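(* For every (nonempty) closed subset $E\subset\mathbb{R}$, every $p$ with $1<p<\infty$ and every $m\in\mathbb{N}$ there exists a continuous linear extension operator which maps the trace space $L^m_p(\mathbb{R})|_E$ into $L^m_p(\mathbb{R})$, whose operator norm is bounded by a constant depending only on $m$. That is, there is a linear map $T:L^m_p(\mathbb{R})|_E\to L^m_p(\mathbb{R})$ with $(Tf)|_E=f$ and $\|Tf\|_{L^m_p(\mathbb{R})}\le C(m)\,\|f\|_{L^m_p(\mathbb{R})|_E}$ for all $f\in L^m_p(\mathbb{R})|_E$. The same statement holds with $W^m_p(\mathbb{R})$ in place of $L^m_p(\mathbb{R})$.
   Context: $L^m_p(\mathbb{R})$ is the space of functions $F:\mathbb{R}\to\mathbb{R}$ such that $F^{(m-1)}$ exists and is (locally) absolutely continuous and $F^{(m)}\in L_p(\mathbb{R})$, seminormed by $\|F\|_{L^m_p(\mathbb{R})}=\|F^{(m)}\|_{L_p(\mathbb{R})}$. $W^m_p(\mathbb{R})$ is the space of all $F\in L^m_p(\mathbb{R})$ whose derivatives of all orders $0,\dots,m$ belong to $L_p(\mathbb{R})$, normed by $\|F\|_{W^m_p(\mathbb{R})}=\sum_{k=0}^m\|F^{(k)}\|_{L_p(\mathbb{R})}$. For $X=L^m_p(\mathbb{R})$ or $X=W^m_p(\mathbb{R})$, the trace space is $X|_E=\{f:E\to\mathbb{R}:\exists F\in X,\ F|_E=f\}$ with trace (semi)norm $\|f\|_{X|_E}=\inf\{\|F\|_X:F\in X,\ F|_E=f\}$. *)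

theory Defs
  imports "HOL-Analysis.Analysis"
begin

(* Epsilon-delta definition; a division is a finite family of closed intervals with pairwise
   disjoint interiors, and K = {Inf K..Sup K} for each of its members. *)
definition absolutely_continuous_fun_on :: "real set \<Rightarrow> (real \<Rightarrow> real) \<Rightarrow> bool" where
  "absolutely_continuous_fun_on S f \<longleftrightarrow>
     (\<forall>\<epsilon>>0. \<exists>\<delta>>0. \<forall>D. D division_of \<Union>D \<and> \<Union>D \<subseteq> S \<and> (\<Sum>K\<in>D. Sup K - Inf K) < \<delta>
        \<longrightarrow> (\<Sum>K\<in>D. \<bar>f (Sup K) - f (Inf K)\<bar>) < \<epsilon>)"

definition locally_absolutely_continuous :: "(real \<Rightarrow> real) \<Rightarrow> bool" where
  "locally_absolutely_continuous f \<longleftrightarrow> (\<forall>a b. absolutely_continuous_fun_on {a..b} f)"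

definition Lp_space :: "real \<Rightarrow> (real \<Rightarrow> real) set" where
  "Lp_space p = {g. g \<in> borel_measurable lebesgue \<and> integrable lebesgue (\<lambda>x. \<bar>g x\<bar> powr p)}"

definition Lp_norm :: "real \<Rightarrow> (real \<Rightarrow> real) \<Rightarrow> real" where
  "Lp_norm p g = (LINT x|lebesgue. \<bar>g x\<bar> powr p) powr (1 / p)"

(* Meant for m > 0 only (m - 1 is truncated). The derivative of order m exists merely almost
   everywhere; on the exceptional null set deriv has an unspecified value, which affects neither
   membership in Lp_space nor Lp_norm. *)
definition hom_Sobolev :: "nat \<Rightarrow> real \<Rightarrow> (real \<Rightarrow> real) set" where
  "hom_Sobolev m p =
     {F. (\<forall>k x. Suc k < m \<longrightarrow> (deriv ^^ k) F differentiable (at x)) \<and>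
         locally_absolutely_continuous ((deriv ^^ (m - 1)) F) \<and>
         (deriv ^^ m) F \<in> Lp_space p}"

definition hom_Sobolev_seminorm :: "nat \<Rightarrow> real \<Rightarrow> (real \<Rightarrow> real) \<Rightarrow> real" where
  "hom_Sobolev_seminorm m p F = Lp_norm p ((deriv ^^ m) F)"

definition Sobolev :: "nat \<Rightarrow> real \<Rightarrow> (real \<Rightarrow> real) set" where
  "Sobolev m p = {F \<in> hom_Sobolev m p. \<forall>k\<le>m. (deriv ^^ k) F \<in> Lp_space p}"

definition Sobolev_norm :: "nat \<Rightarrow> real \<Rightarrow> (real \<Rightarrow> real) \<Rightarrow> real" where
  "Sobolev_norm m p F = (\<Sum>k\<le>m. Lp_norm p ((deriv ^^ k) F))"

(* Functions E \<rightarrow> \<real> are represented by functions on \<real> that are undefined off E, so that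
   an operator on the trace space depends only on the values on E. *)
definition trace_space :: "(real \<Rightarrow> real) set \<Rightarrow> real set \<Rightarrow> (real \<Rightarrow> real) set" where
  "trace_space X E = {f \<in> extensional E. \<exists>F\<in>X. \<forall>x\<in>E. F x = f x}"

definition trace_norm ::
    "(real \<Rightarrow> real) set \<Rightarrow> ((real \<Rightarrow> real) \<Rightarrow> real) \<Rightarrow> real set \<Rightarrow> (real \<Rightarrow> real) \<Rightarrow> real" where
  "trace_norm X N E f = Inf {N F | F. F \<in> X \<and> (\<forall>x\<in>E. F x = f x)}"

definition linear_extension_operator ::
    "(real \<Rightarrow> real) set \<Rightarrow> real set \<Rightarrow> ((real \<Rightarrow> real) \<Rightarrow> (real \<Rightarrow> real)) \<Rightarrow> bool" where
  "linear_extension_operator X E T \<longleftrightarrow>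
     (\<forall>f\<in>trace_space X E. T f \<in> X \<and> (\<forall>x\<in>E. T f x = f x)) \<and>
     (\<forall>f\<in>trace_space X E. \<forall>g\<in>trace_space X E.
        T (\<lambda>x\<in>E. f x + g x) = (\<lambda>x. T f x + T g x)) \<and>
     (\<forall>c. \<forall>f\<in>trace_space X E. T (\<lambda>x\<in>E. c * f x) = (\<lambda>x. c * T f x))"

end

theory Submission
  imports Defs "HOL-Computational_Algebra.Polynomial"
begin

text \<open>
  The proof constructs the operator for finite sets, with a bound that does not depend on the set,
  and then passes to a limit.

  For knots \<open>t\<^sub>0 < \<dots> < t\<^sub>N\<close> let \<open>P\<^sub>i\<close> be the Lagrange polynomial of \<open>f\<close> at \<open>m\<close> consecutive knots starting
  with \<open>t\<^sub>i\<close>, and let \<open>\<chi>\<^sub>i\<close> be a smooth step rising from 0 to 1 inside the largest of the \<open>m\<close> gaps between \<open>t\<^sub>i\<close>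
  and \<open>t\<^bsub>i+m\<^esub>\<close>. Since \<open>P\<^bsub>i+1\<^esub> - P\<^sub>i\<close> vanishes at the knots strictly between \<open>t\<^sub>i\<close> and \<open>t\<^bsub>i+m\<^esub>\<close>, the function
  \<open>P\<^sub>0 + \<Sum>\<^sub>i (P\<^bsub>i+1\<^esub> - P\<^sub>i) \<chi>\<^sub>i\<close> telescopes to an interpolant that is linear in \<open>f\<close>. By Rolle's theorem
  the leading coefficient of \<open>P\<^bsub>i+1\<^esub> - P\<^sub>i\<close> is an increment of the derivative of order \<open>m - 1\<close> of any
  extension \<open>F\<close>, hence at most the integral of the top derivative over \<open>[t\<^sub>i, t\<^bsub>i+m\<^esub>]\<close>; these intervals overlap at most
  \<open>m + 1\<close> times, which gives the norm bound.

  For infinite \<open>E\<close> one takes the limit of these operators along an ultrafilter of finite subsets of \<open>E\<close>.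
  The bound survives because, by a theorem of F. Riesz, membership in \<open>L\<^sub>p\<close> of the derivative of \<open>G\<close> is
  equivalent to a uniform bound of \<open>\<Sum>\<bar>G(b) - G(a)\<bar>\<^sup>p / (b - a)\<^bsup>p-1\<^esup>\<close> over finite families of
  nonoverlapping intervals.

  The inhomogeneous case is reduced to the homogeneous one by adding to \<open>E\<close> the integers at distance more than 1
  from \<open>E\<close> and extending \<open>f\<close> by 0 there: a cutoff of \<open>F\<close> extends this function, and the difference between the
  extension and this cutoff has so many zeros that its lower order derivatives are controlled by the top one.
\<close>

section \<open>Dyadic increments of absolutely continuous functions\<close>

text \<open>Two obstacles shape the construction. Knots may cluster, so a cutoff placed in an
  arbitrary gap could have uncontrollable derivatives. The largest of \<open>m\<close> gaps is at
  least 1/m of its window, and then every term of the Leibniz rule has the same size: leading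
  coefficient divided by window length. Secondly, the operator must be linear in \<open>f\<close>,
  which forbids choosing convergent subsequences for each \<open>f\<close> separately; along an
  ultrafilter all bounded quantities converge at once. Fatou's lemma is a statement about sequences
  and does not apply to such a limit. Riesz sums involve only finitely many values and do pass to
  the limit; Fatou's lemma is applied afterwards, to dyadic Riesz sums of the limit function. A
  constant free of \<open>p\<close> results from keeping every factor inside a power with exponent
  \<open>p\<close>: crude steps such as replacing m + 1 by its power with exponent \<open>p\<close>
  cost only a factor depending on \<open>m\<close> once the root is taken. The construction of the
  operators involves no \<open>p\<close>. Dyadic slopes serve twice, for the fundamental theorem and
  for Riesz's theorem.\<close>

definition dyadic :: "nat \<Rightarrow> int \<Rightarrow> real" where "dyadic n k = of_int k / 2 ^ n"

definition dyadic_incr :: "(real \<Rightarrow> real) \<Rightarrow> nat \<Rightarrow> int \<Rightarrow> real" where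
  "dyadic_incr G n k = G (dyadic n (k + 1)) - G (dyadic n k)"

lemma dyadic_Suc: "dyadic (Suc n) (2 * k) = dyadic n k"
  by (simp add: dyadic_def)

lemma dyadic_incr_split: "dyadic_incr G n k = dyadic_incr G (Suc n) (2 * k) + dyadic_incr G (Suc n) (2 * k + 1)"
proof -
  have "dyadic (Suc n) (2 * k + 1 + 1) = dyadic n (k + 1)" using dyadic_Suc[of n "k+1"] by (simp add: algebra_simps)
  then show ?thesis by (simp add: dyadic_incr_def dyadic_Suc)
qed

lemma dyadic_less [simp]: "dyadic n k < dyadic n l \<longleftrightarrow> k < l" "dyadic n k \<le> dyadic n l \<longleftrightarrow> k \<le> l"
  "dyadic n k = dyadic n l \<longleftrightarrow> k = l"
  by (auto simp: dyadic_def divide_simps)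

lemma dyadic_div2: "dyadic n (k div 2) \<le> dyadic (Suc n) k" "dyadic (Suc n) (k + 1) \<le> dyadic n (k div 2 + 1)"
proof -
  have "2 * (k div 2) \<le> k" "k + 1 \<le> 2 * (k div 2 + 1)" by presburger+
  then have "dyadic (Suc n) (2 * (k div 2)) \<le> dyadic (Suc n) k"
    "dyadic (Suc n) (k + 1) \<le> dyadic (Suc n) (2 * (k div 2 + 1))" by simp_all
  then show "dyadic n (k div 2) \<le> dyadic (Suc n) k" "dyadic (Suc n) (k + 1) \<le> dyadic n (k div 2 + 1)"
    by (simp_all only: dyadic_Suc)
qed

lemma dyadic_Suc_minus: "dyadic n (k + 1) - dyadic n k = 1 / 2 ^ n"
  by (simp add: dyadic_def field_simps)

lemma dyadic_floor_iff: "\<lfloor>2 ^ n * x\<rfloor> = k \<longleftrightarrow> dyadic n k \<le> x \<and> x < dyadic n (k + 1)"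
  by (auto simp: dyadic_def floor_eq_iff field_simps)

lemma dyadic_floor_Suc: "\<lfloor>2 ^ Suc n * x\<rfloor> div 2 = \<lfloor>2 ^ n * (x::real)\<rfloor>"
proof -
  have "\<lfloor>2 ^ n * x\<rfloor> = \<lfloor>(2 ^ Suc n * x) / of_int 2\<rfloor>" by simp
  also have "\<dots> = \<lfloor>2 ^ Suc n * x\<rfloor> div 2" by (subst floor_divide_real_eq_div) auto
  finally show ?thesis by simp
qed

lemma finite_div2_vimage: assumes "finite (B :: int set)" shows "finite {k. k div 2 \<in> B}"
proof -
  have "{k. k div 2 \<in> B} \<subseteq> (\<lambda>k. 2 * k) ` B \<union> (\<lambda>k. 2 * k + 1) ` B"
  proof
    fix k assume "k \<in> {k. k div 2 \<in> B}"
    then have "k div 2 \<in> B" by simp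
    moreover have "k = 2 * (k div 2) \<or> k = 2 * (k div 2) + 1" by presburger
    ultimately show "k \<in> (\<lambda>k. 2 * k) ` B \<union> (\<lambda>k. 2 * k + 1) ` B" by blast
  qed
  then show ?thesis using assms finite_subset by blast
qed

lemma sum_div2_vimage:
  fixes g :: "int \<Rightarrow> real"
  assumes "finite B"
  shows "(\<Sum>k | k div 2 \<in> B. g k) = (\<Sum>k\<in>B. g (2 * k) + g (2 * k + 1))"
proof -
  have eq: "{k. k div 2 \<in> B} = (\<lambda>k. 2 * k) ` B \<union> (\<lambda>k. 2 * k + 1) ` B"
  proof (intro equalityI subsetI)
    fix k assume "k \<in> {k. k div 2 \<in> B}"
    then have "k div 2 \<in> B" by simp
    moreover have "k = 2 * (k div 2) \<or> k = 2 * (k div 2) + 1" by presburger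
    ultimately show "k \<in> (\<lambda>k. 2 * k) ` B \<union> (\<lambda>k. 2 * k + 1) ` B" by blast
  qed auto
  have disj: "(\<lambda>k. 2 * k) ` B \<inter> (\<lambda>k. 2 * k + 1) ` B = {}"
    by (auto; presburger)
  show ?thesis unfolding eq
    by (subst sum.union_disjoint)
      (use assms disj in \<open>auto simp: sum.reindex inj_on_def sum.distrib\<close>)
qed

lemma dyadic_division:
  fixes n :: nat
  assumes "finite B"
  defines "D \<equiv> (\<lambda>k. {dyadic n k..dyadic n (k + 1)}) ` B"
  shows "D division_of \<Union>D" "inj_on (\<lambda>k. {dyadic n k..dyadic n (k + 1)}) B"
proof -
  show inj: "inj_on (\<lambda>k. {dyadic n k..dyadic n (k + 1)}) B"
    by (auto simp: inj_on_def Icc_eq_Icc)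
  have "interior K \<inter> interior L = {}" if KL: "K \<in> D" "L \<in> D" "K \<noteq> L" for K L
  proof -
    obtain k l where kl: "K = {dyadic n k..dyadic n (k + 1)}" "L = {dyadic n l..dyadic n (l + 1)}" "k \<noteq> l"
      using KL unfolding D_def by blast
    have "k + 1 \<le> l \<or> l + 1 \<le> k" using kl(3) by linarith
    then have "dyadic n (k + 1) \<le> dyadic n l \<or> dyadic n (l + 1) \<le> dyadic n k" by simp
    then show ?thesis by (auto simp: kl interior_atLeastAtMost_real)
  qed
  then show "D division_of \<Union>D"
    unfolding division_of_def using assms(1) by (auto simp: D_def cbox_interval)
qed

lemma AC_dyadic:
  assumes ac: "absolutely_continuous_fun_on S G" and "\<epsilon> > 0"
  obtains \<delta> where "\<delta> > 0"
    "\<And>n B. finite B \<Longrightarrow> (\<And>k. k \<in> B \<Longrightarrow> {dyadic n k..dyadic n (k + 1)} \<subseteq> S) \<Longrightarrow> card B / 2 ^ n < \<delta> \<Longrightarrow>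
       (\<Sum>k\<in>B. \<bar>dyadic_incr G n k\<bar>) < \<epsilon>"
proof -
  obtain \<delta> where d: "\<delta> > 0" "\<And>D. D division_of \<Union>D \<Longrightarrow> \<Union>D \<subseteq> S \<Longrightarrow> (\<Sum>K\<in>D. Sup K - Inf K) < \<delta>
        \<Longrightarrow> (\<Sum>K\<in>D. \<bar>G (Sup K) - G (Inf K)\<bar>) < \<epsilon>"
    using assms unfolding absolutely_continuous_fun_on_def by meson
  show thesis
  proof (rule that[OF d(1)])
    fix n and B :: "int set"
    assume B: "finite B" "\<And>k. k \<in> B \<Longrightarrow> {dyadic n k..dyadic n (k + 1)} \<subseteq> S" "card B / 2 ^ n < \<delta>"
    let ?D = "(\<lambda>k. {dyadic n k..dyadic n (k + 1)}) ` B"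
    note D = dyadic_division[OF B(1), of n]
    have "(\<Sum>K\<in>?D. Sup K - Inf K) = (\<Sum>k\<in>B. 1 / 2 ^ n)"
      using D(2) by (simp add: sum.reindex dyadic_Suc_minus)
    also have "\<dots> < \<delta>" using B(3) by simp
    finally have "(\<Sum>K\<in>?D. \<bar>G (Sup K) - G (Inf K)\<bar>) < \<epsilon>"
      by (intro d(2) D(1)) (use B(2) in auto)
    also have "(\<Sum>K\<in>?D. \<bar>G (Sup K) - G (Inf K)\<bar>) = (\<Sum>k\<in>B. \<bar>dyadic_incr G n k\<bar>)"
      using D(2) by (simp add: sum.reindex dyadic_incr_def)
    finally show "(\<Sum>k\<in>B. \<bar>dyadic_incr G n k\<bar>) < \<epsilon>" .
  qed
qed

text \<open>\<open>badset good k0 j\<close> consists of the dyadic intervals of generation \<open>j\<close> below \<open>k0\<close> that are not contained in a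
  good interval of generation at most \<open>j\<close>.\<close>
primrec badset :: "(nat \<Rightarrow> int \<Rightarrow> bool) \<Rightarrow> int \<Rightarrow> nat \<Rightarrow> int set" where
  "badset good k0 0 = (if good 0 k0 then {} else {k0})"
| "badset good k0 (Suc j) = {k. k div 2 \<in> badset good k0 j \<and> \<not> good (Suc j) k}"

lemma finite_badset: "finite (badset good k0 j)"
proof (induction j)
  case (Suc j)
  then show ?case by (auto intro: finite_subset[OF _ finite_div2_vimage[OF Suc]])
qed auto

text \<open>Generations in \<open>good\<close> and \<open>badset\<close> are counted from
  \<open>n\<close>. In terms of points, \<open>x\<close> is still bad if no dyadic interval around
  it of these generations is good; this makes the union of the bad intervals decrease with
  \<open>j\<close> and ties it to an almost everywhere hypothesis.\<close>

lemma badset_floor: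
  "\<lfloor>2 ^ (n + j) * x\<rfloor> \<in> badset good k0 j \<longleftrightarrow>
     \<lfloor>2 ^ n * x\<rfloor> = k0 \<and> (\<forall>i\<le>j. \<not> good i \<lfloor>2 ^ (n + i) * x\<rfloor>)" for x :: real
proof (induction j)
  case (Suc j)
  show ?case
    using Suc dyadic_floor_Suc[of "n + j" x] by (auto simp: le_Suc_eq)
qed auto

text \<open>The good intervals split off so far have total length
  \<open>1 / 2 ^ n - card (badset good k0 j) / 2 ^ (n + j)\<close> and contribute at most
  \<open>\<eta>\<close> times that. In the induction every bad interval is halved, and the halves
  that turn out good move from the sum to this account.\<close>

lemma badset_estimate:
  assumes "\<And>j k. good j k \<Longrightarrow> \<bar>dyadic_incr H (n + j) k\<bar> \<le> \<eta> / 2 ^ (n + j)" "\<eta> \<ge> 0"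
  shows "\<bar>dyadic_incr H n k0\<bar> \<le> \<eta> / 2 ^ n - \<eta> * card (badset good k0 j) / 2 ^ (n + j)
           + (\<Sum>k\<in>badset good k0 j. \<bar>dyadic_incr H (n + j) k\<bar>)"
proof (induction j)
  case 0
  then show ?case using assms(1)[of 0 k0] by auto
next
  case (Suc j)
  let ?B = "badset good k0 j" and ?B' = "badset good k0 (Suc j)"
  let ?C = "{k. k div 2 \<in> ?B}"
  let ?g = "\<lambda>k. \<bar>dyadic_incr H (n + Suc j) k\<bar>"
  have fin: "finite ?C" "finite ?B" using finite_badset finite_div2_vimage by blast+
  have sub: "?B' \<subseteq> ?C" by auto
  have "(\<Sum>k\<in>?B. \<bar>dyadic_incr H (n + j) k\<bar>) \<le> (\<Sum>k\<in>?B. ?g (2 * k) + ?g (2 * k + 1))"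
    by (rule sum_mono) (subst dyadic_incr_split, simp)
  also have "\<dots> = (\<Sum>k\<in>?C. ?g k)" using sum_div2_vimage[OF fin(2)] by simp
  also have "\<dots> = (\<Sum>k\<in>?C - ?B'. ?g k) + (\<Sum>k\<in>?B'. ?g k)"
    using sum.subset_diff[OF sub fin(1)] by blast
  also have "(\<Sum>k\<in>?C - ?B'. ?g k) \<le> (\<Sum>k\<in>?C - ?B'. \<eta> / 2 ^ (n + Suc j))"
    by (rule sum_mono) (use assms(1)[of "Suc j"] in auto)
  also have "\<dots> = real (card ?C - card ?B') * (\<eta> / 2 ^ (n + Suc j))"
    using card_Diff_subset[OF finite_subset[OF sub fin(1)] sub] by simp
  also have "\<dots> = (real (card ?C) - card ?B') * (\<eta> / 2 ^ (n + Suc j))"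
    using card_mono[OF fin(1) sub] by (simp add: of_nat_diff)
  also have "real (card ?C) = 2 * card ?B"
    using sum_div2_vimage[OF fin(2), of "\<lambda>_. 1"] by simp
  finally have "(\<Sum>k\<in>?B. \<bar>dyadic_incr H (n + j) k\<bar>)
     \<le> (2 * real (card ?B) - card ?B') * (\<eta> / 2 ^ (n + Suc j)) + (\<Sum>k\<in>?B'. ?g k)" by simp
  moreover have "(2 * real (card ?B) - card ?B') * (\<eta> / 2 ^ (n + Suc j)) =
     \<eta> * card ?B / 2 ^ (n + j) - \<eta> * card ?B' / 2 ^ (n + Suc j)"
    by (simp add: field_simps)
  ultimately show ?case using Suc by linarith
qed

text \<open>The maximal good dyadic intervals contribute little to the increment by their definition, the remaining ones
  contribute little because their total length tends to 0.\<close>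
lemma AC_const_dyadic:
  assumes ac: "locally_absolutely_continuous H"
    and ae: "AE x::real in lebesgue. \<forall>\<eta>>0. \<forall>n. \<exists>N\<ge>n. \<bar>dyadic_incr H N \<lfloor>2 ^ N * x\<rfloor>\<bar> \<le> \<eta> / 2 ^ N"
  shows "dyadic_incr H n k = 0"
proof -
  have "\<bar>dyadic_incr H n k\<bar> \<le> \<eta> / 2 ^ n + \<eta>" if "\<eta> > 0" for \<eta>
  proof -
    define good where "good j k \<longleftrightarrow> \<bar>dyadic_incr H (n + j) k\<bar> \<le> \<eta> / 2 ^ (n + j)" for j k
    define A where "A j = {x :: real. \<lfloor>2 ^ (n + j) * x\<rfloor> \<in> badset good k j}" for j
    let ?I = "\<lambda>j k. {dyadic (n + j) k..<dyadic (n + j) (k + 1)}"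
    have A_eq: "A j = (\<Union>k\<in>badset good k j. ?I j k)" for j
    proof (intro set_eqI iffI)
      fix x assume "x \<in> A j"
      then show "x \<in> (\<Union>k\<in>badset good k j. ?I j k)"
        using dyadic_floor_iff[of "n + j" x "\<lfloor>2 ^ (n + j) * x\<rfloor>"] unfolding A_def by auto
    next
      fix x assume "x \<in> (\<Union>k\<in>badset good k j. ?I j k)"
      then obtain l where "l \<in> badset good k j" "dyadic (n + j) l \<le> x" "x < dyadic (n + j) (l + 1)" by auto
      then show "x \<in> A j" unfolding A_def using dyadic_floor_iff[of "n + j" x l] by simp
    qed
    have meas: "A j \<in> sets lebesgue" for j
      unfolding A_eq using finite_badset by (intro sets.finite_UN) auto
    have disj: "disjoint_family_on (?I j) B" for j B
      unfolding disjoint_family_on_def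
    proof (intro ballI impI)
      fix a b :: int assume "a \<noteq> b"
      then have "a + 1 \<le> b \<or> b + 1 \<le> a" by linarith
      then have "dyadic (n + j) (a + 1) \<le> dyadic (n + j) b \<or> dyadic (n + j) (b + 1) \<le> dyadic (n + j) a" by simp
      then show "?I j a \<inter> ?I j b = {}" by auto
    qed
    have emA: "emeasure lebesgue (A j) = ennreal (card (badset good k j) / 2 ^ (n + j))" for j
    proof -
      have "emeasure lebesgue (A j) = (\<Sum>k\<in>badset good k j. emeasure lebesgue (?I j k))"
        unfolding A_eq by (rule sum_emeasure[symmetric]) (use disj finite_badset in auto)
      also have "\<dots> = (\<Sum>k\<in>badset good k j. ennreal (1 / 2 ^ (n + j)))"
        by (rule sum.cong) (simp_all add: dyadic_Suc_minus)
      also have "\<dots> = ennreal (\<Sum>k\<in>badset good k j. 1 / 2 ^ (n + j))" by (rule sum_ennreal) simp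
      finally show ?thesis by simp
    qed
    have A_iff: "x \<in> A j \<longleftrightarrow> \<lfloor>2 ^ n * x\<rfloor> = k \<and> (\<forall>i\<le>j. \<not> good i \<lfloor>2 ^ (n + i) * x\<rfloor>)" for x j
      unfolding A_def using badset_floor by simp
    have "decseq A"
      by (rule decseq_SucI) (auto simp: A_iff)
    then have "(\<lambda>j. emeasure lebesgue (A j)) \<longlonglongrightarrow> emeasure lebesgue (\<Inter>j. A j)"
      by (intro Lim_emeasure_decseq) (use meas emA in auto)
    moreover have "emeasure lebesgue (\<Inter>j. A j) = 0"
    proof -
      \<comment> \<open>The hypothesis supplies a good interval around almost every point; its
        generation \<open>N\<close> has number \<open>N - n\<close> in the count relative to
        \<open>n\<close>.\<close>
      have "AE x in lebesgue. x \<notin> (\<Inter>j. A j)"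
        using ae
      proof eventually_elim
        case (elim x)
        then obtain N where N: "N \<ge> n" "\<bar>dyadic_incr H N \<lfloor>2 ^ N * x\<rfloor>\<bar> \<le> \<eta> / 2 ^ N" using \<open>\<eta> > 0\<close> by blast
        then have "good (N - n) \<lfloor>2 ^ (n + (N - n)) * x\<rfloor>" by (simp add: good_def del: power_add)
        then have "x \<notin> A (N - n)" by (auto simp: A_iff)
        then show ?case by blast
      qed
      show ?thesis
      proof -
        have mI: "(\<Inter>j. A j) \<in> sets lebesgue" using meas by (intro sets.countable_INT) auto
        have "(\<Inter>j. A j) \<in> null_sets lebesgue"
          using \<open>AE x in lebesgue. x \<notin> (\<Inter>j. A j)\<close> AE_iff_null_sets[OF mI] by blast
        then show ?thesis by (rule null_setsD1)
      qed
    qed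
    ultimately have "(\<lambda>j. emeasure lebesgue (A j)) \<longlonglongrightarrow> 0" by simp
    then have lim: "(\<lambda>j. card (badset good k j) / 2 ^ (n + j)) \<longlonglongrightarrow> 0"
      unfolding emA using tendsto_ennreal_iff[of "\<lambda>j. card (badset good k j) / 2 ^ (n + j)" sequentially 0]
      by simp
    \<comment> \<open>Absolute continuity enters here: \<open>\<delta>\<close> depends only on the
      base interval and on \<open>\<eta>\<close>, so \<open>j\<close> can afterwards be chosen to
      make the total bad length smaller.\<close>
    obtain \<delta> where d: "\<delta> > 0" "\<And>N B. finite B \<Longrightarrow>
        (\<And>l. l \<in> B \<Longrightarrow> {dyadic N l..dyadic N (l + 1)} \<subseteq> {dyadic n k..dyadic n (k + 1)}) \<Longrightarrow>
        card B / 2 ^ N < \<delta> \<Longrightarrow> (\<Sum>k\<in>B. \<bar>dyadic_incr H N k\<bar>) < \<eta>"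
      using ac \<open>\<eta> > 0\<close> AC_dyadic[of "{dyadic n k..dyadic n (k + 1)}" H \<eta>]
      unfolding locally_absolutely_continuous_def by blast
    obtain j where j: "card (badset good k j) / 2 ^ (n + j) < \<delta>"
      using order_tendstoD(2)[OF lim d(1)] by (auto simp: eventually_sequentially)
    have subI: "{dyadic (n + j) l..dyadic (n + j) (l + 1)} \<subseteq> {dyadic n k..dyadic n (k + 1)}" if "l \<in> badset good k j" for l
      using that
    proof (induction j arbitrary: l)
      case (Suc j)
      have "l div 2 \<in> badset good k j" using Suc.prems by simp
      then show ?case
        using Suc.IH[of "l div 2"] dyadic_div2[of "n + j" l] by auto
    qed (auto split: if_splits)
    have "\<bar>dyadic_incr H n k\<bar> \<le> \<eta> / 2 ^ n - \<eta> * card (badset good k j) / 2 ^ (n + j)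
           + (\<Sum>k\<in>badset good k j. \<bar>dyadic_incr H (n + j) k\<bar>)"
      by (rule badset_estimate) (use \<open>\<eta> > 0\<close> in \<open>auto simp: good_def\<close>)
    also have "\<dots> \<le> \<eta> / 2 ^ n + \<eta>"
    proof -
      have "(\<Sum>k\<in>badset good k j. \<bar>dyadic_incr H (n + j) k\<bar>) < \<eta>"
        by (rule d(2)[OF finite_badset subI j])
      moreover have "0 \<le> \<eta> * card (badset good k j) / 2 ^ (n + j)" using \<open>\<eta> > 0\<close> by simp
      ultimately show ?thesis by linarith
    qed
    finally show ?thesis .
  qed
  then have *: "\<bar>dyadic_incr H n k\<bar> \<le> \<eta> * (1 / 2 ^ n + 1)" if "\<eta> > 0" for \<eta>
    using that by (simp add: algebra_simps)
  have "\<bar>dyadic_incr H n k\<bar> \<le> 0 + e" if "e > 0" for e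
  proof -
    have pos: "(1 / 2 ^ n + 1 :: real) > 0" by (simp add: add_pos_pos)
    show ?thesis using *[of "e / (1 / 2 ^ n + 1)"] that pos by simp
  qed
  then have "\<bar>dyadic_incr H n k\<bar> \<le> 0" by (rule field_le_epsilon)
  then show ?thesis by simp
qed

section \<open>Dyadic difference quotients\<close>

definition dyadic_slope :: "(real \<Rightarrow> real) \<Rightarrow> nat \<Rightarrow> real \<Rightarrow> real" where
  "dyadic_slope G n x = 2 ^ n * dyadic_incr G n \<lfloor>2 ^ n * x\<rfloor>"

lemma borel_measurable_dyadic_slope [measurable]: "dyadic_slope G n \<in> borel_measurable borel"
proof -
  have "(\<lambda>x::real. \<lfloor>2 ^ n * x\<rfloor>) \<in> borel \<rightarrow>\<^sub>M count_space UNIV"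
    by (rule measurable_compose[OF _ measurable_real_floor]) simp
  then have "dyadic_incr G n \<circ> (\<lambda>x::real. \<lfloor>2 ^ n * x\<rfloor>) \<in> borel_measurable borel"
    by (rule measurable_comp) simp
  then show ?thesis unfolding dyadic_slope_def comp_def by simp
qed

lemma dyadic_slope_eqI: "x \<in> {dyadic n k..<dyadic n (k + 1)} \<Longrightarrow> dyadic_slope G n x = 2 ^ n * dyadic_incr G n k"
  using dyadic_floor_iff[of n x k] by (simp add: dyadic_slope_def)

text \<open>The dyadic interval straddles \<open>x\<close>. The first order errors at its two ends
  are proportional to the distances of the ends from \<open>x\<close>, and these distances add up to
  the length of the interval.\<close>

lemma DERIV_dyadic_slope:
  assumes "(G has_real_derivative L) (at x)"
  shows "(\<lambda>n. dyadic_slope G n x) \<longlonglongrightarrow> L"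
proof (rule LIMSEQ_I)
  fix r :: real assume "r > 0"
  then have r: "r / 2 > 0" by simp
  have "(G has_derivative (\<lambda>h. L * h)) (at x)"
    using assms by (simp add: has_field_derivative_def)
  then obtain d where d: "d > 0" "\<And>y. norm (y - x) < d \<Longrightarrow> norm (G y - G x - L * (y - x)) \<le> r / 2 * norm (y - x)"
    using r unfolding has_derivative_at_alt by metis
  obtain N where N: "(1 / 2) ^ N < d" using real_arch_pow_inv[of d "1/2"] d(1) by auto
  have "norm (dyadic_slope G n x - L) < r" if "n \<ge> N" for n
  proof -
    define k where "k = \<lfloor>2 ^ n * x\<rfloor>"
    let ?a = "dyadic n k" and ?b = "dyadic n (k + 1)"
    have k: "?a \<le> x" "x < ?b" using dyadic_floor_iff[of n x k] k_def by auto
    have len: "?b - ?a = 1 / 2 ^ n" by (rule dyadic_Suc_minus)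
    have "(1 / 2) ^ n \<le> ((1 / 2) ^ N :: real)" using that by (intro power_decreasing) auto
    then have small: "1 / 2 ^ n < d" using N by (simp add: power_divide)
    have "\<bar>G ?a - G x - L * (?a - x)\<bar> \<le> r / 2 * (x - ?a)" "\<bar>G ?b - G x - L * (?b - x)\<bar> \<le> r / 2 * (?b - x)"
      using d(2)[of ?a] d(2)[of ?b] k len small by auto
    then have "\<bar>G ?b - G ?a - L * (?b - ?a)\<bar> \<le> r / 2 * (?b - ?a)"
      unfolding abs_le_iff by (simp add: algebra_simps)
    then have "\<bar>dyadic_incr G n k - L / 2 ^ n\<bar> \<le> r / 2 / 2 ^ n"
      unfolding len dyadic_incr_def by simp
    then have "\<bar>dyadic_slope G n x - L\<bar> \<le> r / 2"
      unfolding dyadic_slope_def k_def[symmetric] by (simp add: abs_le_iff field_simps)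
    then show ?thesis using \<open>r > 0\<close> by simp
  qed
  then show "\<exists>no. \<forall>n\<ge>no. norm (dyadic_slope G n x - L) < r" by blast
qed

section \<open>Dyadic variation and the accumulation function of the slopes\<close>

lemma int_div_bounds: "0 < d \<Longrightarrow> k div d * d \<le> k \<and> k < (k div d + 1) * d" for d k :: int
proof -
  assume "0 < d"
  then have "k div d * d + k mod d = k" "0 \<le> k mod d" "k mod d < d" by simp_all
  moreover have "(k div d + 1) * d = k div d * d + d" by (simp add: algebra_simps)
  ultimately show ?thesis by linarith
qed

text \<open>A cell of length \<open>1 / 2 ^ n1\<close>, shorter than the \<open>\<delta>\<close>
  that belongs to the tolerance 1, has dyadic variation below 1 at every finer generation. The bound
  counts these cells.\<close>

lemma AC_dyadic_bounded_variation:
  assumes "locally_absolutely_continuous G"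
  shows "\<exists>V n1. \<forall>n\<ge>n1. (\<Sum>k\<in>{- int N * 2 ^ n..<int N * 2 ^ n}. \<bar>dyadic_incr G n k\<bar>) \<le> V"
proof -
  obtain \<delta> where d: "\<delta> > 0" "\<And>n B. finite B \<Longrightarrow>
        (\<And>k. k \<in> B \<Longrightarrow> {dyadic n k..dyadic n (k + 1)} \<subseteq> {- real N..real N}) \<Longrightarrow>
        card B / 2 ^ n < \<delta> \<Longrightarrow> (\<Sum>k\<in>B. \<bar>dyadic_incr G n k\<bar>) < 1"
    using assms AC_dyadic[of "{- real N..real N}" G 1]
    unfolding locally_absolutely_continuous_def by (metis zero_less_one)
  obtain n1 where n1: "(1 / 2) ^ n1 < \<delta>" using real_arch_pow_inv[of \<delta> "1/2"] d(1) by auto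
  have "(\<Sum>k\<in>{- int N * 2 ^ n..<int N * 2 ^ n}. \<bar>dyadic_incr G n k\<bar>) \<le> 2 * N * 2 ^ n1" if "n \<ge> n1" for n
  proof -
    \<comment> \<open>\<open>l div 2 ^ e\<close> is the index of the cell of generation
      \<open>n1\<close> that contains the interval number \<open>l\<close> of generation
      \<open>n\<close>.\<close>
    define e where "e = n - n1"
    have n: "n = n1 + e" using that e_def by simp
    let ?S = "{- int N * 2 ^ n..<int N * 2 ^ n}" and ?T = "{- int N * 2 ^ n1..<int N * 2 ^ n1}"
    have sub: "(\<lambda>l. l div 2 ^ e) ` ?S \<subseteq> ?T"
    proof (clarsimp, intro conjI)
      fix l assume l: "- (int N * 2 ^ n) \<le> l" "l < int N * 2 ^ n"
      show "- (int N * 2 ^ n1) \<le> l div 2 ^ e"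
        using l(1) zdiv_mono1[of "- (int N * 2 ^ n1) * 2 ^ e" l "2 ^ e"]
        by (simp only: n power_add nonzero_mult_div_cancel_right[of "2 ^ e"]) (simp add: mult.assoc)
      show "l div 2 ^ e < int N * 2 ^ n1"
        using l(2) int_div_bounds[of "2 ^ e" l]
        by (simp add: n power_add mult.assoc[symmetric]) (smt (verit) mult_right_less_imp_less zero_le_power mult_less_cancel_right)
    qed
    have "(\<Sum>k\<in>?S. \<bar>dyadic_incr G n k\<bar>) = (\<Sum>y\<in>?T. \<Sum>k | k \<in> ?S \<and> k div 2 ^ e = y. \<bar>dyadic_incr G n k\<bar>)"
      by (rule sum.group[symmetric]) (use sub in auto)
    also have "\<dots> \<le> (\<Sum>y\<in>?T. 1)"
    proof (intro sum_mono less_imp_le)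
      fix y assume "y \<in> ?T"
      let ?B = "{k. k \<in> ?S \<and> k div 2 ^ e = y}"
      have "?B \<subseteq> {y * 2 ^ e..<(y + 1) * 2 ^ e}"
        using int_div_bounds[of "2 ^ e"] by auto
      then have "card ?B \<le> card {y * 2 ^ e..<(y + 1) * 2 ^ e}" by (intro card_mono) auto
      also have "\<dots> = 2 ^ e" by (simp add: algebra_simps nat_power_eq)
      finally have "real (card ?B) \<le> 2 ^ e" using of_nat_le_iff[of "card ?B" "2 ^ e", where ?'a = real] by simp
      then have "card ?B / 2 ^ n \<le> 1 / 2 ^ n1" by (simp add: n power_add field_simps)
      then have "card ?B / 2 ^ n < \<delta>" using n1 by (simp add: power_divide)
      moreover have "{dyadic n k..dyadic n (k + 1)} \<subseteq> {- real N..real N}" if "k \<in> ?B" for k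
      proof -
        have "- int N * 2 ^ n \<le> k" "k + 1 \<le> int N * 2 ^ n" using that by auto
        then have "dyadic n (- int N * 2 ^ n) \<le> dyadic n k" "dyadic n (k + 1) \<le> dyadic n (int N * 2 ^ n)"
          by (simp_all only: dyadic_less)
        then show ?thesis by (simp add: dyadic_def)
      qed
      ultimately show "(\<Sum>k\<in>?B. \<bar>dyadic_incr G n k\<bar>) < 1"
        by (intro d(2)) (auto intro: finite_subset[of _ ?S])
    qed
    also have "\<dots> = 2 * N * 2 ^ n1" by (simp add: nat_mult_distrib nat_power_eq)
    finally show ?thesis .
  qed
  then show ?thesis by blast
qed

text \<open>The slope is constant on dyadic intervals. A general \<open>\<phi>\<close> is kept
  because two are needed: the absolute value for the accumulation function, and its power with
  exponent \<open>p\<close> for Riesz's theorem.\<close>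

lemma nn_integral_dyadic_slope:
  fixes N :: nat
  assumes "\<And>x. \<phi> x \<ge> (0 :: real)"
  shows "(\<integral>\<^sup>+x\<in>{- real N..<real N}. ennreal (\<phi> (dyadic_slope G n x)) \<partial>lborel)
    \<le> ennreal ((\<Sum>k\<in>{- int N * 2 ^ n..<int N * 2 ^ n}. \<phi> (2 ^ n * dyadic_incr G n k)) / 2 ^ n)"
proof -
  let ?S = "{- int N * 2 ^ n..<int N * 2 ^ n}"
  let ?I = "\<lambda>k. {dyadic n k..<dyadic n (k + 1)}"
  have "(\<integral>\<^sup>+x\<in>{- real N..<real N}. ennreal (\<phi> (dyadic_slope G n x)) \<partial>lborel)
    \<le> (\<integral>\<^sup>+x. (\<Sum>k\<in>?S. ennreal (\<phi> (2 ^ n * dyadic_incr G n k)) * indicator (?I k) x) \<partial>lborel)"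
  proof (rule nn_integral_mono)
    fix x :: real
    show "ennreal (\<phi> (dyadic_slope G n x)) * indicator {- real N..<real N} x
      \<le> (\<Sum>k\<in>?S. ennreal (\<phi> (2 ^ n * dyadic_incr G n k)) * indicator (?I k) x)"
    proof (cases "x \<in> {- real N..<real N}")
      case True
      define k where "k = \<lfloor>2 ^ n * x\<rfloor>"
      have kI: "x \<in> ?I k" using dyadic_floor_iff[of n x k] k_def by auto
      have "- (real N * 2 ^ n) \<le> 2 ^ n * x" "2 ^ n * x < real N * 2 ^ n"
        using True mult_right_mono[of "- real N" x "2 ^ n"] mult_strict_right_mono[of x "real N" "2 ^ n"]
        by (auto simp: mult.commute)
      then have kS: "k \<in> ?S" unfolding k_def by (auto simp: le_floor_iff floor_less_iff)
      have "ennreal (\<phi> (2 ^ n * dyadic_incr G n k)) * indicator (?I k) x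
        \<le> (\<Sum>k\<in>?S. ennreal (\<phi> (2 ^ n * dyadic_incr G n k)) * indicator (?I k) x)"
        by (rule member_le_sum[OF kS]) auto
      then show ?thesis using kI True dyadic_slope_eqI[OF kI] by simp
    qed simp
  qed
  also have "\<dots> = (\<Sum>k\<in>?S. ennreal (\<phi> (2 ^ n * dyadic_incr G n k)) * emeasure lborel (?I k))"
    by (subst nn_integral_sum) (auto simp: nn_integral_cmult)
  also have "\<dots> = (\<Sum>k\<in>?S. ennreal (\<phi> (2 ^ n * dyadic_incr G n k) / 2 ^ n))"
    by (rule sum.cong) (auto simp: dyadic_Suc_minus ennreal_mult[symmetric] assms)
  also have "\<dots> = ennreal (\<Sum>k\<in>?S. \<phi> (2 ^ n * dyadic_incr G n k) / 2 ^ n)"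
    by (rule sum_ennreal) (simp add: assms)
  finally show ?thesis by (simp add: sum_divide_distrib)
qed

text \<open>The slopes need not converge, but almost everywhere \<open>liminf \<bar>q n\<bar>\<close> is finite by Fatou's lemma. Then one of
  the two numbers \<open>\<plusminus>liminf \<bar>q n\<bar>\<close> is an accumulation point; \<open>accu q\<close> selects it measurably. The junk value for
  an infinite \<open>liminf\<close> is 0.\<close>
definition accu_abs :: "(nat \<Rightarrow> real) \<Rightarrow> real" where
  "accu_abs q = enn2real (liminf (\<lambda>n. ennreal \<bar>q n\<bar>))"

definition accu :: "(nat \<Rightarrow> real) \<Rightarrow> real" where
  "accu q = (if liminf (\<lambda>n. ennreal \<bar>q n - accu_abs q\<bar>) = 0 then accu_abs q else - accu_abs q)"

text \<open>With \<open>r\<close> the lower limit, the absolute values are eventually above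
  \<open>r - c\<close> and infinitely often below \<open>r + c\<close>. If \<open>r\<close> itself
  is not approached, then eventually \<open>q n\<close> keeps a fixed distance from
  \<open>r\<close>; at the indices where its absolute value is close to \<open>r\<close> it must be
  negative, hence close to \<open>- r\<close>.\<close>

lemma frequently_accu:
  assumes fin: "liminf (\<lambda>n. ennreal \<bar>q n\<bar>) < \<infinity>" and "\<eta> > 0"
  shows "\<exists>\<^sub>F n in sequentially. \<bar>q n - accu q\<bar> < \<eta>"
proof -
  define r where "r = accu_abs q"
  have r: "ennreal r = liminf (\<lambda>n. ennreal \<bar>q n\<bar>)" "r \<ge> 0"
    unfolding r_def accu_abs_def using fin by (auto simp: ennreal_enn2real_if)
  have freq: "\<exists>\<^sub>F n in sequentially. \<bar>\<bar>q n\<bar> - r\<bar> < c" if "c > 0" for c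
  proof -
    have "\<exists>\<^sub>F n in sequentially. \<bar>q n\<bar> < r + c"
    proof (rule ccontr)
      assume "\<not> ?thesis"
      then have "\<forall>\<^sub>F n in sequentially. ennreal (r + c) \<le> ennreal \<bar>q n\<bar>"
        by (auto simp: not_frequently not_less elim!: eventually_mono intro: ennreal_leI)
      then have "ennreal (r + c) \<le> ennreal r" unfolding r by (rule Liminf_bounded)
      then show False using that r(2) by (simp add: ennreal_le_iff)
    qed
    moreover have "\<forall>\<^sub>F n in sequentially. r - c < \<bar>q n\<bar>"
    proof (cases "r > 0")
      case True
      have "ennreal (max 0 (r - c)) < liminf (\<lambda>n. ennreal \<bar>q n\<bar>)"
        unfolding r(1)[symmetric] using that True by (simp add: ennreal_less_iff)
      then have "\<forall>\<^sub>F n in sequentially. ennreal (max 0 (r - c)) < ennreal \<bar>q n\<bar>" by (rule less_LiminfD)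
      then show ?thesis by (rule eventually_mono) (simp add: ennreal_less_iff)
    next
      case False
      then have "r - c < \<bar>q n\<bar>" for n using that r(2) abs_ge_zero[of "q n"] by linarith
      then show ?thesis by simp
    qed
    ultimately have "\<exists>\<^sub>F n in sequentially. \<bar>q n\<bar> < r + c \<and> r - c < \<bar>q n\<bar>"
      by (rule frequently_eventually_frequently)
    then show ?thesis by (rule frequently_elim1) auto
  qed
  show ?thesis
  proof (cases "liminf (\<lambda>n. ennreal \<bar>q n - r\<bar>) = 0")
    case True
    show ?thesis
    proof (rule ccontr)
      assume "\<not> ?thesis"
      then have "\<forall>\<^sub>F n in sequentially. ennreal \<eta> \<le> ennreal \<bar>q n - r\<bar>"
        using True by (auto simp: accu_def r_def not_frequently not_less elim!: eventually_mono intro: ennreal_leI)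
      then have "ennreal \<eta> \<le> 0" unfolding True[symmetric] by (rule Liminf_bounded)
      then show False using \<open>\<eta> > 0\<close> by simp
    qed
  next
    case False
    then have "0 < liminf (\<lambda>n. ennreal \<bar>q n - r\<bar>)" by (simp add: zero_less_iff_neq_zero)
    then obtain y where y: "0 < y" "y < liminf (\<lambda>n. ennreal \<bar>q n - r\<bar>)" using dense by blast
    define c where "c = enn2real y"
    have "y < top" using y(2) top_greatest by (rule order_less_le_trans)
    then have c: "y = ennreal c" "c > 0" using y(1) unfolding c_def by (auto simp: enn2real_positive_iff)
    have ev: "\<forall>\<^sub>F n in sequentially. ennreal c < ennreal \<bar>q n - r\<bar>"
      using y(2) unfolding c(1) by (rule less_LiminfD)
    have "\<exists>\<^sub>F n in sequentially. \<bar>\<bar>q n\<bar> - r\<bar> < min c \<eta> \<and> ennreal c < ennreal \<bar>q n - r\<bar>"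
      by (rule frequently_eventually_frequently[OF freq ev]) (use c \<open>\<eta> > 0\<close> in simp)
    then show ?thesis
      by (rule frequently_elim1) (use False c in \<open>auto simp: accu_def r_def[symmetric] ennreal_less_iff abs_if split: if_splits\<close>)
  qed
qed

text \<open>By Fatou's lemma the bound for the dyadic variation bounds the integral of the lower
  limit \<open>R\<close> over every interval around 0. So \<open>R\<close> is finite almost
  everywhere, and it dominates the absolute value of the selected accumulation point, which is
  therefore locally integrable.\<close>

lemma exists_accumulation_function:
  assumes "locally_absolutely_continuous G"
  obtains g where "g \<in> borel_measurable borel" "\<And>a b. g absolutely_integrable_on {a..b}"
    "AE x in lebesgue. \<forall>\<eta>>0. \<exists>\<^sub>F n in sequentially. \<bar>dyadic_slope G n x - g x\<bar> < \<eta>"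
proof
  define R where "R x = liminf (\<lambda>n. ennreal \<bar>dyadic_slope G n x\<bar>)" for x
  define g where "g x = accu (\<lambda>n. dyadic_slope G n x)" for x
  have Rm [measurable]: "R \<in> borel_measurable borel" unfolding R_def by measurable
  have abs_m [measurable]: "(\<lambda>x. accu_abs (\<lambda>n. dyadic_slope G n x)) \<in> borel_measurable borel"
    unfolding accu_abs_def R_def[symmetric] by measurable
  show gm [measurable]: "g \<in> borel_measurable borel"
    unfolding g_def accu_def by measurable
  have fin: "(\<integral>\<^sup>+x\<in>{- real N..<real N}. R x \<partial>lborel) < \<infinity>" for N
  proof -
    obtain V n1 where V: "\<And>n. n \<ge> n1 \<Longrightarrow> (\<Sum>k\<in>{- int N * 2 ^ n..<int N * 2 ^ n}. \<bar>dyadic_incr G n k\<bar>) \<le> V"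
      using AC_dyadic_bounded_variation[OF assms, of N] by blast
    have "(\<integral>\<^sup>+x\<in>{- real N..<real N}. R x \<partial>lborel)
      = (\<integral>\<^sup>+x. liminf (\<lambda>n. ennreal \<bar>dyadic_slope G n x\<bar> * indicator {- real N..<real N} x) \<partial>lborel)"
      by (rule nn_integral_cong) (auto simp: R_def indicator_def Liminf_const)
    also have "\<dots> \<le> liminf (\<lambda>n. (\<integral>\<^sup>+x\<in>{- real N..<real N}. ennreal \<bar>dyadic_slope G n x\<bar> \<partial>lborel))"
      by (rule nn_integral_liminf) measurable
    also have "\<dots> \<le> ennreal V"
    proof (rule Liminf_le)
      show "\<forall>\<^sub>F n in sequentially. (\<integral>\<^sup>+x\<in>{- real N..<real N}. ennreal \<bar>dyadic_slope G n x\<bar> \<partial>lborel) \<le> ennreal V"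
        unfolding eventually_sequentially
      proof (intro exI allI impI)
        fix n assume "n1 \<le> n"
        have "(\<integral>\<^sup>+x\<in>{- real N..<real N}. ennreal \<bar>dyadic_slope G n x\<bar> \<partial>lborel)
          \<le> ennreal ((\<Sum>k\<in>{- int N * 2 ^ n..<int N * 2 ^ n}. \<bar>2 ^ n * dyadic_incr G n k\<bar>) / 2 ^ n)"
          by (rule nn_integral_dyadic_slope) simp
        also have "\<dots> \<le> ennreal V"
          using V[OF \<open>n1 \<le> n\<close>] by (intro ennreal_leI) (simp add: abs_mult sum_distrib_left[symmetric])
        finally show "(\<integral>\<^sup>+x\<in>{- real N..<real N}. ennreal \<bar>dyadic_slope G n x\<bar> \<partial>lborel) \<le> ennreal V" .
      qed
    qed simp
    finally show ?thesis by (rule order_le_less_trans) simp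
  qed
  have R_fin: "AE x in lborel. R x < \<infinity>"
  proof -
    have "AE x in lborel. x \<in> {- real N..<real N} \<longrightarrow> R x < \<infinity>" for N
    proof -
      have "AE x in lborel. R x * indicator {- real N..<real N} x \<noteq> \<infinity>"
        by (rule nn_integral_noteq_infinite) (use fin[of N] in auto)
      then show ?thesis by eventually_elim (auto simp: less_top)
    qed
    then have "AE x in lborel. \<forall>N::nat. x \<in> {- real N..<real N} \<longrightarrow> R x < \<infinity>"
      unfolding AE_all_countable by blast
    then show ?thesis
    proof eventually_elim
      case (elim x)
      obtain N :: nat where "\<bar>x\<bar> < real N" using reals_Archimedean2 by blast
      then have "x \<in> {- real N..<real N}" by auto
      then show ?case using elim by blast
    qed
  qed
  then have R_fin': "AE x in lebesgue. R x < \<infinity>" by (rule AE_completion)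
  then show "AE x in lebesgue. \<forall>\<eta>>0. \<exists>\<^sub>F n in sequentially. \<bar>dyadic_slope G n x - g x\<bar> < \<eta>"
    by eventually_elim (auto simp: R_def g_def intro: frequently_accu)
  have g_le: "ennreal \<bar>g x\<bar> \<le> R x" for x
    unfolding g_def accu_def accu_abs_def R_def by (auto simp: ennreal_enn2real_if)
  show "g absolutely_integrable_on {a..b}" for a b
  proof -
    obtain N :: nat where N: "max \<bar>a\<bar> \<bar>b\<bar> < real N" using reals_Archimedean2 by blast
    have "set_integrable lborel {- real N..<real N} g"
      unfolding set_integrable_def
    proof (rule integrableI_bounded)
      have "(\<integral>\<^sup>+x. ennreal (norm (indicator {- real N..<real N} x *\<^sub>R g x)) \<partial>lborel)
         \<le> (\<integral>\<^sup>+x\<in>{- real N..<real N}. R x \<partial>lborel)"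
        by (rule nn_integral_mono) (use g_le in \<open>auto simp: indicator_def\<close>)
      also note fin
      finally show "(\<integral>\<^sup>+x. ennreal (norm (indicator {- real N..<real N} x *\<^sub>R g x)) \<partial>lborel) < \<infinity>" .
    qed measurable
    then have "set_integrable lborel {a..b} g"
      by (rule set_integrable_subset) (use N in auto)
    then show ?thesis
      by (simp add: set_integrable_def integrable_completion)
  qed
qed

section \<open>Indefinite integrals and Lebesgue differentiation\<close>

lemma exists_indefinite_integral:
  fixes g :: "real \<Rightarrow> real"
  assumes "\<And>a b. g integrable_on {a..b}"
  obtains \<Phi> where "\<And>a b. a \<le> b \<Longrightarrow> \<Phi> b - \<Phi> a = integral {a..b} g"
proof
  define \<Phi> where "\<Phi> x = (if x \<ge> 0 then integral {0..x} g else - integral {x..0} g)" for x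
  show "\<Phi> b - \<Phi> a = integral {a..b} g" if "a \<le> b" for a b
  proof (cases "a \<ge> 0")
    case True
    then show ?thesis
      using that Henstock_Kurzweil_Integration.integral_combine[of 0 a b g] assms by (simp add: \<Phi>_def)
  next
    case a: False
    show ?thesis
    proof (cases "b \<ge> 0")
      case True
      then show ?thesis
        using a Henstock_Kurzweil_Integration.integral_combine[of a 0 b g] assms by (simp add: \<Phi>_def)
    next
      case False
      then show ?thesis
        using a that Henstock_Kurzweil_Integration.integral_combine[of a b 0 g] assms by (simp add: \<Phi>_def)
    qed
  qed
qed

lemma right_Lebesgue_differentiation:
  fixes g :: "real \<Rightarrow> real"
  assumes "\<And>a b. g integrable_on {a..b}"
  obtains N where "negligible N"
    "\<And>x. x \<notin> N \<Longrightarrow> ((\<lambda>y. integral {x..y} g / (y - x)) \<longlongrightarrow> g x) (at_right x)"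
proof -
  obtain N where N: "negligible N" "\<And>x e. \<lbrakk>x \<notin> N; 0 < e\<rbrakk> \<Longrightarrow>
     \<exists>d>0. \<forall>h. 0 < h \<and> h < d \<longrightarrow> norm (integral (cbox x (x + h *\<^sub>R One)) g /\<^sub>R h ^ DIM(real) - g x) < e"
    by (rule integrable_ccontinuous_explicit[of g]) (use assms in auto)
  have "((\<lambda>y. integral {x..y} g / (y - x)) \<longlongrightarrow> g x) (at_right x)" if x: "x \<notin> N" for x
    unfolding tendsto_iff
  proof (intro allI impI)
    fix e :: real assume "e > 0"
    then obtain d where d: "d > 0" "\<And>h. 0 < h \<Longrightarrow> h < d \<Longrightarrow> norm (integral (cbox x (x + h *\<^sub>R One)) g /\<^sub>R h ^ DIM(real) - g x) < e"
      using N(2)[OF x] by blast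
    show "\<forall>\<^sub>F y in at_right x. dist (integral {x..y} g / (y - x)) (g x) < e"
      unfolding eventually_at_right_field
    proof (intro exI[of _ "x + d"] conjI allI impI)
      fix y assume "x < y" "y < x + d"
      then show "dist (integral {x..y} g / (y - x)) (g x) < e"
        using d(2)[of "y - x"] by (simp add: dist_norm divide_inverse mult.commute)
    qed (use d in simp)
  qed
  then show ?thesis using N(1) that by blast
qed

text \<open>Reflection at 0 turns left averages into right averages.\<close>

lemma left_Lebesgue_differentiation:
  fixes g :: "real \<Rightarrow> real"
  assumes "\<And>a b. g integrable_on {a..b}"
  obtains N where "negligible N"
    "\<And>x. x \<notin> N \<Longrightarrow> ((\<lambda>y. integral {y..x} g / (x - y)) \<longlongrightarrow> g x) (at_left x)"
proof -
  have int: "(\<lambda>x. g (- x)) integrable_on {a..b}" for a b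
    using assms[of "-b" "-a"] Henstock_Kurzweil_Integration.integrable_reflect_real[where f = g and a = "-b" and b = "-a"] by simp
  have eq: "integral {a..b} (\<lambda>x. g (- x)) = integral {- b..- a} g" for a b
    using Henstock_Kurzweil_Integration.integral_reflect_real[of "-a" "-b" g] by simp
  obtain N where N: "negligible N"
    "\<And>x. x \<notin> N \<Longrightarrow> ((\<lambda>y. integral {- y..- x} g / (y - x)) \<longlongrightarrow> g (- x)) (at_right x)"
    using right_Lebesgue_differentiation[OF int] unfolding eq by blast
  show ?thesis
  proof
    show "negligible (uminus ` N)" by (rule negligible_differentiable_image_negligible[OF order_refl N(1)]) (auto intro!: derivative_intros simp: differentiable_on_def)
    fix x assume "x \<notin> uminus ` N"
    then have "- x \<notin> N" by force
    then show "((\<lambda>y. integral {y..x} g / (x - y)) \<longlongrightarrow> g x) (at_left x)"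
      using N(2)[of "-x"] by (simp add: filterlim_at_left_to_right add.commute)
  qed
qed

lemma Lebesgue_differentiation:
  fixes g :: "real \<Rightarrow> real"
  assumes g: "\<And>a b. g integrable_on {a..b}" and \<Phi>: "\<And>a b. a \<le> b \<Longrightarrow> \<Phi> b - \<Phi> a = integral {a..b} g"
  obtains N where "negligible N" "\<And>x. x \<notin> N \<Longrightarrow> (\<Phi> has_real_derivative g x) (at x)"
proof -
  obtain N1 where N1: "negligible N1"
    "\<And>x. x \<notin> N1 \<Longrightarrow> ((\<lambda>y. integral {x..y} g / (y - x)) \<longlongrightarrow> g x) (at_right x)"
    using right_Lebesgue_differentiation[OF g] by blast
  obtain N2 where N2: "negligible N2"
    "\<And>x. x \<notin> N2 \<Longrightarrow> ((\<lambda>y. integral {y..x} g / (x - y)) \<longlongrightarrow> g x) (at_left x)"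
    using left_Lebesgue_differentiation[OF g] by blast
  show ?thesis
  proof
    show "negligible (N1 \<union> N2)" using N1 N2 by simp
    fix x assume x: "x \<notin> N1 \<union> N2"
    have "((\<lambda>y. (\<Phi> y - \<Phi> x) / (y - x)) \<longlongrightarrow> g x) (at_right x)"
    proof (rule Lim_transform_eventually[OF N1(2)])
      show "\<forall>\<^sub>F y in at_right x. integral {x..y} g / (y - x) = (\<Phi> y - \<Phi> x) / (y - x)"
        unfolding eventually_at_filter by (rule always_eventually) (auto simp: \<Phi>[symmetric])
    qed (use x in simp)
    moreover have "((\<lambda>y. (\<Phi> y - \<Phi> x) / (y - x)) \<longlongrightarrow> g x) (at_left x)"
    proof (rule Lim_transform_eventually[OF N2(2)])
      show "\<forall>\<^sub>F y in at_left x. integral {y..x} g / (x - y) = (\<Phi> y - \<Phi> x) / (y - x)"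
        unfolding eventually_at_filter
      proof (rule always_eventually, intro allI impI)
        fix y assume "y \<noteq> x" "y \<in> {..<x}"
        then have "integral {y..x} g = - (\<Phi> y - \<Phi> x)" "x - y = - (y - x)" using \<Phi>[of y x] by auto
        then show "integral {y..x} g / (x - y) = (\<Phi> y - \<Phi> x) / (y - x)" by (simp only: minus_divide_divide)
      qed
    qed (use x in simp)
    ultimately show "(\<Phi> has_real_derivative g x) (at x)"
      unfolding has_field_derivative_iff filterlim_split_at_real by (intro filterlim_split_at)
  qed
qed

text \<open>Truncation at a height \<open>K\<close>: the part of \<open>\<bar>g\<bar>\<close> above
  \<open>K\<close> has small integral by dominated convergence, while the part below contributes at
  most \<open>K\<close> times the length of a set.\<close>

lemma integrable_small_on_small_sets:
  fixes g :: "real \<Rightarrow> real"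
  assumes g: "g absolutely_integrable_on {a..b}" and "\<epsilon> > 0"
  obtains K where "K \<ge> 0" "(\<lambda>x. max 0 (\<bar>g x\<bar> - K)) integrable_on {a..b}" "integral {a..b} (\<lambda>x. max 0 (\<bar>g x\<bar> - K)) < \<epsilon>"
proof -
  let ?f = "\<lambda>k x. max 0 (\<bar>g x\<bar> - real k)"
  have absg: "(\<lambda>x. \<bar>g x\<bar>) absolutely_integrable_on {a..b}" using absolutely_integrable_norm[OF g] by (simp add: comp_def)
  have int: "?f k integrable_on {a..b}" for k
  proof -
    have "?f k absolutely_integrable_on {a..b}"
      by (intro absolutely_integrable_max_1 set_integral_diff absg) auto
    then show ?thesis using set_lebesgue_integral_eq_integral(1) by blast
  qed
  have "(\<lambda>k. integral {a..b} (?f k)) \<longlonglongrightarrow> integral {a..b} (\<lambda>x. 0)"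
  proof (rule dominated_convergence(2)[OF int])
    show "(\<lambda>x. \<bar>g x\<bar>) integrable_on {a..b}" using absg set_lebesgue_integral_eq_integral(1) by blast
    fix x
    obtain N :: nat where "\<bar>g x\<bar> \<le> real N" using real_arch_simple by blast
    then show "(\<lambda>k. ?f k x) \<longlonglongrightarrow> 0"
      by (intro tendsto_eventually eventually_sequentiallyI[of N]) auto
  qed auto
  then have "\<forall>\<^sub>F k in sequentially. integral {a..b} (?f k) < \<epsilon>" using \<open>\<epsilon> > 0\<close> by (intro order_tendstoD) auto
  then obtain k where "integral {a..b} (?f k) < \<epsilon>" by (auto simp: eventually_sequentially)
  then show thesis using that[of "real k"] int by simp
qed

lemma integral_division_le:
  fixes h :: "real \<Rightarrow> real"
  assumes D: "D division_of \<Union>D" "\<Union>D \<subseteq> {a..b}" and h: "h integrable_on {a..b}" "\<And>x. h x \<ge> 0"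
  shows "(\<Sum>K\<in>D. integral K h) \<le> integral {a..b} h"
proof -
  have intK: "h integrable_on K" if "K \<in> D" for K
  proof -
    obtain u v where "K = cbox u v" using D(1) \<open>K \<in> D\<close> by blast
    moreover have "K \<subseteq> {a..b}" using D(2) \<open>K \<in> D\<close> by blast
    ultimately show ?thesis using integrable_on_subcbox[OF h(1)] by blast
  qed
  have "(\<Sum>K\<in>D. integral K h) = integral (\<Union>D) h"
    using integral_combine_division_bottomup[OF D(1), of h] intK by simp
  also have "\<dots> \<le> integral {a..b} h"
  proof (rule integral_subset_le[OF D(2)])
    show "h integrable_on \<Union>D" using integrable_combine_division[OF D(1)] intK by blast
  qed (use h in auto)
  finally show ?thesis .
qed

lemma AC_indefinite_integral:
  assumes g: "\<And>a b. g absolutely_integrable_on {a..b}" and \<Phi>: "\<And>a b. a \<le> b \<Longrightarrow> \<Phi> b - \<Phi> a = integral {a..b} g"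
  shows "locally_absolutely_continuous \<Phi>"
  unfolding locally_absolutely_continuous_def absolutely_continuous_fun_on_def
proof (intro allI impI)
  fix a b \<epsilon> :: real assume "\<epsilon> > 0"
  then obtain K where K: "K \<ge> 0" "(\<lambda>x. max 0 (\<bar>g x\<bar> - K)) integrable_on {a..b}" "integral {a..b} (\<lambda>x. max 0 (\<bar>g x\<bar> - K)) < \<epsilon> / 2"
    using integrable_small_on_small_sets[OF g, of "\<epsilon> / 2" a b] by auto
  let ?u = "\<lambda>x. max 0 (\<bar>g x\<bar> - K)"
  show "\<exists>\<delta>>0. \<forall>D. D division_of \<Union>D \<and> \<Union>D \<subseteq> {a..b} \<and> (\<Sum>K\<in>D. Sup K - Inf K) < \<delta>
        \<longrightarrow> (\<Sum>K\<in>D. \<bar>\<Phi> (Sup K) - \<Phi> (Inf K)\<bar>) < \<epsilon>"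
  \<comment> \<open>On total length \<open>\<delta>\<close> the part below height \<open>K\<close>
    contributes at most \<open>\<epsilon> / 2\<close>; \<open>K + 1\<close> instead of
    \<open>K\<close> keeps the quotient meaningful for \<open>K = 0\<close>.\<close>
  proof (intro exI[of _ "\<epsilon> / (2 * (K + 1))"] conjI allI impI; (elim conjE)?)
    show "0 < \<epsilon> / (2 * (K + 1))" using \<open>\<epsilon> > 0\<close> K by simp
    fix D :: "real set set" assume D: "D division_of \<Union>D" "\<Union>D \<subseteq> {a..b}" "(\<Sum>K\<in>D. Sup K - Inf K) < \<epsilon> / (2 * (K + 1))"
    have "\<bar>\<Phi> (Sup J) - \<Phi> (Inf J)\<bar> \<le> integral J ?u + K * (Sup J - Inf J)" if "J \<in> D" for J
    proof -
      obtain u v where J: "J = {u..v}" "u \<le> v" using division_ofD(3,4)[OF D(1) \<open>J \<in> D\<close>] by (auto simp: cbox_interval)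
      have sub: "{u..v} \<subseteq> {a..b}" using D(2) that J by blast
      have iu: "?u integrable_on {u..v}" using integrable_on_subinterval[OF K(2) sub] .
      have "\<bar>\<Phi> v - \<Phi> u\<bar> = norm (integral {u..v} g)" using \<Phi>[OF J(2)] by simp
      also have "\<dots> \<le> integral {u..v} (\<lambda>x. ?u x + K)"
      proof (rule integral_norm_bound_integral)
        show "g integrable_on {u..v}" using g set_lebesgue_integral_eq_integral(1) by blast
      qed (use iu in \<open>auto intro: integrable_add\<close>)
      also have "\<dots> = integral {u..v} ?u + K * (v - u)"
        using iu J(2) by (subst integral_add) auto
      finally show ?thesis using J by simp
    qed
    then have "(\<Sum>K\<in>D. \<bar>\<Phi> (Sup K) - \<Phi> (Inf K)\<bar>) \<le> (\<Sum>J\<in>D. integral J ?u + K * (Sup J - Inf J))"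
      by (rule sum_mono)
    also have "\<dots> = (\<Sum>J\<in>D. integral J ?u) + K * (\<Sum>J\<in>D. Sup J - Inf J)"
      by (simp add: sum.distrib sum_distrib_left)
    also have "(\<Sum>J\<in>D. integral J ?u) \<le> integral {a..b} ?u"
      using D K by (intro integral_division_le) auto
    also have "K * (\<Sum>J\<in>D. Sup J - Inf J) \<le> K * (\<epsilon> / (2 * (K + 1)))"
      using D(3) K by (intro mult_left_mono) auto
    also have "\<dots> \<le> \<epsilon> / 2" using K \<open>\<epsilon> > 0\<close> by (simp add: field_simps)
    finally show "(\<Sum>K\<in>D. \<bar>\<Phi> (Sup K) - \<Phi> (Inf K)\<bar>) < \<epsilon>" using K(3) by linarith
  qed
qed

section \<open>The fundamental theorem for absolutely continuous functions\<close>

lemma AC_diff: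
  assumes "locally_absolutely_continuous F" "locally_absolutely_continuous G"
  shows "locally_absolutely_continuous (\<lambda>x. F x - G x)"
  unfolding locally_absolutely_continuous_def absolutely_continuous_fun_on_def
proof (intro allI impI)
  fix a b \<epsilon> :: real assume "\<epsilon> > 0"
  then have e: "\<epsilon> / 2 > 0" by simp
  obtain d1 where d1: "d1 > 0" "\<And>D. D division_of \<Union>D \<and> \<Union>D \<subseteq> {a..b} \<and> (\<Sum>K\<in>D. Sup K - Inf K) < d1
        \<Longrightarrow> (\<Sum>K\<in>D. \<bar>F (Sup K) - F (Inf K)\<bar>) < \<epsilon> / 2"
    using assms(1) e unfolding locally_absolutely_continuous_def absolutely_continuous_fun_on_def by meson
  obtain d2 where d2: "d2 > 0" "\<And>D. D division_of \<Union>D \<and> \<Union>D \<subseteq> {a..b} \<and> (\<Sum>K\<in>D. Sup K - Inf K) < d2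
        \<Longrightarrow> (\<Sum>K\<in>D. \<bar>G (Sup K) - G (Inf K)\<bar>) < \<epsilon> / 2"
    using assms(2) e unfolding locally_absolutely_continuous_def absolutely_continuous_fun_on_def by meson
  show "\<exists>\<delta>>0. \<forall>D. D division_of \<Union>D \<and> \<Union>D \<subseteq> {a..b} \<and> (\<Sum>K\<in>D. Sup K - Inf K) < \<delta>
        \<longrightarrow> (\<Sum>K\<in>D. \<bar>F (Sup K) - G (Sup K) - (F (Inf K) - G (Inf K))\<bar>) < \<epsilon>"
  proof (intro exI[of _ "min d1 d2"] conjI allI impI)
    fix D assume D: "D division_of \<Union>D \<and> \<Union>D \<subseteq> {a..b} \<and> (\<Sum>K\<in>D. Sup K - Inf K) < min d1 d2"
    have "(\<Sum>K\<in>D. \<bar>F (Sup K) - G (Sup K) - (F (Inf K) - G (Inf K))\<bar>)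
      \<le> (\<Sum>K\<in>D. \<bar>F (Sup K) - F (Inf K)\<bar> + \<bar>G (Sup K) - G (Inf K)\<bar>)"
      by (rule sum_mono) linarith
    also have "\<dots> < \<epsilon> / 2 + \<epsilon> / 2"
      unfolding sum.distrib using D by (intro add_strict_mono d1(2) d2(2)) auto
    finally show "(\<Sum>K\<in>D. \<bar>F (Sup K) - G (Sup K) - (F (Inf K) - G (Inf K))\<bar>) < \<epsilon>" by simp
  qed (use d1 d2 in auto)
qed

lemma AC_isCont:
  assumes "locally_absolutely_continuous G"
  shows "isCont G x"
  unfolding continuous_at_eps_delta
proof (intro allI impI)
  fix e :: real assume "e > 0"
  then obtain d where d: "d > 0" "\<And>D. D division_of \<Union>D \<and> \<Union>D \<subseteq> {x-1..x+1} \<and> (\<Sum>K\<in>D. Sup K - Inf K) < d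
        \<Longrightarrow> (\<Sum>K\<in>D. \<bar>G (Sup K) - G (Inf K)\<bar>) < e"
    using assms unfolding locally_absolutely_continuous_def absolutely_continuous_fun_on_def by meson
  have *: "\<bar>G v - G u\<bar> < e" if "u \<le> v" "{u..v} \<subseteq> {x-1..x+1}" "v - u < d" for u v
    using d(2)[of "{{u..v}}"] that division_of_self[of u v] by (auto simp: cbox_interval)
  show "\<exists>d>0. \<forall>x'. dist x' x < d \<longrightarrow> dist (G x') (G x) < e"
  proof (intro exI[of _ "min d 1"] conjI allI impI)
    fix y assume "dist y x < min d 1"
    then show "dist (G y) (G x) < e"
      using *[of x y] *[of y x] by (auto simp: dist_real_def abs_if split: if_splits)
  qed (use d in simp)
qed

text \<open>The difference \<open>H\<close> of \<open>G\<close> and the integral of the accumulation function has almost everywhere 0 as an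
  accumulation point of its dyadic slopes, hence is constant.\<close>
theorem AC_fundamental_theorem:
  assumes G: "locally_absolutely_continuous G"
  shows "\<exists>g N. g \<in> borel_measurable borel \<and> negligible N \<and>
    (\<forall>x. x \<notin> N \<longrightarrow> (G has_real_derivative g x) (at x)) \<and>
    (\<forall>a b. a \<le> b \<longrightarrow> G b - G a = integral {a..b} g)"
proof -
  obtain g where g: "g \<in> borel_measurable borel" "\<And>a b. g absolutely_integrable_on {a..b}"
    "AE x in lebesgue. \<forall>\<eta>>0. \<exists>\<^sub>F n in sequentially. \<bar>dyadic_slope G n x - g x\<bar> < \<eta>"
    using exists_accumulation_function[OF G] by blast
  have gi: "g integrable_on {a..b}" for a b using g(2) set_lebesgue_integral_eq_integral(1) by blast
  obtain \<Phi> where \<Phi>: "\<And>a b. a \<le> b \<Longrightarrow> \<Phi> b - \<Phi> a = integral {a..b} g"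
    using exists_indefinite_integral[OF gi] by blast
  obtain N where N: "negligible N" "\<And>x. x \<notin> N \<Longrightarrow> (\<Phi> has_real_derivative g x) (at x)"
    using Lebesgue_differentiation[OF gi \<Phi>] by blast
  define H where "H x = G x - \<Phi> x" for x
  have H: "locally_absolutely_continuous H"
    unfolding H_def by (intro AC_diff G AC_indefinite_integral[OF g(2) \<Phi>])
  have slope: "dyadic_slope H n x = dyadic_slope G n x - dyadic_slope \<Phi> n x" for n x
    by (simp add: dyadic_slope_def dyadic_incr_def H_def algebra_simps)
  have "AE x in lebesgue. x \<notin> N" using N(1) by (intro AE_not_in) (simp add: negligible_iff_null_sets)
  with g(3) have "AE x::real in lebesgue. \<forall>\<eta>>0. \<forall>n. \<exists>N\<ge>n. \<bar>dyadic_incr H N \<lfloor>2 ^ N * x\<rfloor>\<bar> \<le> \<eta> / 2 ^ N"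
  proof eventually_elim
    case (elim x)
    show ?case
    proof (intro allI impI)
      fix \<eta> :: real and n :: nat assume "\<eta> > 0"
      \<comment> \<open>The slopes of \<open>\<Phi>\<close> converge to \<open>g x\<close>, those of
        \<open>G\<close> are close to it only infinitely often. An eventual and a frequent property
        hold jointly infinitely often, which is what \<open>AC_const_dyadic\<close> asks
        for.\<close>
      have "\<forall>\<^sub>F n in sequentially. \<bar>dyadic_slope \<Phi> n x - g x\<bar> < \<eta> / 2"
        using tendstoD[OF DERIV_dyadic_slope[OF N(2)[OF elim(2)]], of "\<eta> / 2"] \<open>\<eta> > 0\<close> by (simp add: dist_real_def)
      then have "\<exists>\<^sub>F n in sequentially. \<bar>dyadic_slope G n x - g x\<bar> < \<eta> / 2 \<and> \<bar>dyadic_slope \<Phi> n x - g x\<bar> < \<eta> / 2"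
        using elim(1)[rule_format, of "\<eta> / 2"] \<open>\<eta> > 0\<close> by (intro frequently_eventually_frequently) auto
      then obtain k where k: "k \<ge> n" "\<bar>dyadic_slope G k x - g x\<bar> < \<eta> / 2" "\<bar>dyadic_slope \<Phi> k x - g x\<bar> < \<eta> / 2"
        by (auto simp: frequently_sequentially)
      have "\<bar>dyadic_slope H k x\<bar> \<le> \<eta>" unfolding slope using k by linarith
      then have "\<bar>dyadic_incr H k \<lfloor>2 ^ k * x\<rfloor>\<bar> \<le> \<eta> / 2 ^ k"
        by (simp add: dyadic_slope_def abs_mult field_simps)
      then show "\<exists>N\<ge>n. \<bar>dyadic_incr H N \<lfloor>2 ^ N * x\<rfloor>\<bar> \<le> \<eta> / 2 ^ N" using k(1) by blast
    qed
  qed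
  then have inc0: "dyadic_incr H n k = 0" for n k using AC_const_dyadic[OF H] by blast
  have dyadic0: "H (dyadic n k) = H 0" for n k
  proof -
    have "H (dyadic n (int j)) = H 0 \<and> H (dyadic n (- int j)) = H 0" for j
    proof (induction j)
      case (Suc j)
      then show ?case using inc0[of n "int j"] inc0[of n "- 1 - int j"] by (simp add: dyadic_incr_def add.commute)
    qed (simp add: dyadic_def)
    then show ?thesis by (metis int_cases2)
  qed
  have H0: "H x = H 0" for x
  proof -
    have "(\<lambda>n. dyadic n \<lfloor>2 ^ n * x\<rfloor>) \<longlonglongrightarrow> x"
    proof (rule LIMSEQ_I)
      fix r :: real assume "r > 0"
      then obtain k where k: "(1 / 2) ^ k < r" using real_arch_pow_inv[of r "1/2"] by auto
      show "\<exists>no. \<forall>n\<ge>no. norm (dyadic n \<lfloor>2 ^ n * x\<rfloor> - x) < r"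
      proof (intro exI[of _ k] allI impI)
        fix n assume "n \<ge> k"
        then have "(1 / 2) ^ n \<le> ((1 / 2) ^ k :: real)" by (intro power_decreasing) auto
        then have "1 / 2 ^ n < r" using k by (simp add: power_divide)
        then show "norm (dyadic n \<lfloor>2 ^ n * x\<rfloor> - x) < r"
          using dyadic_floor_iff[of n x "\<lfloor>2 ^ n * x\<rfloor>"] dyadic_Suc_minus[of n "\<lfloor>2 ^ n * x\<rfloor>"] by (auto simp: abs_if)
      qed
    qed
    then have "(\<lambda>n. H (dyadic n \<lfloor>2 ^ n * x\<rfloor>)) \<longlonglongrightarrow> H x"
      using AC_isCont[OF H] isCont_tendsto_compose by blast
    then show ?thesis unfolding dyadic0 by (simp add: LIMSEQ_const_iff)
  qed
  have G_eq: "G x = \<Phi> x + H 0" for x using H0[of x] by (simp add: H_def)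
  show ?thesis
  proof (intro exI conjI allI impI, rule g(1), rule N(1))
    show "(G has_real_derivative g x) (at x)" if "x \<notin> N" for x
      unfolding G_eq[abs_def] using N(2)[OF that] by (auto intro!: derivative_eq_intros)
    show "G b - G a = integral {a..b} g" if "a \<le> b" for a b
      using \<Phi>[OF that] by (simp add: G_eq)
  qed
qed

section \<open>Functions in L_p on bounded intervals and Jensen's inequality\<close>

lemma Lp_absolutely_integrable:
  assumes h: "h \<in> Lp_space p" and p: "p > 1"
  shows "h absolutely_integrable_on {a..b}"
proof -
  have m: "h \<in> borel_measurable lebesgue" and i: "integrable lebesgue (\<lambda>x. \<bar>h x\<bar> powr p)"
    using h by (auto simp: Lp_space_def)
  have "set_integrable lebesgue {a..b} (\<lambda>x. 1 + \<bar>h x\<bar> powr p)"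
  proof (rule set_integral_add)
    show "set_integrable lebesgue {a..b} (\<lambda>x. \<bar>h x\<bar> powr p)"
      using i unfolding set_integrable_def
      by (intro integrable_mult_indicator) auto
  qed auto
  then show ?thesis
    unfolding set_integrable_def
  proof (rule Bochner_Integration.integrable_bound)
    show "(\<lambda>x. indicat_real {a..b} x *\<^sub>R h x) \<in> borel_measurable lebesgue"
      by (intro borel_measurable_scaleR borel_measurable_indicator m) auto
    show "AE x in lebesgue. norm (indicat_real {a..b} x *\<^sub>R h x) \<le> norm (indicat_real {a..b} x *\<^sub>R (1 + \<bar>h x\<bar> powr p))"
    proof (rule AE_I2)
      fix x
      have "\<bar>h x\<bar> \<le> 1 + \<bar>h x\<bar> powr p"
      proof (cases "\<bar>h x\<bar> \<le> 1")
        case False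
        then have "\<bar>h x\<bar> powr 1 \<le> \<bar>h x\<bar> powr p" using p by (intro powr_mono) auto
        then show ?thesis using False by simp
      qed (simp add: add_increasing2)
      then show "norm (indicat_real {a..b} x *\<^sub>R h x) \<le> norm (indicat_real {a..b} x *\<^sub>R (1 + \<bar>h x\<bar> powr p))"
        by (auto simp: indicator_def)
    qed
  qed
qed

lemma Lp_integrable_on:
  assumes "h \<in> Lp_space p" "p > 1"
  shows "h integrable_on {a..b}" "(\<lambda>x. \<bar>h x\<bar> powr p) integrable_on {a..b}"
proof -
  show "h integrable_on {a..b}"
    using Lp_absolutely_integrable[OF assms] set_lebesgue_integral_eq_integral(1) by blast
  have "set_integrable lebesgue {a..b} (\<lambda>x. \<bar>h x\<bar> powr p)"
    using assms(1) unfolding set_integrable_def Lp_space_def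
    by (intro integrable_mult_indicator) auto
  then show "(\<lambda>x. \<bar>h x\<bar> powr p) integrable_on {a..b}"
    using set_lebesgue_integral_eq_integral(1) by blast
qed

text \<open>A convex function lies above its tangent at \<open>s\<close>. The point
  \<open>t = 0\<close> is outside the open half line on which the tangent theorem is applied and is
  computed directly.\<close>

lemma powr_tangent_le:
  assumes "(t::real) \<ge> 0" "s > 0" "p > 1"
  shows "s powr p + p * s powr (p - 1) * (t - s) \<le> t powr p"
proof (cases "t = 0")
  case True
  have "s powr p = s powr (p - 1) * s" using assms by (simp add: powr_diff)
  then have "s powr p + p * s powr (p - 1) * (0 - s) = (1 - p) * s powr p" by (simp add: algebra_simps)
  also have "\<dots> \<le> 0" using assms by (intro mult_nonpos_nonneg) auto
  finally show ?thesis using True by simp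
next
  case False
  have "(\<lambda>x. x powr p) t - (\<lambda>x. x powr p) s \<ge> p * s powr (p - 1) * (t - s)"
  proof (rule convex_on_imp_above_tangent[where A = "{0<..}"])
    show "convex_on {0<..} (\<lambda>x. x powr p)"
      using assms by (intro powr_convex) auto
    show "((\<lambda>x. x powr p) has_real_derivative p * s powr (p - 1)) (at s within {0<..})"
      using assms by (auto intro!: derivative_eq_intros)
  qed (use assms False in \<open>auto simp: interior_open\<close>)
  then show ?thesis by simp
qed

text \<open>The tangent inequality is integrated with \<open>s\<close> the mean value of
  \<open>h\<close>, for which the linear term integrates to 0.\<close>

lemma Jensen_powr:
  assumes h: "h \<in> Lp_space p" "\<And>x. h x \<ge> 0" and p: "p > 1" and "x \<le> y"
  shows "(integral {x..y} h) powr p \<le> (y - x) powr (p - 1) * integral {x..y} (\<lambda>x. h x powr p)"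
proof (cases "integral {x..y} h > 0")
  case False
  moreover have "integral {x..y} h \<ge> 0" by (rule integral_nonneg) (use h Lp_integrable_on[OF h(1) p] in auto)
  ultimately show ?thesis using h Lp_integrable_on[OF h(1) p, of x y]
    by (auto intro!: mult_nonneg_nonneg integral_nonneg)
next
  case True
  then have xy: "y - x > 0" using \<open>x \<le> y\<close> by (cases "x = y") auto
  define I where "I = integral {x..y} h"
  define s where "s = I / (y - x)"
  have s: "s > 0" using True xy by (simp add: s_def I_def)
  have i1: "h integrable_on {x..y}" and i2: "(\<lambda>x. h x powr p) integrable_on {x..y}"
    using Lp_integrable_on[OF h(1) p, of x y] h(2) by simp_all
  have "integral {x..y} (\<lambda>t. s powr p + p * s powr (p - 1) * (h t - s)) \<le> integral {x..y} (\<lambda>t. h t powr p)"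
    by (rule integral_le) (use i1 i2 h s p powr_tangent_le in \<open>auto intro!: integrable_add integrable_diff integrable_on_mult_right\<close>)
  also have "integral {x..y} (\<lambda>t. s powr p + p * s powr (p - 1) * (h t - s)) = s powr p * (y - x)"
  proof -
    have "((\<lambda>t. s powr p + p * s powr (p - 1) * (h t - s)) has_integral
      (y - x) *\<^sub>R s powr p + p * s powr (p - 1) * (I - (y - x) *\<^sub>R s)) {x..y}"
      unfolding I_def using i1 xy has_integral_const_real[of s x y] has_integral_const_real[of "s powr p" x y]
      by (intro has_integral_add has_integral_mult_right has_integral_diff) auto
    moreover have "(y - x) *\<^sub>R s = I" using xy by (simp add: s_def)
    ultimately show ?thesis by (simp add: integral_unique mult.commute)
  qed
  finally have *: "s powr p * (y - x) \<le> integral {x..y} (\<lambda>t. h t powr p)" .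
  have "I powr p = (s * (y - x)) powr p" using xy by (simp add: s_def)
  also have "\<dots> = s powr p * (y - x) powr p" using s xy by (simp add: powr_mult)
  also have "(y - x) powr p = (y - x) powr (p - 1) * (y - x)" using xy by (simp add: powr_diff)
  finally have "I powr p = (y - x) powr (p - 1) * (s powr p * (y - x))" by simp
  also have "\<dots> \<le> (y - x) powr (p - 1) * integral {x..y} (\<lambda>t. h t powr p)"
    using * by (rule mult_left_mono) simp
  finally show ?thesis unfolding I_def .
qed

section \<open>The Riesz characterization\<close>

text \<open>A one-dimensional upper gradient: \<open>h\<close> stands in for the absolute value of
  the derivative without requiring that a derivative exists anywhere.\<close>

definition incr_bounded :: "(real \<Rightarrow> real) \<Rightarrow> (real \<Rightarrow> real) \<Rightarrow> bool" where
  "incr_bounded G h \<longleftrightarrow> (\<forall>x y. x \<le> y \<longrightarrow> \<bar>G y - G x\<bar> \<le> integral {x..y} h)"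

text \<open>Degenerate intervals contribute \<open>0 / 0 = 0\<close>.\<close>
definition riesz_bounded :: "real \<Rightarrow> real \<Rightarrow> (real \<Rightarrow> real) \<Rightarrow> bool" where
  "riesz_bounded p M G \<longleftrightarrow> (\<forall>D. D division_of \<Union>D \<longrightarrow>
     (\<Sum>K\<in>D. \<bar>G (Sup K) - G (Inf K)\<bar> powr p / (Sup K - Inf K) powr (p - 1)) \<le> M)"

text \<open>The derivatives are carried along as explicit functions, so that Leibniz formulas and
  limits along a filter can be written down; \<open>deriv_chain_deriv\<close> leads back to iterated
  \<open>deriv\<close>.\<close>

definition deriv_chain :: "nat \<Rightarrow> (nat \<Rightarrow> real \<Rightarrow> real) \<Rightarrow> bool" where
  "deriv_chain n D \<longleftrightarrow> (\<forall>k<n. \<forall>x. (D k has_real_derivative D (Suc k) x) (at x))"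

lemma deriv_chain_deriv:
  assumes "deriv_chain n D" "k \<le> n"
  shows "(deriv ^^ k) (D 0) = D k"
  using assms(2)
proof (induction k)
  case (Suc k)
  then have "deriv (D k) = D (Suc k)"
    using assms(1) by (intro ext DERIV_imp_deriv) (simp add: deriv_chain_def)
  then show ?case using Suc by simp
qed simp

lemma hom_Sobolev_deriv_chain:
  assumes "F \<in> hom_Sobolev m p"
  shows "deriv_chain (m - 1) (\<lambda>k. (deriv ^^ k) F)"
  using assms unfolding deriv_chain_def hom_Sobolev_def
  by (auto simp: DERIV_deriv_iff_real_differentiable)

text \<open>This is where membership in the space is exploited through the fundamental theorem: off
  a null set \<open>deriv\<close> agrees with the integrand \<open>g\<close>, so the integrals
  coincide.\<close>

lemma hom_Sobolev_incr_bounded: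
  assumes F: "F \<in> hom_Sobolev m p" and m: "m \<ge> 1" and p: "p > 1"
  shows "incr_bounded ((deriv ^^ (m - 1)) F) (\<lambda>x. \<bar>(deriv ^^ m) F x\<bar>)"
  unfolding incr_bounded_def
proof (intro allI impI)
  fix x y :: real assume "x \<le> y"
  define G where "G = (deriv ^^ (m - 1)) F"
  have dG: "(deriv ^^ m) F = deriv G" using m by (cases m) (auto simp: G_def)
  have G: "locally_absolutely_continuous G" using F by (simp add: hom_Sobolev_def G_def)
  obtain g N where g: "negligible N" "\<forall>x. x \<notin> N \<longrightarrow> (G has_real_derivative g x) (at x)"
      "\<forall>a b. a \<le> b \<longrightarrow> G b - G a = integral {a..b} g"
    using AC_fundamental_theorem[OF G] by blast
  have "deriv G \<in> Lp_space p" using F by (simp add: hom_Sobolev_def dG)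
  note ai = Lp_absolutely_integrable[OF this p, of x y]
  have "\<bar>G y - G x\<bar> = norm (integral {x..y} g)" using g(3) \<open>x \<le> y\<close> by simp
  also have "integral {x..y} g = integral {x..y} (deriv G)"
    by (rule integral_spike[OF g(1)]) (use g(2) DERIV_imp_deriv in auto)
  also have "norm \<dots> \<le> integral {x..y} (\<lambda>x. \<bar>deriv G x\<bar>)"
    using ai unfolding absolutely_integrable_on_def by (intro integral_norm_bound_integral) auto
  finally show "\<bar>(deriv ^^ (m - 1)) F y - (deriv ^^ (m - 1)) F x\<bar> \<le> integral {x..y} (\<lambda>x. \<bar>(deriv ^^ m) F x\<bar>)"
    by (simp add: G_def[symmetric] dG del: One_nat_def)
qed

lemma Lp_space_abs: "h \<in> Lp_space p \<Longrightarrow> (\<lambda>x. \<bar>h x\<bar>) \<in> Lp_space p"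
  by (auto simp: Lp_space_def)

lemma integral_interval_le_LINT:
  fixes u :: "real \<Rightarrow> real"
  assumes "integrable lebesgue u" "\<And>x. u x \<ge> 0"
  shows "integral {a..b} u \<le> (LINT x|lebesgue. u x)"
proof -
  have si: "set_integrable lebesgue {a..b} u"
    using assms(1) unfolding set_integrable_def by (intro integrable_mult_indicator) auto
  have "integral {a..b} u = (LINT x|lebesgue. indicator {a..b} x *\<^sub>R u x)"
    using set_lebesgue_integral_eq_integral(2)[OF si] by (simp add: set_lebesgue_integral_def)
  also have "\<dots> \<le> (LINT x|lebesgue. u x)"
    using si assms by (intro integral_mono) (auto simp: set_integrable_def indicator_def)
  finally show ?thesis .
qed

text \<open>The easy half of Riesz's theorem: Jensen's inequality on each interval of the division,
  followed by additivity of the integral.\<close>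

lemma incr_bounded_riesz_bounded:
  assumes G: "incr_bounded G h" and h: "h \<in> Lp_space p" "\<And>x. h x \<ge> 0" and p: "p > 1"
  shows "riesz_bounded p (LINT x|lebesgue. h x powr p) G"
  unfolding riesz_bounded_def
proof (intro allI impI)
  fix D :: "real set set" assume D: "D division_of \<Union>D"
  obtain b where "\<Union>D \<subseteq> cbox (- b) b" using bounded_subset_cbox_symmetric[OF elementary_bounded[OF D]] .
  then have ab: "\<Union>D \<subseteq> {- b..b}" by simp
  have int: "integrable lebesgue (\<lambda>x. h x powr p)" using h by (simp add: Lp_space_def)
  have "(\<Sum>K\<in>D. \<bar>G (Sup K) - G (Inf K)\<bar> powr p / (Sup K - Inf K) powr (p - 1)) \<le> (\<Sum>K\<in>D. integral K (\<lambda>x. h x powr p))"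
  proof (rule sum_mono)
    fix K assume "K \<in> D"
    then obtain u v where K: "K = {u..v}" "u \<le> v" using division_ofD(3,4)[OF D \<open>K \<in> D\<close>] by (auto simp: cbox_interval)
    have "\<bar>G v - G u\<bar> powr p \<le> (integral {u..v} h) powr p"
      using G K p by (intro powr_mono2) (auto simp: incr_bounded_def)
    also have "\<dots> \<le> (v - u) powr (p - 1) * integral {u..v} (\<lambda>x. h x powr p)"
      by (rule Jensen_powr[OF h p K(2)])
    finally have *: "\<bar>G v - G u\<bar> powr p \<le> (v - u) powr (p - 1) * integral {u..v} (\<lambda>x. h x powr p)" .
    have "\<bar>G v - G u\<bar> powr p / (v - u) powr (p - 1) \<le> integral {u..v} (\<lambda>x. h x powr p)"
    proof (cases "u = v")
      case False
      then have "(v - u) powr (p - 1) > 0" using K by simp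
      then show ?thesis using * by (simp add: divide_le_eq mult.commute)
    qed simp
    then show "\<bar>G (Sup K) - G (Inf K)\<bar> powr p / (Sup K - Inf K) powr (p - 1) \<le> integral K (\<lambda>x. h x powr p)"
      using K by simp
  qed
  also have "\<dots> \<le> integral {- b..b} (\<lambda>x. h x powr p)"
    using Lp_integrable_on(2)[OF h(1) p] h(2) by (intro integral_division_le D ab) auto
  also have "\<dots> \<le> (LINT x|lebesgue. h x powr p)"
    by (rule integral_interval_le_LINT[OF int]) simp
  finally show "(\<Sum>K\<in>D. \<bar>G (Sup K) - G (Inf K)\<bar> powr p / (Sup K - Inf K) powr (p - 1)) \<le> (LINT x|lebesgue. h x powr p)" .
qed

text \<open>Intervals on which the slope of \<open>G\<close> is at most \<open>l\<close> contribute
  at most \<open>l\<close> times their length; on a steeper interval the increment is at most its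
  Riesz term divided by \<open>l powr (p - 1)\<close>. The sum of both bounds covers either
  case.\<close>

lemma riesz_bounded_AC:
  assumes G: "riesz_bounded p M G" and p: "p > 1"
  shows "locally_absolutely_continuous G"
  unfolding locally_absolutely_continuous_def absolutely_continuous_fun_on_def
proof (intro allI impI)
  fix a b \<epsilon> :: real assume e: "\<epsilon> > 0"
  \<comment> \<open>The threshold \<open>l\<close> is chosen such that the steep intervals
    contribute at most \<open>\<epsilon> / 2\<close>; passing from \<open>M\<close> to
    \<open>M1\<close> keeps it positive.\<close>
  define M1 where "M1 = max M 1"
  have M1: "M1 > 0" by (simp add: M1_def)
  define l where "l = (2 * M1 / \<epsilon>) powr (1 / (p - 1))"
  have l: "l > 0" using e M1 by (simp add: l_def)
  have lp: "l powr (p - 1) = 2 * M1 / \<epsilon>" using e M1 p by (simp add: l_def powr_powr)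
  show "\<exists>\<delta>>0. \<forall>D. D division_of \<Union>D \<and> \<Union>D \<subseteq> {a..b} \<and> (\<Sum>K\<in>D. Sup K - Inf K) < \<delta>
        \<longrightarrow> (\<Sum>K\<in>D. \<bar>G (Sup K) - G (Inf K)\<bar>) < \<epsilon>"
  proof (intro exI[of _ "\<epsilon> / (2 * l)"] conjI allI impI; (elim conjE)?)
    show "0 < \<epsilon> / (2 * l)" using e l by simp
    fix D :: "real set set" assume D: "D division_of \<Union>D" "(\<Sum>K\<in>D. Sup K - Inf K) < \<epsilon> / (2 * l)"
    let ?w = "\<lambda>K. \<bar>G (Sup K) - G (Inf K)\<bar> powr p / (Sup K - Inf K) powr (p - 1)"
    have "\<bar>G (Sup K) - G (Inf K)\<bar> \<le> l * (Sup K - Inf K) + ?w K / l powr (p - 1)" if "K \<in> D" for K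
    proof -
      obtain u v where K: "K = {u..v}" "u \<le> v" using division_ofD(3,4)[OF D(1) \<open>K \<in> D\<close>] by (auto simp: cbox_interval)
      show ?thesis
      proof (cases "\<bar>G v - G u\<bar> \<le> l * (v - u)")
        case True
        then show ?thesis using K by (simp add: add_increasing2)
      next
        case False
        then have uv: "u < v" using K by (cases "u = v") auto
        let ?d = "\<bar>G v - G u\<bar>"
        have "l * (v - u) > 0" using uv l by simp
        then have d: "?d > 0" using False by linarith
        have "(l * (v - u)) powr (p - 1) \<le> ?d powr (p - 1)"
          using False p uv l by (intro powr_mono2) auto
        then have "?d * (l powr (p - 1) * (v - u) powr (p - 1)) \<le> ?d * ?d powr (p - 1)"
          using l uv by (intro mult_left_mono) (auto simp: powr_mult)
        also have "\<dots> = ?d powr p" using d by (simp add: powr_diff)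
        finally have "?d \<le> ?d powr p / (v - u) powr (p - 1) / l powr (p - 1)"
          using uv l by (simp add: field_simps)
        then show ?thesis using K l uv by (simp add: add_increasing)
      qed
    qed
    then have "(\<Sum>K\<in>D. \<bar>G (Sup K) - G (Inf K)\<bar>) \<le> (\<Sum>K\<in>D. l * (Sup K - Inf K) + ?w K / l powr (p - 1))"
      by (rule sum_mono)
    also have "\<dots> = l * (\<Sum>K\<in>D. Sup K - Inf K) + (\<Sum>K\<in>D. ?w K) / l powr (p - 1)"
      by (simp only: sum.distrib sum_distrib_left sum_divide_distrib)
    also have "\<dots> < l * (\<epsilon> / (2 * l)) + M1 / l powr (p - 1)"
    proof (rule add_less_le_mono)
      show "l * (\<Sum>K\<in>D. Sup K - Inf K) < l * (\<epsilon> / (2 * l))" using D(2) l by (intro mult_strict_left_mono)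
      have "(\<Sum>K\<in>D. ?w K) \<le> M" using G[unfolded riesz_bounded_def, rule_format, OF D(1)] .
      then have "(\<Sum>K\<in>D. ?w K) \<le> M1" unfolding M1_def by simp
      then show "(\<Sum>K\<in>D. ?w K) / l powr (p - 1) \<le> M1 / l powr (p - 1)" by (rule divide_right_mono) simp
    qed
    also have "\<dots> = \<epsilon>" using l lp e M1 by simp
    finally show "(\<Sum>K\<in>D. \<bar>G (Sup K) - G (Inf K)\<bar>) < \<epsilon>" .
  qed
qed

text \<open>The hard half of Riesz's theorem. Dyadic slopes converge almost everywhere to the
  derivative, and the integral of their power over a dyadic interval is exactly the Riesz term of
  that interval; Fatou's lemma transfers the bound.\<close>

lemma riesz_bounded_deriv:
  assumes G: "riesz_bounded p M G" and p: "p > 1"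
  shows "deriv G \<in> Lp_space p" "(LINT x|lebesgue. \<bar>deriv G x\<bar> powr p) \<le> M"
proof -
  have M: "M \<ge> 0"
    using G[unfolded riesz_bounded_def, rule_format, of "{}"] by simp
  obtain g N where g: "g \<in> borel_measurable borel" "negligible N"
    "\<forall>x. x \<notin> N \<longrightarrow> (G has_real_derivative g x) (at x)"
    using AC_fundamental_theorem[OF riesz_bounded_AC[OF G p]] by blast
  have ae: "AE x in lebesgue. (G has_real_derivative g x) (at x)"
    by (rule AE_I'[of N]) (use g(2,3) in \<open>auto simp: negligible_iff_null_sets\<close>)
  have gm: "g \<in> borel_measurable lebesgue" using g(1) by (simp add: measurable_completion)
  have dm: "deriv G \<in> borel_measurable lebesgue"
  proof (rule borel_measurable_AE[OF gm])
    show "AE x in lebesgue. g x = deriv G x" using ae by eventually_elim (simp add: DERIV_imp_deriv)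
  qed
  \<comment> \<open>The same index governs the mesh and the window, so that a single sequence
    reaches the whole line.\<close>
  let ?u = "\<lambda>n x. ennreal (\<bar>dyadic_slope G n x\<bar> powr p) * indicator {- real n..<real n} x"
  have "(\<integral>\<^sup>+x. ennreal (\<bar>deriv G x\<bar> powr p) \<partial>lebesgue) \<le> (\<integral>\<^sup>+x. liminf (\<lambda>n. ?u n x) \<partial>lebesgue)"
  proof (rule nn_integral_mono_AE)
    show "AE x in lebesgue. ennreal (\<bar>deriv G x\<bar> powr p) \<le> liminf (\<lambda>n. ?u n x)"
      using ae
    proof eventually_elim
      case (elim x)
      have d: "(\<lambda>n. dyadic_slope G n x) \<longlonglongrightarrow> deriv G x"
        using DERIV_dyadic_slope[OF elim] DERIV_imp_deriv[OF elim] by simp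
      have "(\<lambda>n. ennreal (\<bar>dyadic_slope G n x\<bar> powr p)) \<longlonglongrightarrow> ennreal (\<bar>deriv G x\<bar> powr p)"
        using p by (intro tendsto_ennrealI tendsto_powr' tendsto_rabs d) auto
      moreover obtain k :: nat where k: "\<bar>x\<bar> < real k" using reals_Archimedean2 by blast
      then have "\<forall>\<^sub>F n in sequentially. ennreal (\<bar>dyadic_slope G n x\<bar> powr p) = ?u n x"
        unfolding eventually_sequentially by (intro exI[of _ k]) (auto simp: abs_if split: if_splits)
      ultimately have "(\<lambda>n. ?u n x) \<longlonglongrightarrow> ennreal (\<bar>deriv G x\<bar> powr p)"
        by (rule Lim_transform_eventually)
      then show ?case by (simp add: lim_imp_Liminf)
    qed
  qed
  also have "\<dots> = (\<integral>\<^sup>+x. liminf (\<lambda>n. ?u n x) \<partial>lborel)"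
    by (rule nn_integral_completion)
  also have "\<dots> \<le> liminf (\<lambda>n. (\<integral>\<^sup>+x. ?u n x \<partial>lborel))"
    by (rule nn_integral_liminf) measurable
  also have "\<dots> \<le> ennreal M"
  proof (rule Liminf_le)
    show "\<forall>\<^sub>F n in sequentially. (\<integral>\<^sup>+x. ?u n x \<partial>lborel) \<le> ennreal M"
    proof (rule always_eventually, rule allI)
      fix n
      let ?S = "{- int n * 2 ^ n..<int n * 2 ^ n}"
      let ?D = "(\<lambda>k. {dyadic n k..dyadic n (k + 1)}) ` ?S"
      have "(\<integral>\<^sup>+x. ?u n x \<partial>lborel) \<le> ennreal ((\<Sum>k\<in>?S. \<bar>2 ^ n * dyadic_incr G n k\<bar> powr p) / 2 ^ n)"
        by (rule nn_integral_dyadic_slope) simp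
      also have "(\<Sum>k\<in>?S. \<bar>2 ^ n * dyadic_incr G n k\<bar> powr p) / 2 ^ n
         = (\<Sum>K\<in>?D. \<bar>G (Sup K) - G (Inf K)\<bar> powr p / (Sup K - Inf K) powr (p - 1))"
      proof -
        have "(\<Sum>K\<in>?D. \<bar>G (Sup K) - G (Inf K)\<bar> powr p / (Sup K - Inf K) powr (p - 1))
          = (\<Sum>k\<in>?S. \<bar>dyadic_incr G n k\<bar> powr p / (1 / 2 ^ n) powr (p - 1))"
          using dyadic_division(2)[of ?S n] by (simp add: sum.reindex dyadic_Suc_minus dyadic_incr_def)
        also have "\<dots> = (\<Sum>k\<in>?S. \<bar>2 ^ n * dyadic_incr G n k\<bar> powr p / 2 ^ n)"
          by (rule sum.cong) (simp_all add: abs_mult powr_mult powr_diff powr_divide)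
        finally show ?thesis by (simp add: sum_divide_distrib)
      qed
      also have "ennreal \<dots> \<le> ennreal M"
        using G dyadic_division(1)[of ?S n] by (intro ennreal_leI) (simp add: riesz_bounded_def)
      finally show "(\<integral>\<^sup>+x. ?u n x \<partial>lborel) \<le> ennreal M" .
    qed
  qed simp
  finally have le: "(\<integral>\<^sup>+x. ennreal (\<bar>deriv G x\<bar> powr p) \<partial>lebesgue) \<le> ennreal M" .
  have pm: "(\<lambda>x. \<bar>deriv G x\<bar> powr p) \<in> borel_measurable lebesgue" using dm by measurable
  have "integrable lebesgue (\<lambda>x. \<bar>deriv G x\<bar> powr p)"
    by (rule integrableI_bounded[OF pm]) (use le order_le_less_trans[OF le] in simp)
  then show "deriv G \<in> Lp_space p" using dm by (simp add: Lp_space_def)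
  show "(LINT x|lebesgue. \<bar>deriv G x\<bar> powr p) \<le> M"
    using le M pm by (subst integral_eq_nn_integral) (auto intro!: enn2real_leI)
qed

theorem riesz_bounded_hom_Sobolev:
  assumes D: "deriv_chain (m - 1) D" and m: "m \<ge> 1" and r: "riesz_bounded p M (D (m - 1))" and p: "p > 1"
  shows "D 0 \<in> hom_Sobolev m p" "hom_Sobolev_seminorm m p (D 0) \<le> M powr (1 / p)"
    "(deriv ^^ m) (D 0) = deriv (D (m - 1))"
proof -
  have eq: "(deriv ^^ k) (D 0) = D k" if "k \<le> m - 1" for k using deriv_chain_deriv[OF D that] .
  show top: "(deriv ^^ m) (D 0) = deriv (D (m - 1))"
    using eq[of "m - 1"] m by (cases m) auto
  have "(deriv ^^ k) (D 0) differentiable at x" if "Suc k < m" for k x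
  proof -
    have "k < m - 1" using that by linarith
    then have "(D k has_real_derivative D (Suc k) x) (at x)" using D unfolding deriv_chain_def by blast
    then show ?thesis using eq[of k] \<open>k < m - 1\<close> unfolding real_differentiable_def by auto
  qed
  then show "D 0 \<in> hom_Sobolev m p"
    unfolding hom_Sobolev_def using eq[of "m - 1"] riesz_bounded_AC[OF r p] riesz_bounded_deriv(1)[OF r p] top by simp
  show "hom_Sobolev_seminorm m p (D 0) \<le> M powr (1 / p)"
    unfolding hom_Sobolev_seminorm_def Lp_norm_def top
    using riesz_bounded_deriv(2)[OF r p] p by (intro powr_mono2) auto
qed

section \<open>Derivative chains, smooth steps and Lagrange interpolation\<close>

lemma deriv_chain_mono: "deriv_chain n D \<Longrightarrow> k \<le> n \<Longrightarrow> deriv_chain k D"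
  by (auto simp: deriv_chain_def)

lemma deriv_chain_add: "deriv_chain n D \<Longrightarrow> deriv_chain n E \<Longrightarrow> deriv_chain n (\<lambda>k x. D k x + E k x)"
  by (auto simp: deriv_chain_def intro!: DERIV_add)

lemma deriv_chain_diff: "deriv_chain n D \<Longrightarrow> deriv_chain n E \<Longrightarrow> deriv_chain n (\<lambda>k x. D k x - E k x)"
  by (auto simp: deriv_chain_def intro!: DERIV_diff)

lemma deriv_chain_sum:
  "(\<And>i. i \<in> A \<Longrightarrow> deriv_chain n (D i)) \<Longrightarrow> deriv_chain n (\<lambda>k x. \<Sum>i\<in>A. D i k x)"
  by (auto simp: deriv_chain_def intro!: DERIV_sum)

lemma deriv_chain_poly: "deriv_chain n (\<lambda>k. poly ((pderiv ^^ k) Q))"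
  by (auto simp: deriv_chain_def intro: poly_DERIV)

lemma deriv_chain_affine:
  assumes "deriv_chain n D" "l \<noteq> 0"
  shows "deriv_chain n (\<lambda>k x. D k ((x - a) / l) / l ^ k)"
  unfolding deriv_chain_def
proof (intro allI impI)
  fix k x assume "k < n"
  then have "(D k has_real_derivative D (Suc k) ((x - a) / l)) (at ((x - a) / l))"
    using assms by (simp add: deriv_chain_def)
  then have "((\<lambda>x. D k ((x - a) / l)) has_real_derivative D (Suc k) ((x - a) / l) * (1 / l)) (at x)"
    by (rule DERIV_chain2) (use assms in \<open>auto intro!: derivative_eq_intros\<close>)
  from DERIV_cdivide[OF this, of "l ^ k"]
  show "((\<lambda>x. D k ((x - a) / l) / l ^ k) has_real_derivative D (Suc k) ((x - a) / l) / l ^ Suc k) (at x)"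
    by simp
qed

text \<open>Pascal's rule, with the derivatives at a point treated as arbitrary sequences.\<close>

lemma Leibniz_step:
  fixes a b :: "nat \<Rightarrow> real"
  shows "(\<Sum>r\<le>k. real (k choose r) * (a (Suc r) * b (k - r) + a r * b (Suc (k - r))))
    = (\<Sum>r\<le>Suc k. real (Suc k choose r) * (a r * b (Suc k - r)))"
proof -
  have "(\<Sum>r\<le>k. real (k choose r) * (a r * b (Suc (k - r)))) = (\<Sum>r\<le>k. real (k choose r) * (a r * b (Suc k - r)))"
    by (rule sum.cong) (auto simp: Suc_diff_le)
  also have "\<dots> = (\<Sum>r\<le>Suc k. real (k choose r) * (a r * b (Suc k - r)))" by simp
  also have "\<dots> = a 0 * b (Suc k) + (\<Sum>r\<le>k. real (k choose Suc r) * (a (Suc r) * b (k - r)))"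
    by (subst sum.atMost_Suc_shift) simp
  finally have 1: "(\<Sum>r\<le>k. real (k choose r) * (a r * b (Suc (k - r)))) = \<dots>" .
  have "(\<Sum>r\<le>Suc k. real (Suc k choose r) * (a r * b (Suc k - r)))
    = a 0 * b (Suc k) + (\<Sum>r\<le>k. real (Suc k choose Suc r) * (a (Suc r) * b (k - r)))"
    by (subst sum.atMost_Suc_shift) simp
  also have "(\<Sum>r\<le>k. real (Suc k choose Suc r) * (a (Suc r) * b (k - r)))
    = (\<Sum>r\<le>k. real (k choose r) * (a (Suc r) * b (k - r))) + (\<Sum>r\<le>k. real (k choose Suc r) * (a (Suc r) * b (k - r)))"
    by (simp add: sum.distrib[symmetric] algebra_simps)
  finally show ?thesis using 1 by (simp add: distrib_left sum.distrib)
qed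

lemma deriv_chain_mult:
  assumes "deriv_chain n U" "deriv_chain n V"
  shows "deriv_chain n (\<lambda>k x. \<Sum>r\<le>k. real (k choose r) * (U r x * V (k - r) x))"
  unfolding deriv_chain_def
proof (intro allI impI)
  fix k x assume "k < n"
  have "((\<lambda>x. \<Sum>r\<le>k. real (k choose r) * (U r x * V (k - r) x)) has_real_derivative
    (\<Sum>r\<le>k. real (k choose r) * (U (Suc r) x * V (k - r) x + U r x * V (Suc (k - r)) x))) (at x)"
  proof (rule DERIV_sum)
    fix r assume "r \<in> {..k}"
    then have "(U r has_real_derivative U (Suc r) x) (at x)" "(V (k - r) has_real_derivative V (Suc (k - r)) x) (at x)"
      using assms \<open>k < n\<close> by (auto simp: deriv_chain_def)
    then show "((\<lambda>x. real (k choose r) * (U r x * V (k - r) x)) has_real_derivative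
        real (k choose r) * (U (Suc r) x * V (k - r) x + U r x * V (Suc (k - r)) x)) (at x)"
      by (auto intro!: derivative_eq_intros)
  qed
  then show "((\<lambda>x. \<Sum>r\<le>k. real (k choose r) * (U r x * V (k - r) x)) has_real_derivative
    (\<Sum>r\<le>Suc k. real (Suc k choose r) * (U r x * V (Suc k - r) x))) (at x)"
    by (simp only: Leibniz_step[of k "\<lambda>r. U r x" "\<lambda>r. V r x"])
qed

section \<open>Smooth steps of finite order\<close>

lemma DERIV_pos_part_power:
  "((\<lambda>x. (max 0 x) ^ Suc (Suc j)) has_real_derivative real (Suc (Suc j)) * (max 0 x) ^ Suc j) (at (x :: real))"
proof -
  consider "x < 0" | "x > 0" | "x = 0" by linarith
  then show ?thesis
  proof cases
    case 1
    have "((\<lambda>x. 0) has_real_derivative 0) (at x)" by simp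
    then have "((\<lambda>x. (max 0 x) ^ Suc (Suc j)) has_real_derivative 0) (at x)"
      by (rule has_field_derivative_transform_within_open[where S = "{..<0}"]) (use 1 in auto)
    then show ?thesis using 1 by simp
  next
    case 2
    have "((\<lambda>x. x ^ Suc (Suc j)) has_real_derivative real (Suc (Suc j)) * x ^ Suc j) (at x)"
      using DERIV_pow[of "Suc (Suc j)" x] by simp
    then have "((\<lambda>x. (max 0 x) ^ Suc (Suc j)) has_real_derivative real (Suc (Suc j)) * x ^ Suc j) (at x)"
      by (rule has_field_derivative_transform_within_open[where S = "{0<..}"]) (use 2 in auto)
    then show ?thesis using 2 by simp
  next
    case 3
    have "((\<lambda>y. (max 0 y) ^ Suc (Suc j) / y) \<longlongrightarrow> 0) (at (0 :: real))"
    proof (rule tendsto_rabs_zero_cancel, rule tendsto_sandwich[OF _ _ tendsto_const])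
      have "((\<lambda>y::real. \<bar>y\<bar> ^ Suc j) \<longlongrightarrow> \<bar>0\<bar> ^ Suc j) (at 0)" by (intro tendsto_intros)
      then show "((\<lambda>y::real. \<bar>y\<bar> ^ Suc j) \<longlongrightarrow> 0) (at 0)" by simp
      show "\<forall>\<^sub>F y in at (0 :: real). \<bar>(max 0 y) ^ Suc (Suc j) / y\<bar> \<le> \<bar>y\<bar> ^ Suc j"
      proof (rule always_eventually, rule allI)
        fix y :: real
        show "\<bar>(max 0 y) ^ Suc (Suc j) / y\<bar> \<le> \<bar>y\<bar> ^ Suc j"
        proof (cases "y \<le> 0")
          case True
          then have "\<bar>(max 0 y) ^ Suc (Suc j) / y\<bar> = 0" by simp
          then show ?thesis using zero_le_power_abs[of y "Suc j"] by (simp only:)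
        qed (simp add: abs_mult power_abs)
      qed
    qed auto
    then show ?thesis using 3 by (simp add: has_field_derivative_iff)
  qed
qed

text \<open>The bump is the product of the power \<open>q = n + 1\<close> of the positive part of
  \<open>x\<close> and of the positive part of \<open>1 - x\<close>. Up to order \<open>n\<close>
  the derivatives \<open>U k\<close> keep a positive exponent and hence vanish at the
  junction.\<close>

lemma deriv_chain_bump:
  obtains W where "deriv_chain n W" "\<And>k x. k \<le> n \<Longrightarrow> x \<le> 0 \<or> x \<ge> 1 \<Longrightarrow> W k x = 0"
    "\<And>x. 0 < x \<Longrightarrow> x < 1 \<Longrightarrow> W 0 x > (0 :: real)"
proof
  define q where "q = Suc n"
  define U where "U k x = fact q / fact (q - k) * (max 0 x) ^ (q - k)" for k and x :: real
  define V where "V k x = U k (1 - x) * (-1) ^ k" for k x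
  let ?W = "\<lambda>k x. \<Sum>r\<le>k. real (k choose r) * (U r x * V (k - r) x)"
  have U: "deriv_chain n U"
    unfolding deriv_chain_def
  proof (intro allI impI)
    fix k x assume "k < n"
    then obtain j where j: "q - k = Suc (Suc j)" "q - Suc k = Suc j"
      by (metis Suc_diff_Suc Suc_diff_le less_imp_le_nat q_def diff_Suc_Suc)
    show "(U k has_real_derivative U (Suc k) x) (at x)"
      unfolding U_def[abs_def] j
      by (rule DERIV_cong[OF DERIV_cmult[OF DERIV_pos_part_power]]) (simp del: fact_Suc of_nat_Suc add: fact_Suc[of "Suc j"])
  qed
  have V: "deriv_chain n V"
    unfolding deriv_chain_def
  proof (intro allI impI)
    fix k x assume "k < n"
    then have "(U k has_real_derivative U (Suc k) (1 - x)) (at (1 - x))" using U by (simp add: deriv_chain_def)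
    then have "((\<lambda>x. U k (1 - x)) has_real_derivative U (Suc k) (1 - x) * (-1)) (at x)"
      by (rule DERIV_chain2) (auto intro!: derivative_eq_intros)
    from DERIV_cmult_right[OF this, of "(-1) ^ k"]
    show "(V k has_real_derivative V (Suc k) x) (at x)"
      unfolding V_def[abs_def] by (simp add: mult.commute mult.left_commute)
  qed
  show "deriv_chain n ?W" by (rule deriv_chain_mult[OF U V])
  have U0: "U k x = 0" if "k \<le> n" "x \<le> 0" for k x
    using that by (simp add: U_def q_def Suc_diff_le)
  show "?W k x = 0" if "k \<le> n" "x \<le> 0 \<or> x \<ge> 1" for k x
    using that by (intro sum.neutral) (auto simp: V_def U0)
  show "?W 0 x > 0" if "0 < x" "x < 1" for x
    using that by (simp add: U_def V_def)
qed

lemma continuous_antiderivative: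
  fixes f :: "real \<Rightarrow> real"
  assumes "continuous_on UNIV f"
  obtains s where "\<And>x. (s has_real_derivative f x) (at x)"
proof -
  have int: "f integrable_on {a..b}" for a b
    by (rule integrable_continuous_real) (use assms continuous_on_subset in blast)
  obtain s where s: "\<And>a b. a \<le> b \<Longrightarrow> s b - s a = integral {a..b} f"
    using exists_indefinite_integral[OF int] by blast
  have "(s has_real_derivative f x) (at x)" for x
  proof -
    have "((\<lambda>y. integral {x - 1..y} f) has_real_derivative f x) (at x within {x - 1..x + 1})"
      by (rule integral_has_real_derivative) (use assms continuous_on_subset in auto)
    moreover have "at x within {x - 1..x + 1} = at x" by (rule at_within_interior) (auto simp: interior_atLeastAtMost_real)
    ultimately have "((\<lambda>y. integral {x - 1..y} f + s (x - 1)) has_real_derivative f x) (at x)"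
      by (auto intro!: derivative_eq_intros)
    then show ?thesis
    proof (rule has_field_derivative_transform_within_open[where S = "{x - 1<..<x + 1}"])
      fix y assume "y \<in> {x - 1<..<x + 1}"
      then show "integral {x - 1..y} f + s (x - 1) = s y" using s[of "x - 1" y] by simp
    qed auto
  qed
  then show thesis by (rule that)
qed

text \<open>The step is the normalised primitive of a bump, so its derivative of order
  \<open>k\<close> is a multiple of the bump's derivative of order \<open>k - 1\<close>. Only
  \<open>n\<close> enters the construction, which makes \<open>B\<close> a constant depending on the
  order alone.\<close>

lemma smoothstep_exists:
  obtains \<sigma> B where "deriv_chain n \<sigma>" "B \<ge> (1 :: real)"
    "\<And>x. x \<le> 0 \<Longrightarrow> \<sigma> 0 x = 0" "\<And>x. x \<ge> 1 \<Longrightarrow> \<sigma> 0 x = 1"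
    "\<And>k x. 1 \<le> k \<Longrightarrow> k \<le> n \<Longrightarrow> x \<le> 0 \<or> x \<ge> 1 \<Longrightarrow> \<sigma> k x = 0"
    "\<And>k x. k \<le> n \<Longrightarrow> \<bar>\<sigma> k x\<bar> \<le> B"
proof -
  obtain W where W: "deriv_chain (Suc n) W" "\<And>k x. k \<le> Suc n \<Longrightarrow> x \<le> 0 \<or> x \<ge> 1 \<Longrightarrow> W k x = 0"
    "\<And>x. 0 < x \<Longrightarrow> x < 1 \<Longrightarrow> W 0 x > (0 :: real)"
    using deriv_chain_bump[of "Suc n"] by blast
  have contW: "continuous_on A (W k)" if "k \<le> n" for k A
  proof -
    have "(W k has_real_derivative W (Suc k) x) (at x)" for x using W(1) that by (simp add: deriv_chain_def)
    then show ?thesis by (intro continuous_at_imp_continuous_on ballI DERIV_isCont)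
  qed
  obtain s where s: "\<And>x. (s has_real_derivative W 0 x) (at x)"
    using continuous_antiderivative[OF contW[of 0 UNIV]] by auto
  have const: "s x = s y" if xy: "x < y" "y \<le> 0 \<or> 1 \<le> x" for x y
  proof -
    obtain z where "z > x" "z < y" "s y - s x = (y - x) * W 0 z" using MVT2[OF xy(1), of s "W 0"] s by blast
    then show ?thesis using W(2)[of 0 z] xy by auto
  qed
  define c where "c = s 1 - s 0"
  have c: "c > 0"
  proof -
    obtain z where "z > 0" "z < 1" "s 1 - s 0 = (1 - 0) * W 0 z" using MVT2[of 0 1 s "W 0"] s by auto
    then show ?thesis using W(3)[of z] by (simp add: c_def)
  qed
  define \<sigma> where "\<sigma> k x = (case k of 0 \<Rightarrow> (s x - s 0) / c | Suc j \<Rightarrow> W j x / c)" for k x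
  have ch: "deriv_chain n \<sigma>"
    unfolding deriv_chain_def
  proof (intro allI impI)
    fix k x assume "k < n"
    show "(\<sigma> k has_real_derivative \<sigma> (Suc k) x) (at x)"
    proof (cases k)
      case 0
      then show ?thesis using s[of x] c unfolding \<sigma>_def[abs_def] by (auto intro!: derivative_eq_intros)
    next
      case (Suc j)
      then have "(W j has_real_derivative W (Suc j) x) (at x)" using W(1) \<open>k < n\<close> by (simp add: deriv_chain_def)
      then show ?thesis using c Suc unfolding \<sigma>_def[abs_def] by (auto intro!: derivative_eq_intros)
    qed
  qed
  have s0: "\<sigma> 0 x = 0" if "x \<le> 0" for x using const[of x 0] that by (cases "x = 0") (auto simp: \<sigma>_def)
  have s1: "\<sigma> 0 x = 1" if "x \<ge> 1" for x using const[of 1 x] that c by (cases "x = 1") (auto simp: \<sigma>_def c_def)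
  have sk: "\<sigma> k x = 0" if "1 \<le> k" "k \<le> n" "x \<le> 0 \<or> x \<ge> 1" for k x
    using that W(2)[of "k - 1" x] by (cases k) (auto simp: \<sigma>_def)
  have "\<exists>B. \<forall>x. \<bar>\<sigma> k x\<bar> \<le> B" if "k \<le> n" for k
  proof -
    have cont: "continuous_on {0..1} (\<sigma> k)"
    proof (cases k)
      case 0
      have "continuous_on {0..1} s" using s by (intro continuous_at_imp_continuous_on) (auto intro!: DERIV_isCont)
      then show ?thesis using 0 unfolding \<sigma>_def[abs_def] by (auto intro!: continuous_intros simp: c[THEN less_imp_neq, symmetric])
    next
      case (Suc j)
      then show ?thesis using contW[of j] that c unfolding \<sigma>_def[abs_def] by (auto intro!: continuous_intros)
    qed
    have "bounded (\<sigma> k ` {0..1})" by (intro compact_imp_bounded compact_continuous_image cont) simp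
    then obtain B where "\<forall>y\<in>\<sigma> k ` {0..1}. norm y \<le> B" unfolding bounded_iff by blast
    then have B: "\<bar>\<sigma> k x\<bar> \<le> B" if "x \<in> {0..1}" for x using that by auto
    have "\<bar>\<sigma> k x\<bar> \<le> max B 1" for x
      using B[of x] s0[of x] s1[of x] sk[of k x] that
      by (cases "k = 0"; cases "x \<in> {0..1}") (auto simp: le_max_iff_disj not_le)
    then show ?thesis by blast
  qed
  then obtain b where b: "\<And>k x. k \<le> n \<Longrightarrow> \<bar>\<sigma> k x\<bar> \<le> b k" by metis
  have "\<bar>\<sigma> k x\<bar> \<le> Max (insert 1 (b ` {..n}))" if "k \<le> n" for k x
    using b[OF that, of x] that by (intro order_trans[OF _ Max_ge[of _ "b k"]]) auto
  moreover have "Max (insert 1 (b ` {..n})) \<ge> 1" by (intro Max_ge) auto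
  ultimately show thesis by (intro that[OF ch _ s0 s1 sk])
qed

section \<open>Lagrange interpolation\<close>

definition lagrange :: "real set \<Rightarrow> (real \<Rightarrow> real) \<Rightarrow> real poly" where
  "lagrange S f = (\<Sum>s\<in>S. smult (f s / (\<Prod>u\<in>S - {s}. s - u)) (\<Prod>u\<in>S - {s}. [:- u, 1:]))"

lemma degree_prod_linear: "degree (\<Prod>u\<in>S. [:- u, 1:]) \<le> card S" for S :: "real set"
proof (cases "finite S")
  case True
  have "degree (\<Prod>u\<in>S. [:- u, 1:]) \<le> sum (degree \<circ> (\<lambda>u. [:- u, 1:])) S" by (rule degree_prod_sum_le[OF True])
  then show ?thesis by simp
qed simp

lemma degree_lag:
  assumes "finite S"
  shows "degree (lagrange S f) \<le> card S - 1"
  unfolding lagrange_def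
proof (rule degree_sum_le[OF assms])
  fix s assume "s \<in> S"
  then show "degree (smult (f s / (\<Prod>u\<in>S - {s}. s - u)) (\<Prod>u\<in>S - {s}. [:- u, 1:])) \<le> card S - 1"
    using degree_prod_linear[of "S - {s}"] assms
    by (intro order_trans[OF degree_smult_le]) (simp add: card_Diff_singleton)
qed

lemma poly_lag:
  assumes "finite S" "x \<in> S"
  shows "poly (lagrange S f) x = f x"
proof -
  have "poly (lagrange S f) x = (\<Sum>s\<in>S. f s / (\<Prod>u\<in>S - {s}. s - u) * (\<Prod>u\<in>S - {s}. x - u))"
    by (simp add: lagrange_def poly_sum poly_prod)
  also have "\<dots> = (\<Sum>s\<in>S. if s = x then f x else 0)"
  proof (rule sum.cong)
    fix s assume "s \<in> S"
    show "f s / (\<Prod>u\<in>S - {s}. s - u) * (\<Prod>u\<in>S - {s}. x - u) = (if s = x then f x else 0)"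
    proof (cases "s = x")
      case True
      have "(\<Prod>u\<in>S - {x}. x - u) \<noteq> 0" using assms by (subst prod_zero_iff) auto
      then show ?thesis using True by simp
    next
      case False
      then have "(\<Prod>u\<in>S - {s}. x - u) = 0" using assms by (intro prod_zero) auto
      then show ?thesis using False by simp
    qed
  qed simp
  also have "\<dots> = f x" using assms by simp
  finally show ?thesis .
qed

lemma lagrange_add: "(\<And>x. x \<in> S \<Longrightarrow> h x = f x + g x) \<Longrightarrow> lagrange S h = lagrange S f + lagrange S g"
  unfolding lagrange_def by (simp add: sum.distrib[symmetric] add_divide_distrib smult_add_left)

lemma lagrange_cmult: "(\<And>x. x \<in> S \<Longrightarrow> h x = c * f x) \<Longrightarrow> lagrange S h = smult c (lagrange S f)"
  by (rule poly_eqI) (simp add: lagrange_def coeff_sum sum_distrib_left mult.assoc)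

section \<open>Rolle's theorem and polynomials given by their zeros\<close>

text \<open>The induction adds the largest zero \<open>M\<close>. The new zero of \<open>f'\<close>
  lies between \<open>M\<close> and the previous maximum, hence to the right of all zeros of
  \<open>f'\<close> found before.\<close>

lemma Rolle_set:
  fixes f :: "real \<Rightarrow> real"
  assumes "finite S" "\<And>x. x \<in> S \<Longrightarrow> f x = 0" "S \<subseteq> {a..b}" "\<And>x. (f has_real_derivative f' x) (at x)"
  shows "\<exists>S'. finite S' \<and> card S' = card S - 1 \<and> S' \<subseteq> {a..b} \<and> (\<forall>x\<in>S'. f' x = 0)"
  using assms(1-3)
proof (induction S arbitrary: b rule: finite_linorder_max_induct)
  case (insert M S)
  show ?case
  proof (cases "S = {}")
    case False
    let ?c = "Max S"
    have c: "?c \<in> S" "?c < M" "\<And>x. x \<in> S \<Longrightarrow> x \<le> ?c" using False insert.hyps by auto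
    then have "\<exists>S'. finite S' \<and> card S' = card S - 1 \<and> S' \<subseteq> {a..?c} \<and> (\<forall>x\<in>S'. f' x = 0)"
      using insert.prems by (intro insert.IH) (auto dest: c(3))
    then obtain S' where S': "finite S'" "card S' = card S - 1" "S' \<subseteq> {a..?c}" "\<forall>x\<in>S'. f' x = 0" by blast
    obtain z where z: "?c < z" "z < M" "f' z = 0"
    proof -
      obtain z where "?c < z" "z < M" "f M - f ?c = (M - ?c) * f' z" using MVT2[OF c(2), of f f'] assms(4) by blast
      then show thesis using insert.prems(1) c(1,2) that by auto
    qed
    have "z \<notin> S'" using S'(3) z(1) by auto
    moreover have "card S \<ge> 1" using c(1) insert.hyps(1) by (simp add: card_gt_0_iff Suc_le_eq) blast
    ultimately have "card (insert z S') = card (insert M S) - 1"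
      using S' insert.hyps by auto
    moreover have "insert z S' \<subseteq> {a..b}"
      using S'(3) z c insert.prems(2) by (auto intro: order_trans less_imp_le dest: subsetD)
    ultimately show ?thesis using S' z by (intro exI[of _ "insert z S'"]) auto
  qed (auto intro: exI[of _ "{}"])
qed (auto intro: exI[of _ "{}"])

lemma generalized_Rolle:
  assumes "deriv_chain n D" "k \<le> n" "finite S" "card S > k" "\<And>x. x \<in> S \<Longrightarrow> D 0 x = 0" "S \<subseteq> {a..b}"
  shows "\<exists>\<xi>\<in>{a..b}. D k \<xi> = 0"
proof -
  have "\<exists>S'. finite S' \<and> card S' = card S - k \<and> S' \<subseteq> {a..b} \<and> (\<forall>x\<in>S'. D k x = 0)"
    using assms(2)
  proof (induction k)
    case 0
    then show ?case using assms by (intro exI[of _ S]) auto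
  next
    case (Suc k)
    then obtain S' where S': "finite S'" "card S' = card S - k" "S' \<subseteq> {a..b}" "\<forall>x\<in>S'. D k x = 0" by auto
    show ?case
      using Rolle_set[of S' "D k" a b "D (Suc k)"] S' assms(1) Suc.prems by (auto simp: deriv_chain_def)
  qed
  then obtain S' where S': "finite S'" "card S' = card S - k" "S' \<subseteq> {a..b}" "\<forall>x\<in>S'. D k x = 0" by blast
  then have "S' \<noteq> {}" using assms(4) by auto
  then show ?thesis using S' by blast
qed

lemma pderiv_linear_mult:
  "(pderiv ^^ r) ([:- u, 1:] * R) = [:- u, 1:] * (pderiv ^^ r) R + of_nat r * (pderiv ^^ (r - 1)) R" for R :: "real poly"
proof (induction r)
  case (Suc r)
  have "(pderiv ^^ Suc r) ([:- u, 1:] * R) = pderiv ([:- u, 1:] * (pderiv ^^ r) R + of_nat r * (pderiv ^^ (r - 1)) R)"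
    using Suc by simp
  also have "\<dots> = [:- u, 1:] * (pderiv ^^ Suc r) R + (pderiv ^^ r) R + of_nat r * pderiv ((pderiv ^^ (r - 1)) R)"
  proof -
    have A: "pderiv [:- u, 1:] = (1 :: real poly)" by (simp add: pderiv_pCons)
    have B: "pderiv (of_nat r * Q) = of_nat r * pderiv Q" for Q :: "real poly" by (simp add: pderiv_mult)
    show ?thesis by (simp only: pderiv_add pderiv_mult[of "[:- u, 1:]"] A B funpow.simps comp_apply mult_1_right)
  qed
  also have "of_nat r * pderiv ((pderiv ^^ (r - 1)) R) = of_nat r * (pderiv ^^ r) R"
    by (cases r) auto
  finally show ?case by (simp add: algebra_simps)
qed simp

text \<open>By the Leibniz rule each further linear factor produces two terms with the same bound,
  whence the power of 2. The power of \<open>L\<close> is written as a quotient because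
  \<open>r\<close> may exceed \<open>card S\<close>.\<close>

lemma poly_pderiv_prod_bound:
  fixes S :: "real set"
  assumes "finite S" "\<And>u. u \<in> S \<Longrightarrow> \<bar>x - u\<bar> \<le> L" "L > 0"
  shows "\<bar>poly ((pderiv ^^ r) (\<Prod>u\<in>S. [:- u, 1:])) x\<bar> \<le> fact r * 2 ^ card S * L ^ card S / L ^ r"
  using assms(1,2)
proof (induction S arbitrary: r rule: finite_induct)
  case empty
  have "(pderiv ^^ Suc j) 1 = (0 :: real poly)" for j by (induction j) (auto simp: pderiv_1)
  then show ?case using \<open>L > 0\<close> by (cases r) auto
next
  case (insert v S)
  let ?R = "\<Prod>u\<in>S. [:- u, 1:]" and ?d = "card S"
  have IH: "\<bar>poly ((pderiv ^^ r) ?R) x\<bar> \<le> fact r * 2 ^ ?d * L ^ ?d / L ^ r" for r using insert by auto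
  have "\<bar>poly ((pderiv ^^ r) ([:- v, 1:] * ?R)) x\<bar>
    \<le> \<bar>x - v\<bar> * \<bar>poly ((pderiv ^^ r) ?R) x\<bar> + r * \<bar>poly ((pderiv ^^ (r - 1)) ?R) x\<bar>"
  proof -
    have "poly ((pderiv ^^ r) ([:- v, 1:] * ?R)) x
      = (x - v) * poly ((pderiv ^^ r) ?R) x + r * poly ((pderiv ^^ (r - 1)) ?R) x"
      unfolding pderiv_linear_mult by (simp add: algebra_simps)
    then show ?thesis
      using abs_triangle_ineq[of "(x - v) * poly ((pderiv ^^ r) ?R) x" "r * poly ((pderiv ^^ (r - 1)) ?R) x"]
      by (simp add: abs_mult)
  qed
  also have "\<bar>x - v\<bar> * \<bar>poly ((pderiv ^^ r) ?R) x\<bar> \<le> L * (fact r * 2 ^ ?d * L ^ ?d / L ^ r)"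
    using insert.prems assms(3) by (intro mult_mono IH) auto
  also have "r * \<bar>poly ((pderiv ^^ (r - 1)) ?R) x\<bar> \<le> L * (fact r * 2 ^ ?d * L ^ ?d / L ^ r)"
  proof (cases r)
    case (Suc j)
    have "r * \<bar>poly ((pderiv ^^ (r - 1)) ?R) x\<bar> \<le> r * (fact (r - 1) * 2 ^ ?d * L ^ ?d / L ^ (r - 1))"
      by (intro mult_left_mono IH) auto
    also have "\<dots> = L * (fact r * 2 ^ ?d * L ^ ?d / L ^ r)" using Suc assms(3) by (simp add: field_simps)
    finally show ?thesis .
  qed (use assms in simp)
  finally show ?case using insert.hyps by (simp add: algebra_simps)
qed

section \<open>Interpolation at finitely many knots\<close>

text \<open>The sum is at most \<open>N\<close> times its largest term, and the power of that term
  is among the summands. The factor is left as \<open>N powr p\<close> because the root of order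
  \<open>p\<close> turns it into \<open>N\<close>.\<close>

lemma powr_sum_le:
  fixes s :: "'a \<Rightarrow> real"
  assumes "finite J" "card J \<le> N" "\<And>i. i \<in> J \<Longrightarrow> s i \<ge> 0" "p \<ge> 0"
  shows "(\<Sum>i\<in>J. s i) powr p \<le> real N powr p * (\<Sum>i\<in>J. s i powr p)"
proof (cases "J = {}")
  case False
  define M where "M = Max (s ` J)"
  have "M \<in> s ` J" unfolding M_def using assms(1) False by (intro Max_in) auto
  then obtain k where k: "k \<in> J" "s k = M" by blast
  have "(\<Sum>i\<in>J. s i) \<le> (\<Sum>i\<in>J. M)" unfolding M_def using assms(1) by (intro sum_mono Max_ge) auto
  also have "\<dots> \<le> N * M" using assms(2,3) k by (auto intro!: mult_right_mono)
  finally have "(\<Sum>i\<in>J. s i) powr p \<le> (N * M) powr p"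
    using assms by (intro powr_mono2 sum_nonneg) auto
  also have "\<dots> = N powr p * s k powr p" using assms(3) k by (simp add: powr_mult)
  also have "s k powr p \<le> (\<Sum>i\<in>J. s i powr p)" using assms(1) k by (intro member_le_sum) auto
  finally show ?thesis by (simp add: mult_left_mono)
qed (use assms in auto)

lemma incr_bounded_within:
  assumes "incr_bounded G h" "\<And>a b. h integrable_on {a..b}" "\<And>x. h x \<ge> 0" "u \<in> {a..b}" "v \<in> {a..b}"
  shows "\<bar>G u - G v\<bar> \<le> integral {a..b} h"
proof -
  have "\<bar>G y - G x\<bar> \<le> integral {a..b} h" if "x \<le> y" "a \<le> x" "y \<le> b" for x y
  proof -
    have "\<bar>G y - G x\<bar> \<le> integral {x..y} h" using assms(1) that by (simp add: incr_bounded_def)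
    also have "\<dots> \<le> integral {a..b} h"
      by (rule integral_subset_le) (use assms that in auto)
    finally show ?thesis .
  qed
  from this[of u v] this[of v u] show ?thesis using assms(4,5) by (cases "u \<le> v") auto
qed

lemma poly_higher_pderiv_degree:
  fixes P :: "real poly"
  assumes "degree P \<le> d"
  shows "poly ((pderiv ^^ d) P) x = fact d * coeff P d"
proof -
  have "degree ((pderiv ^^ d) P) = 0" using assms by (simp add: degree_higher_pderiv)
  then obtain a where "(pderiv ^^ d) P = [:a:]" by (rule degree_eq_zeroE)
  moreover have "coeff ((pderiv ^^ d) P) 0 = fact d * coeff P d"
    by (simp add: coeff_higher_pderiv pochhammer_fact)
  ultimately show ?thesis by simp
qed

lemma higher_pderiv_eq_0:
  assumes "degree P < d"
  shows "(pderiv ^^ d) P = (0 :: real poly)"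
  using assms by (intro poly_eqI) (simp add: coeff_higher_pderiv coeff_eq_0)

lemma coeff_prod_linear: "finite S \<Longrightarrow> coeff (\<Prod>u\<in>S. [:- u, 1:]) (card S) = (1 :: real)"
proof (induction S rule: finite_induct)
  case (insert v S)
  have "coeff (\<Prod>u\<in>S. [:- u, 1:]) (Suc (card S)) = (0 :: real)"
    using degree_prod_linear[of S] by (intro coeff_eq_0) simp
  then show ?case using insert by simp
qed simp

lemma poly_eq_smult_prod:
  fixes Q :: "real poly"
  assumes "finite S" "degree Q \<le> card S" "\<And>x. x \<in> S \<Longrightarrow> poly Q x = 0"
  shows "Q = smult (coeff Q (card S)) (\<Prod>u\<in>S. [:- u, 1:])"
proof (rule ccontr)
  let ?R = "Q - smult (coeff Q (card S)) (\<Prod>u\<in>S. [:- u, 1:])"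
  assume "\<not> ?thesis"
  then have R: "?R \<noteq> 0" by simp
  have "degree ?R \<le> card S"
    using assms(2) degree_prod_linear[of S] by (intro degree_diff_le order_trans[OF degree_smult_le])
  moreover have c0: "coeff ?R (card S) = 0" using coeff_prod_linear[OF assms(1)] by simp
  moreover have "degree ?R \<noteq> card S" using c0 R by (metis leading_coeff_0_iff)
  ultimately have "degree ?R < card S" by simp
  moreover have "S \<subseteq> {x. poly ?R x = 0}"
    using assms(1,3) by (auto simp: poly_prod intro: prod_zero)
  then have "card S \<le> card {x. poly ?R x = 0}" by (intro card_mono poly_roots_finite R)
  moreover have "card {x. poly ?R x = 0} \<le> degree ?R" by (rule card_poly_roots_bound[OF R])
  ultimately show False by linarith
qed

text \<open>The mean value form of a divided difference: \<open>D 0\<close> minus the interpolating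
  polynomial has \<open>d + 1\<close> zeros, so its derivative of order \<open>d\<close> has
  one.\<close>

lemma lagrange_leading_coeff:
  assumes D: "deriv_chain d D" and S: "finite S" "card S = Suc d" "S \<subseteq> {a..b}"
    and f: "\<And>x. x \<in> S \<Longrightarrow> f x = D 0 x"
  shows "\<exists>\<xi>\<in>{a..b}. D d \<xi> = fact d * coeff (lagrange S f) d"
proof -
  have "deriv_chain d (\<lambda>k x. D k x - poly ((pderiv ^^ k) (lagrange S f)) x)"
    by (intro deriv_chain_diff D deriv_chain_poly)
  from generalized_Rolle[OF this order_refl S(1) _ _ S(3)]
  obtain \<xi> where "\<xi> \<in> {a..b}" "D d \<xi> - poly ((pderiv ^^ d) (lagrange S f)) \<xi> = 0"
    using S poly_lag[OF S(1)] f by auto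
  then show ?thesis
    using poly_higher_pderiv_degree[of "lagrange S f" d \<xi>] degree_lag[OF S(1), of f] S(2) by auto
qed

section \<open>The interpolant at finitely many knots\<close>

text \<open>The constant of the Leibniz estimate: \<open>fact r * 2 ^ m\<close> bounds a derivative
  of a product of linear factors, \<open>B\<close> one of the step, and \<open>real m ^ m\<close> is
  the price for a gap that may be only 1/m of its window.\<close>

definition jump_const :: "nat \<Rightarrow> real \<Rightarrow> real" where
  "jump_const m B = (\<Sum>r\<le>m. real (m choose r) * (fact r * 2 ^ m * B * real m ^ m))"

text \<open>Here \<open>gap i\<close> is the index of the left end of a largest gap between \<open>t i\<close> and \<open>t (i + m)\<close>.\<close>
locale knots =
  fixes t :: "nat \<Rightarrow> real" and n m :: nat and \<sigma> :: "nat \<Rightarrow> real \<Rightarrow> real" and B :: real and gap :: "nat \<Rightarrow> nat"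
  assumes t_less: "\<And>i j. i < j \<Longrightarrow> j < n \<Longrightarrow> t i < t j"
    and m: "m \<ge> 1"
    and \<sigma>: "deriv_chain m \<sigma>" "\<And>x. x \<le> 0 \<Longrightarrow> \<sigma> 0 x = 0" "\<And>x. x \<ge> 1 \<Longrightarrow> \<sigma> 0 x = 1"
      "\<And>k x. 1 \<le> k \<Longrightarrow> k \<le> m \<Longrightarrow> x \<le> 0 \<or> x \<ge> 1 \<Longrightarrow> \<sigma> k x = 0"
      "\<And>k x. k \<le> m \<Longrightarrow> \<bar>\<sigma> k x\<bar> \<le> B"
    and gap: "\<And>i. i + m < n \<Longrightarrow> i \<le> gap i" "\<And>i. i + m < n \<Longrightarrow> gap i < i + m"
      "\<And>i. i + m < n \<Longrightarrow> t (i + m) - t i \<le> m * (t (Suc (gap i)) - t (gap i))"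
begin

text \<open>Truncation at \<open>n\<close> is effective for fewer than \<open>m\<close> knots:
  \<open>nodes 0\<close> then consists of all of them and the interpolant is a single
  polynomial.\<close>

definition nodes :: "nat \<Rightarrow> real set" where "nodes i = t ` {i..<min (i + m) n}"

definition jump :: "(real \<Rightarrow> real) \<Rightarrow> nat \<Rightarrow> real poly" where
  "jump f i = lagrange (nodes (Suc i)) f - lagrange (nodes i) f"

definition width :: "nat \<Rightarrow> real" where "width i = t (Suc (gap i)) - t (gap i)"

definition step :: "nat \<Rightarrow> nat \<Rightarrow> real \<Rightarrow> real" where
  "step i k x = \<sigma> k ((x - t (gap i)) / width i) / width i ^ k"

text \<open>The derivative of order \<open>k\<close> of the interpolant, written out by the Leibniz rule. For \<open>n \<le> m\<close> the sum is empty.\<close>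
definition ext :: "(real \<Rightarrow> real) \<Rightarrow> nat \<Rightarrow> real \<Rightarrow> real" where
  "ext f k x = poly ((pderiv ^^ k) (lagrange (nodes 0) f)) x +
     (\<Sum>i<n - m. \<Sum>r\<le>k. real (k choose r) * (poly ((pderiv ^^ r) (jump f i)) x * step i (k - r) x))"

lemma t_le: "i \<le> j \<Longrightarrow> j < n \<Longrightarrow> t i \<le> t j"
  using t_less[of i j] by (cases "i = j") auto

lemma t_inj: "inj_on t {..<n}"
  by (rule inj_onI) (metis lessThan_iff linorder_neqE_nat order_less_irrefl t_less)

lemma width_pos: "i + m < n \<Longrightarrow> width i > 0"
  unfolding width_def using t_less[of "gap i" "Suc (gap i)"] gap(2)[of i] by simp

lemma finite_nodes [simp]: "finite (nodes i)"
  by (simp add: nodes_def)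

lemma card_nodes: "card (nodes i) = min (i + m) n - i"
proof -
  have "inj_on t {i..<min (i + m) n}" by (rule inj_on_subset[OF t_inj]) auto
  then show ?thesis by (simp add: nodes_def card_image)
qed

lemma deriv_chain_ext: "deriv_chain m (ext f)"
  unfolding ext_def[abs_def]
proof (intro deriv_chain_add deriv_chain_sum deriv_chain_poly deriv_chain_mult)
  fix i assume "i \<in> {..<n - m}"
  then have "i + m < n" by auto
  then show "deriv_chain m (step i)"
    unfolding step_def[abs_def] using width_pos by (intro deriv_chain_affine \<sigma>(1)) force
qed

text \<open>At the knot \<open>t k\<close> the step number \<open>i\<close> has the value 0 if
  \<open>k \<le> i\<close> and 1 if \<open>i + m \<le> k\<close>; in between the jump vanishes. The
  sum telescopes to the polynomial with first node index \<open>k + 1 - m\<close>, and for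
  \<open>k + 1 < m\<close> the truncated difference correctly gives the initial polynomial.\<close>

lemma ext_interpolates:
  assumes "k < n"
  shows "ext f 0 (t k) = f (t k)"
proof -
  have trm: "poly (jump f i) (t k) * \<sigma> 0 ((t k - t (gap i)) / width i) = (if i + m \<le> k then poly (jump f i) (t k) else 0)"
    if "i + m < n" for i
  proof -
    note g = gap(1,2)[OF that] and w = width_pos[OF that]
    consider "k \<le> i" | "i < k" "k < i + m" | "i + m \<le> k" by linarith
    then show ?thesis
    proof cases
      case 1
      then have "t k \<le> t (gap i)" using g that by (intro t_le) auto
      then have "(t k - t (gap i)) / width i \<le> 0" using w by (simp add: divide_nonpos_pos)
      then show ?thesis using 1 \<sigma>(2) m by simp
    next
      case 2
      then have "t k \<in> nodes i" "t k \<in> nodes (Suc i)" using assms by (auto simp: nodes_def)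
      then have "poly (jump f i) (t k) = 0" by (simp add: jump_def poly_lag)
      then show ?thesis by simp
    next
      case 3
      then have "t (Suc (gap i)) \<le> t k" using g assms by (intro t_le) auto
      then have "(t k - t (gap i)) / width i \<ge> 1" using w by (simp add: width_def)
      then show ?thesis using 3 \<sigma>(3) by simp
    qed
  qed
  have "ext f 0 (t k) = poly (lagrange (nodes 0) f) (t k) + (\<Sum>i<n - m. if i + m \<le> k then poly (jump f i) (t k) else 0)"
    unfolding ext_def step_def using trm by (auto intro!: sum.cong)
  also have "(\<Sum>i<n - m. if i + m \<le> k then poly (jump f i) (t k) else 0) = (\<Sum>i<k + 1 - m. poly (jump f i) (t k))"
    using assms by (intro sum.mono_neutral_cong_right) auto
  also have "\<dots> = poly (lagrange (nodes (k + 1 - m)) f) (t k) - poly (lagrange (nodes 0) f) (t k)"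
    using sum_lessThan_telescope[of "\<lambda>i. poly (lagrange (nodes i) f) (t k)" "k + 1 - m"] by (simp add: jump_def)
  also have "poly (lagrange (nodes (k + 1 - m)) f) (t k) = f (t k)"
  proof (rule poly_lag[OF finite_nodes])
    show "t k \<in> nodes (k + 1 - m)" unfolding nodes_def by (rule imageI) (use assms m in auto)
  qed
  finally show ?thesis by simp
qed

lemma ext_add:
  assumes "\<And>i. i < n \<Longrightarrow> h (t i) = f (t i) + g (t i)"
  shows "ext h k x = ext f k x + ext g k x"
proof -
  have "lagrange (nodes i) h = lagrange (nodes i) f + lagrange (nodes i) g" for i
    by (rule lagrange_add) (use assms in \<open>auto simp: nodes_def\<close>)
  moreover from this have "jump h i = jump f i + jump g i" for i by (simp add: jump_def)
  ultimately show ?thesis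
    by (simp add: ext_def higher_pderiv_add sum.distrib algebra_simps)
qed

lemma ext_cmult:
  assumes "\<And>i. i < n \<Longrightarrow> h (t i) = c * f (t i)"
  shows "ext h k x = c * ext f k x"
proof -
  have "lagrange (nodes i) h = smult c (lagrange (nodes i) f)" for i
    by (rule lagrange_cmult) (use assms in \<open>auto simp: nodes_def\<close>)
  moreover from this have "jump h i = smult c (jump f i)" for i by (simp add: jump_def smult_diff_right)
  ultimately show ?thesis
    by (simp add: ext_def higher_pderiv_smult sum_distrib_left algebra_simps)
qed

abbreviation K :: real where "K \<equiv> jump_const m B"

lemma B_nonneg: "B \<ge> 0" using \<sigma>(5)[of 0 0] by linarith

lemma K_nonneg: "K \<ge> 0"
  unfolding jump_const_def using B_nonneg by (intro sum_nonneg) auto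

lemma window_pos: "i + m < n \<Longrightarrow> t (i + m) - t i > 0"
  using t_less[of i "i + m"] m by simp

text \<open>The \<open>m - 1\<close> common nodes are zeros of a polynomial of degree at most
  \<open>m - 1\<close>, so only its leading coefficient is left to estimate.\<close>

lemma jump_eq:
  assumes i: "i + m < n"
  shows "jump f i = smult (coeff (jump f i) (m - 1)) (\<Prod>u\<in>t ` {Suc i..<i + m}. [:- u, 1:])"
proof -
  have "inj_on t {Suc i..<i + m}" by (rule inj_on_subset[OF t_inj]) (use i in auto)
  then have c: "card (t ` {Suc i..<i + m}) = m - 1" by (simp add: card_image)
  have "degree (jump f i) \<le> m - 1"
    unfolding jump_def
    using degree_lag[OF finite_nodes, of "Suc i" f] degree_lag[OF finite_nodes, of i f] card_nodes i
    by (intro degree_diff_le) auto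
  moreover have "poly (jump f i) x = 0" if "x \<in> t ` {Suc i..<i + m}" for x
  proof -
    have "x \<in> nodes i" "x \<in> nodes (Suc i)" using that i by (auto simp: nodes_def)
    then show ?thesis by (simp add: jump_def poly_lag)
  qed
  ultimately show ?thesis using poly_eq_smult_prod[of "t ` {Suc i..<i + m}" "jump f i"] c by simp
qed

lemma jump_coeff_bound:
  assumes i: "i + m < n" and D: "deriv_chain (m - 1) D" "incr_bounded (D (m - 1)) h"
    and h: "\<And>a b. h integrable_on {a..b}" "\<And>x. h x \<ge> 0"
    and f: "\<And>i. i < n \<Longrightarrow> f (t i) = D 0 (t i)"
  shows "\<bar>coeff (jump f i) (m - 1)\<bar> \<le> integral {t i..t (i + m)} h"
proof -
  have sub: "nodes i \<subseteq> {t i..t (i + m)}" "nodes (Suc i) \<subseteq> {t i..t (i + m)}"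
    using i by (auto simp: nodes_def intro!: t_le)
  have card: "card (nodes i) = Suc (m - 1)" "card (nodes (Suc i)) = Suc (m - 1)"
    using i m by (auto simp: card_nodes)
  have fn: "f x = D 0 x" if "x \<in> nodes j" for x j using that f by (auto simp: nodes_def)
  obtain \<xi>1 where 1: "\<xi>1 \<in> {t i..t (i + m)}" "D (m - 1) \<xi>1 = fact (m - 1) * coeff (lagrange (nodes i) f) (m - 1)"
    using lagrange_leading_coeff[OF D(1) finite_nodes card(1) sub(1), of f] fn[of _ i] by blast
  obtain \<xi>2 where 2: "\<xi>2 \<in> {t i..t (i + m)}" "D (m - 1) \<xi>2 = fact (m - 1) * coeff (lagrange (nodes (Suc i)) f) (m - 1)"
    using lagrange_leading_coeff[OF D(1) finite_nodes card(2) sub(2), of f] fn[of _ "Suc i"] by blast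
  have "fact (m - 1) * coeff (jump f i) (m - 1) = D (m - 1) \<xi>2 - D (m - 1) \<xi>1"
    using 1 2 by (simp add: jump_def algebra_simps)
  \<comment> \<open>Rolle's theorem controls \<open>fact (m - 1)\<close> times the coefficient; the
    factor is at least 1 and is given away.\<close>
  moreover have "\<bar>coeff (jump f i) (m - 1)\<bar> \<le> \<bar>fact (m - 1) * coeff (jump f i) (m - 1)\<bar>"
    using fact_ge_1[of "m - 1", where ?'a = real] by (simp add: abs_mult mult_le_cancel_right1)
  ultimately show ?thesis using incr_bounded_within[OF D(2) h 2(1) 1(1)] by simp
qed

text \<open>Let L be the window length and c the leading coefficient. The derivative of order r of
  the jump has the size of c times the power m - 1 - r of L, the derivative of order m - r of the
  step that of the power m - r of 1/L; the product has the size of c / L for every r. The term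
  \<open>r = m\<close> vanishes for reasons of degree, so only derivatives of the step of positive
  order remain, which are 0 outside the gap.\<close>

lemma ext_top_bound:
  "\<bar>ext f m x\<bar> \<le> (\<Sum>i<n - m. K * \<bar>coeff (jump f i) (m - 1)\<bar> / (t (i + m) - t i) * indicator {t (gap i)..t (Suc (gap i))} x)"
proof -
  have trm: "\<bar>\<Sum>r\<le>m. real (m choose r) * (poly ((pderiv ^^ r) (jump f i)) x * step i (m - r) x)\<bar>
    \<le> K * \<bar>coeff (jump f i) (m - 1)\<bar> / (t (i + m) - t i) * indicator {t (gap i)..t (Suc (gap i))} x"
    if i: "i + m < n" for i
  proof -
    let ?c = "coeff (jump f i) (m - 1)" and ?L = "t (i + m) - t i" and ?S = "t ` {Suc i..<i + m}"
    note L = window_pos[OF i] and w = width_pos[OF i]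
    have "inj_on t {Suc i..<i + m}" by (rule inj_on_subset[OF t_inj]) (use i in auto)
    then have cS: "card ?S = m - 1" by (simp add: card_image)
    have top0: "(pderiv ^^ m) (jump f i) = 0"
    proof (rule higher_pderiv_eq_0)
      have "degree (jump f i) \<le> m - 1"
        using degree_prod_linear[of ?S] cS by (subst jump_eq[OF i]) (simp add: order_trans[OF degree_smult_le])
      then show "degree (jump f i) < m" using m by simp
    qed
    show ?thesis
    proof (cases "x \<in> {t (gap i)..t (Suc (gap i))}")
      case False
      then have "(x - t (gap i)) / width i \<le> 0 \<or> (x - t (gap i)) / width i \<ge> 1"
        using w by (auto simp: width_def divide_nonpos_pos)
      then have "step i (m - r) x = 0" if "r < m" for r
        using \<sigma>(4)[of "m - r"] that by (simp add: step_def)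
      then have "(\<Sum>r\<le>m. real (m choose r) * (poly ((pderiv ^^ r) (jump f i)) x * step i (m - r) x)) = 0"
        using top0 by (intro sum.neutral) (auto simp: le_less)
      then show ?thesis using False by simp
    next
      case True
      have xin: "t i \<le> x" "x \<le> t (i + m)"
        using True t_le[of i "gap i"] t_le[of "Suc (gap i)" "i + m"] gap(1,2)[OF i] i by auto
      have dist: "\<bar>x - u\<bar> \<le> ?L" if "u \<in> ?S" for u
      proof -
        have "t i \<le> u" "u \<le> t (i + m)" using that i by (auto intro!: t_le)
        then show ?thesis using xin by linarith
      qed
      have one: "\<bar>real (m choose r) * (poly ((pderiv ^^ r) (jump f i)) x * step i (m - r) x)\<bar>
        \<le> real (m choose r) * (fact r * 2 ^ m * B * real m ^ m) * (\<bar>?c\<bar> / ?L)" if r: "r \<le> m" for r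
      proof (cases "r = m")
        case True
        then show ?thesis using top0 B_nonneg L by simp
      next
        case False
        then have rm: "r < m" using r by simp
        have "\<bar>poly ((pderiv ^^ r) (jump f i)) x\<bar> = \<bar>?c\<bar> * \<bar>poly ((pderiv ^^ r) (\<Prod>u\<in>?S. [:- u, 1:])) x\<bar>"
          by (subst jump_eq[OF i]) (simp add: higher_pderiv_smult abs_mult)
        also have "\<dots> \<le> \<bar>?c\<bar> * (fact r * 2 ^ (m - 1) * ?L ^ (m - 1) / ?L ^ r)"
          using poly_pderiv_prod_bound[of ?S x ?L r] dist L cS by (intro mult_left_mono) auto
        also have "\<dots> \<le> \<bar>?c\<bar> * (fact r * 2 ^ m * ?L ^ (m - 1) / ?L ^ r)"
          using L by (intro mult_left_mono divide_right_mono mult_right_mono power_increasing) auto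
        finally have p1: "\<bar>poly ((pderiv ^^ r) (jump f i)) x\<bar> \<le> \<bar>?c\<bar> * (fact r * 2 ^ m * ?L ^ (m - 1) / ?L ^ r)" .
        have p2: "\<bar>step i (m - r) x\<bar> \<le> B * (real m ^ m / ?L ^ (m - r))"
        proof -
          have "\<bar>step i (m - r) x\<bar> = \<bar>\<sigma> (m - r) ((x - t (gap i)) / width i)\<bar> * (1 / width i ^ (m - r))"
            using w by (simp add: step_def abs_mult)
          also have "\<dots> \<le> B * (real m ^ m / ?L ^ (m - r))"
          proof (rule mult_mono)
            have "?L ^ (m - r) \<le> (m * width i) ^ (m - r)"
              using gap(3)[OF i] L by (intro power_mono) (auto simp: width_def)
            also have "\<dots> = real m ^ (m - r) * width i ^ (m - r)" by (rule power_mult_distrib)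
            also have "\<dots> \<le> real m ^ m * width i ^ (m - r)"
              using m w by (intro mult_right_mono power_increasing) auto
            finally show "1 / width i ^ (m - r) \<le> real m ^ m / ?L ^ (m - r)"
              using L w by (simp add: field_simps)
          qed (use \<sigma>(5) B_nonneg w in auto)
          finally show ?thesis .
        qed
        have "\<bar>poly ((pderiv ^^ r) (jump f i)) x * step i (m - r) x\<bar>
          \<le> \<bar>?c\<bar> * (fact r * 2 ^ m * ?L ^ (m - 1) / ?L ^ r) * (B * (real m ^ m / ?L ^ (m - r)))"
          unfolding abs_mult using p1 p2 L by (intro mult_mono) auto
        also have "\<dots> = fact r * 2 ^ m * B * real m ^ m * \<bar>?c\<bar> * (?L ^ (m - 1) / (?L ^ r * ?L ^ (m - r)))"
          by simp
        also have "?L ^ r * ?L ^ (m - r) = ?L ^ (m - 1) * ?L"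
          using rm m by (simp add: power_add[symmetric] power_Suc2[symmetric] del: power_Suc)
        also have "?L ^ (m - 1) / (?L ^ (m - 1) * ?L) = 1 / ?L" using L by simp
        finally have "\<bar>poly ((pderiv ^^ r) (jump f i)) x * step i (m - r) x\<bar>
          \<le> fact r * 2 ^ m * B * real m ^ m * (\<bar>?c\<bar> / ?L)" by simp
        then show ?thesis
          unfolding abs_mult[of "real (m choose r)"] mult.assoc[of "real (m choose r)"] abs_of_nat
          by (intro mult_left_mono) auto
      qed
      have "\<bar>\<Sum>r\<le>m. real (m choose r) * (poly ((pderiv ^^ r) (jump f i)) x * step i (m - r) x)\<bar>
        \<le> (\<Sum>r\<le>m. real (m choose r) * (fact r * 2 ^ m * B * real m ^ m) * (\<bar>?c\<bar> / ?L))"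
        by (rule order_trans[OF sum_abs sum_mono]) (use one in auto)
      also have "\<dots> = K * (\<bar>?c\<bar> / ?L)" unfolding jump_const_def by (rule sum_distrib_right[symmetric])
      finally show ?thesis using True by simp
    qed
  qed
  have P0: "(pderiv ^^ m) (lagrange (nodes 0) f) = 0"
    using degree_lag[OF finite_nodes, of 0 f] card_nodes[of 0] m by (intro higher_pderiv_eq_0) auto
  have "\<bar>ext f m x\<bar> \<le> (\<Sum>i<n - m. \<bar>\<Sum>r\<le>m. real (m choose r) * (poly ((pderiv ^^ r) (jump f i)) x * step i (m - r) x)\<bar>)"
    unfolding ext_def P0 by simp
  also have "\<dots> \<le> (\<Sum>i<n - m. K * \<bar>coeff (jump f i) (m - 1)\<bar> / (t (i + m) - t i) * indicator {t (gap i)..t (Suc (gap i))} x)"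
    by (rule sum_mono) (use trm in auto)
  finally show ?thesis .
qed

text \<open>Windows whose indices differ by more than \<open>m\<close> are disjoint, so all indices
  in question lie within \<open>m\<close> of the least one.\<close>

lemma overlap:
  "card {i. i < n - m \<and> x \<in> {t i..t (i + m)}} \<le> m + 1"
proof (cases "{i. i < n - m \<and> x \<in> {t i..t (i + m)}} = {}")
  case False
  let ?J = "{i. i < n - m \<and> x \<in> {t i..t (i + m)}}"
  define i0 where "i0 = (LEAST i. i \<in> ?J)"
  have i0: "i0 \<in> ?J" unfolding i0_def using False by (metis (mono_tags, lifting) LeastI_ex all_not_in_conv)
  have "?J \<subseteq> {i0..i0 + m}"
  proof
    fix i assume i: "i \<in> ?J"
    have "i0 \<le> i" unfolding i0_def by (rule Least_le[of "\<lambda>i. i \<in> ?J", OF i])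
    moreover have "i \<le> i0 + m"
    proof (rule ccontr)
      assume "\<not> i \<le> i0 + m"
      then have "t (i0 + m) < t i" using i by (intro t_less) auto
      then show False using i i0 by auto
    qed
    ultimately show "i \<in> {i0..i0 + m}" by simp
  qed
  then have "card ?J \<le> card {i0..i0 + m}" by (intro card_mono) auto
  then show ?thesis by simp
next
  case True
  show ?thesis unfolding True by simp
qed

end

lemma sum_integral_overlap:
  fixes u :: "real \<Rightarrow> real"
  assumes "finite I" and u: "integrable lebesgue u" "\<And>x. u x \<ge> 0"
    and N: "\<And>x. card {i\<in>I. x \<in> {a i..b i}} \<le> N"
  shows "(\<Sum>i\<in>I. integral {a i..b i} u) \<le> real N * (LINT x|lebesgue. u x)"
proof -
  have si: "set_integrable lebesgue {a i..b i} u" for i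
    using u(1) unfolding set_integrable_def by (intro integrable_mult_indicator) auto
  have "(\<Sum>i\<in>I. integral {a i..b i} u) = (\<Sum>i\<in>I. LINT x|lebesgue. indicator {a i..b i} x * u x)"
    using set_lebesgue_integral_eq_integral(2)[OF si] by (simp add: set_lebesgue_integral_def)
  also have "\<dots> = (LINT x|lebesgue. (\<Sum>i\<in>I. indicator {a i..b i} x * u x))"
    using si by (intro Bochner_Integration.integral_sum[symmetric]) (simp add: set_integrable_def)
  also have "\<dots> \<le> (LINT x|lebesgue. real N * u x)"
  proof (rule integral_mono)
    show "integrable lebesgue (\<lambda>x. \<Sum>i\<in>I. indicator {a i..b i} x * u x)"
      using si by (intro Bochner_Integration.integrable_sum) (simp add: set_integrable_def)
    show "integrable lebesgue (\<lambda>x. real N * u x)" using u(1) by simp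
    fix x :: real
    have "(\<Sum>i\<in>I. indicator {a i..b i} x * u x) = (\<Sum>i\<in>{i\<in>I. x \<in> {a i..b i}}. u x)"
      using assms(1) by (intro sum.mono_neutral_cong_right) auto
    also have "\<dots> = real (card {i\<in>I. x \<in> {a i..b i}}) * u x" by simp
    also have "\<dots> \<le> real N * u x" using N[of x] u(2) by (intro mult_right_mono) auto
    finally show "(\<Sum>i\<in>I. indicator {a i..b i} x * u x) \<le> real N * u x" .
  qed
  finally show ?thesis by simp
qed

context knots
begin

text \<open>The number \<open>m + 1\<close> enters twice: at most so many of the chosen gaps contain
  a given point, as several windows may share a gap, and at most so many windows do. Both factors
  are raised to the power \<open>p\<close>, whence \<open>(real m + 1)\<^sup>2 * K\<close>.\<close>

lemma ext_riesz_bounded: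
  assumes D: "deriv_chain (m - 1) D" "incr_bounded (D (m - 1)) h" and h: "h \<in> Lp_space p" "\<And>x. h x \<ge> 0" and p: "p > 1"
    and f: "\<And>i. i < n \<Longrightarrow> f (t i) = D 0 (t i)"
  shows "riesz_bounded p (((real m + 1)\<^sup>2 * K) powr p * (LINT x|lebesgue. h x powr p)) (ext f (m - 1))"
proof -
  let ?c = "\<lambda>i. \<bar>coeff (jump f i) (m - 1)\<bar>" and ?L = "\<lambda>i. t (i + m) - t i"
  let ?G = "\<lambda>i. {t (gap i)..t (Suc (gap i))}"
  define w where "w i = K * ?c i / ?L i" for i
  define g where "g x = (\<Sum>i<n - m. w i * indicator (?G i) x)" for x
  have hp: "integrable lebesgue (\<lambda>x. h x powr p)" using h by (simp add: Lp_space_def)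
  have hi: "h integrable_on {a..b}" for a b using Lp_integrable_on[OF h(1) p] by blast
  have w0: "w i \<ge> 0" if "i < n - m" for i
  proof -
    have "i + m < n" using that by linarith
    then show ?thesis using window_pos[of i] K_nonneg by (simp add: w_def)
  qed
  have g0: "g x \<ge> 0" for x unfolding g_def using w0 by (intro sum_nonneg) auto
  have gm [measurable]: "g \<in> borel_measurable lebesgue"
    unfolding g_def by (intro borel_measurable_sum borel_measurable_times borel_measurable_indicator) auto
  define U where "U x = (real m + 1) powr p * (\<Sum>i<n - m. w i powr p * indicator (?G i) x)" for x
  have g_le: "g x powr p \<le> U x" for x
  proof -
    let ?J = "{i. i < n - m \<and> x \<in> ?G i}"
    have sub: "?J \<subseteq> {i. i < n - m \<and> x \<in> {t i..t (i + m)}}"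
    proof safe
      fix i assume i: "i < n - m" "x \<in> ?G i"
      then have i': "i + m < n" by simp
      have "t i \<le> t (gap i)" "t (Suc (gap i)) \<le> t (i + m)"
        using gap(1,2)[OF i'] i' by (auto intro!: t_le)
      then show "x \<in> {t i..t (i + m)}" using i by auto
    qed
    have "card ?J \<le> card {i. i < n - m \<and> x \<in> {t i..t (i + m)}}" by (rule card_mono[OF _ sub]) simp
    also have "\<dots> \<le> m + 1" by (rule overlap)
    finally have card: "card ?J \<le> m + 1" .
    have "g x = (\<Sum>i\<in>?J. w i)"
      unfolding g_def by (rule sum.mono_neutral_cong_right) auto
    then have "g x powr p \<le> real (m + 1) powr p * (\<Sum>i\<in>?J. w i powr p)"
      using powr_sum_le[OF _ card, of w p] w0 p by simp
    also have "(\<Sum>i\<in>?J. w i powr p) = (\<Sum>i<n - m. w i powr p * indicator (?G i) x)"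
      by (rule sum.mono_neutral_cong_left) auto
    finally show ?thesis by (simp add: U_def add.commute)
  qed
  have Gi: "integrable lebesgue (\<lambda>x. indicat_real (?G i) x)" for i
    by (rule integrable_real_indicator) (auto simp: emeasure_lborel_Icc_eq)
  have Ui: "integrable lebesgue U"
    unfolding U_def
    by (intro Bochner_Integration.integrable_mult_right Bochner_Integration.integrable_sum Gi)
  have gp: "integrable lebesgue (\<lambda>x. g x powr p)"
  proof (rule Bochner_Integration.integrable_bound[OF Ui])
    show "AE x in lebesgue. norm (g x powr p) \<le> norm (U x)"
      by (rule AE_I2) (use g_le in \<open>simp add: abs_of_nonneg order_trans[OF _ abs_ge_self]\<close>)
  qed measurable
  have gL: "g \<in> Lp_space p" using gp g0 gm by (simp add: Lp_space_def)
  have "incr_bounded (ext f (m - 1)) g"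
    unfolding incr_bounded_def
  proof (intro allI impI)
    fix x y :: real assume xy: "x \<le> y"
    have m1: "m = Suc (m - 1)" using m by simp
    have "(ext f (m - 1) has_real_derivative ext f m z) (at z)" for z
      using deriv_chain_ext[of f] m unfolding deriv_chain_def by (metis m1 lessI)
    then have "(ext f (m - 1) has_vector_derivative ext f m z) (at z within {x..y})" for z
      by (simp add: has_real_derivative_iff_has_vector_derivative[symmetric] has_field_derivative_at_within)
    then have "(ext f m has_integral ext f (m - 1) y - ext f (m - 1) x) {x..y}"
      by (intro fundamental_theorem_of_calculus xy)
    then have "ext f m integrable_on {x..y}" "integral {x..y} (ext f m) = ext f (m - 1) y - ext f (m - 1) x"
      by (auto simp: integral_unique)
    moreover have "norm (integral {x..y} (ext f m)) \<le> integral {x..y} g"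
    proof (rule integral_norm_bound_integral)
      show "g integrable_on {x..y}" using Lp_integrable_on[OF gL p] by blast
      show "norm (ext f m z) \<le> g z" for z
        using ext_top_bound[of f z] by (simp add: g_def w_def)
    qed fact
    ultimately show "\<bar>ext f (m - 1) y - ext f (m - 1) x\<bar> \<le> integral {x..y} g" by simp
  qed
  from incr_bounded_riesz_bounded[OF this gL g0 p] have r: "riesz_bounded p (LINT x|lebesgue. g x powr p) (ext f (m - 1))" .
  \<comment> \<open>The height on a gap is \<open>K\<close> times the coefficient divided by the
    window length, and the gap is no longer than the window. This leaves the window length to the
    power \<open>1 - p\<close>, exactly what Jensen's inequality for the integral of
    \<open>h\<close> over the window cancels.\<close>
  have term_le: "w i powr p * (t (Suc (gap i)) - t (gap i)) \<le> K powr p * integral {t i..t (i + m)} (\<lambda>x. h x powr p)"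
    if "i < n - m" for i
  proof -
    have i: "i + m < n" using that by simp
    note L = window_pos[OF i]
    have "t (Suc (gap i)) - t (gap i) \<le> ?L i"
      using gap(1,2)[OF i] i t_le[of i "gap i"] t_le[of "Suc (gap i)" "i + m"] by auto
    then have "w i powr p * (t (Suc (gap i)) - t (gap i)) \<le> w i powr p * ?L i" by (rule mult_left_mono) simp
    also have "\<dots> = K powr p * (?c i powr p) / ?L i powr (p - 1)"
      using L K_nonneg by (simp add: w_def powr_mult powr_divide powr_diff)
    also have "\<dots> \<le> K powr p * (?L i powr (p - 1) * integral {t i..t (i + m)} (\<lambda>x. h x powr p)) / ?L i powr (p - 1)"
    proof (intro divide_right_mono mult_left_mono)
      have "?c i powr p \<le> (integral {t i..t (i + m)} h) powr p"
        using jump_coeff_bound[OF i D hi h(2) f] p by (intro powr_mono2) auto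
      also have "\<dots> \<le> ?L i powr (p - 1) * integral {t i..t (i + m)} (\<lambda>x. h x powr p)"
        using L by (intro Jensen_powr h p) auto
      finally show "?c i powr p \<le> ?L i powr (p - 1) * integral {t i..t (i + m)} (\<lambda>x. h x powr p)" .
    qed auto
    also have "\<dots> = K powr p * integral {t i..t (i + m)} (\<lambda>x. h x powr p)" using L by simp
    finally show ?thesis .
  qed
  have "(LINT x|lebesgue. g x powr p) \<le> (LINT x|lebesgue. U x)"
    by (rule integral_mono[OF gp Ui g_le])
  also have "\<dots> = (real m + 1) powr p * (\<Sum>i<n - m. w i powr p * (t (Suc (gap i)) - t (gap i)))"
  proof -
    have le: "t (gap i) \<le> t (Suc (gap i))" if "i < n - m" for i
    proof -
      have "i + m < n" using that by linarith
      then show ?thesis using gap(2)[of i] by (intro t_le) auto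
    qed
    have "(LINT x|lebesgue. U x) = (real m + 1) powr p * (\<Sum>i<n - m. LINT x|lebesgue. w i powr p * indicator (?G i) x)"
      unfolding U_def
      by (subst Bochner_Integration.integral_mult_right, intro Bochner_Integration.integrable_mult_right Bochner_Integration.integrable_sum Gi,
          subst Bochner_Integration.integral_sum, intro Bochner_Integration.integrable_mult_right Gi) simp
    also have "(\<Sum>i<n - m. LINT x|lebesgue. w i powr p * indicator (?G i) x)
      = (\<Sum>i<n - m. w i powr p * (t (Suc (gap i)) - t (gap i)))"
      using le by (intro sum.cong) (auto simp del: mult_eq_0_iff)
    finally show ?thesis .
  qed
  also have "\<dots> \<le> (real m + 1) powr p * (\<Sum>i<n - m. K powr p * integral {t i..t (i + m)} (\<lambda>x. h x powr p))"
    by (intro mult_left_mono sum_mono term_le) auto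
  also have "\<dots> = (real m + 1) powr p * K powr p * (\<Sum>i<n - m. integral {t i..t (i + m)} (\<lambda>x. h x powr p))"
    by (simp add: sum_distrib_left mult.assoc)
  also have "\<dots> \<le> (real m + 1) powr p * K powr p * (real (m + 1) * (LINT x|lebesgue. h x powr p))"
  proof (intro mult_left_mono sum_integral_overlap hp)
    show "card {i \<in> {..<n - m}. x \<in> {t i..t (i + m)}} \<le> m + 1" for x using overlap[of x] by simp
  qed auto
  also have "\<dots> \<le> (real m + 1) powr p * K powr p * ((real m + 1) powr p * (LINT x|lebesgue. h x powr p))"
  proof (intro mult_left_mono mult_right_mono)
    have "(real m + 1) powr 1 \<le> (real m + 1) powr p" using p by (intro powr_mono) auto
    then show "real (m + 1) \<le> (real m + 1) powr p" by (simp add: add.commute)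
  qed auto
  also have "\<dots> = ((real m + 1)\<^sup>2 * K) powr p * (LINT x|lebesgue. h x powr p)"
    using K_nonneg by (simp add: powr_mult power2_eq_square)
  finally have "(LINT x|lebesgue. g x powr p) \<le> ((real m + 1)\<^sup>2 * K) powr p * (LINT x|lebesgue. h x powr p)" .
  then show ?thesis using r unfolding riesz_bounded_def by (meson order_trans)
qed

end

text \<open>\<open>D\<close> lists the derivatives of order below \<open>m\<close> of an extension of \<open>f\<close>, and \<open>h\<close> dominates its derivative of order \<open>m\<close>.\<close>
definition trace_rep :: "nat \<Rightarrow> real set \<Rightarrow> (real \<Rightarrow> real) \<Rightarrow> real \<Rightarrow> (nat \<Rightarrow> real \<Rightarrow> real) \<Rightarrow> (real \<Rightarrow> real) \<Rightarrow> bool" where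
  "trace_rep m E f p D h \<longleftrightarrow> p > 1 \<and> deriv_chain (m - 1) D \<and> incr_bounded (D (m - 1)) h \<and> h \<in> Lp_space p \<and> (\<forall>x. h x \<ge> 0) \<and>
     (\<forall>x\<in>E. f x = D 0 x)"

lemma trace_rep_subset: "trace_rep m E f p D h \<Longrightarrow> A \<subseteq> E \<Longrightarrow> trace_rep m A f p D h"
  by (auto simp: trace_rep_def)

text \<open>Quantifying over \<open>p\<close> inside makes one operator serve all exponents. The
  linearity clauses require their hypotheses on \<open>A\<close> only, so they express at the same
  time that \<open>T f\<close> depends only on the values of \<open>f\<close> on
  \<open>A\<close>.\<close>

definition extends_well :: "nat \<Rightarrow> real \<Rightarrow> real set \<Rightarrow> ((real \<Rightarrow> real) \<Rightarrow> nat \<Rightarrow> real \<Rightarrow> real) \<Rightarrow> bool" where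
  "extends_well m C A T \<longleftrightarrow>
     (\<forall>f. deriv_chain m (T f)) \<and> (\<forall>f. \<forall>x\<in>A. T f 0 x = f x) \<and>
     (\<forall>f g h. (\<forall>x\<in>A. h x = f x + g x) \<longrightarrow> (\<forall>k x. T h k x = T f k x + T g k x)) \<and>
     (\<forall>c f h. (\<forall>x\<in>A. h x = c * f x) \<longrightarrow> (\<forall>k x. T h k x = c * T f k x)) \<and>
     (\<forall>f p D h. trace_rep m A f p D h \<longrightarrow> riesz_bounded p (C powr p * (LINT x|lebesgue. h x powr p)) (T f (m - 1)))"

lemma extends_wellD:
  assumes "extends_well m C A T"
  shows "deriv_chain m (T f)" "x \<in> A \<Longrightarrow> T f 0 x = f x"
    "\<forall>x\<in>A. h x = f x + g x \<Longrightarrow> T h k y = T f k y + T g k y"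
    "\<forall>x\<in>A. h x = c * f x \<Longrightarrow> T h k y = c * T f k y"
    "trace_rep m A f p D u \<Longrightarrow> riesz_bounded p (C powr p * (LINT x|lebesgue. u x powr p)) (T f (m - 1))"
  using assms unfolding extends_well_def by blast+

theorem finite_extension:
  assumes m: "m \<ge> 1"
  obtains C where "C > 0" "\<And>A. finite A \<Longrightarrow> \<exists>T. extends_well m C A T"
proof -
  \<comment> \<open>The step is fixed before the set \<open>A\<close>; this is why \<open>C\<close>
    depends on \<open>m\<close> alone.\<close>
  obtain \<sigma> B where \<sigma>: "deriv_chain m \<sigma>" "B \<ge> (1 :: real)"
    "\<And>x. x \<le> 0 \<Longrightarrow> \<sigma> 0 x = 0" "\<And>x. x \<ge> 1 \<Longrightarrow> \<sigma> 0 x = 1"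
    "\<And>k x. 1 \<le> k \<Longrightarrow> k \<le> m \<Longrightarrow> x \<le> 0 \<or> x \<ge> 1 \<Longrightarrow> \<sigma> k x = 0"
    "\<And>k x. k \<le> m \<Longrightarrow> \<bar>\<sigma> k x\<bar> \<le> B"
    using smoothstep_exists[of m] by blast
  define C where "C = (real m + 1)\<^sup>2 * jump_const m B"
  have "\<exists>T. extends_well m C A T" if A: "finite A" for A
  proof -
    define t where "t i = sorted_list_of_set A ! i" for i
    define n where "n = card A"
    have tA: "A = t ` {..<n}"
      using set_sorted_list_of_set[OF A] unfolding t_def n_def
      by (auto simp: set_conv_nth image_def)
    have t: "t i < t j" if "i < j" "j < n" for i j
      unfolding t_def using that sorted_wrt_nth_less[OF strict_sorted_list_of_set[of A]]
      by (auto simp: n_def)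
    have "\<exists>j. i \<le> j \<and> j < i + m \<and> t (i + m) - t i \<le> m * (t (Suc j) - t j)" if i: "i + m < n" for i
    proof (rule ccontr)
      assume "\<not> ?thesis"
      then have "\<not> t (i + m) - t i \<le> m * (t (Suc (i + k)) - t (i + k))" if "k < m" for k using that by auto
      then have "t (i + Suc k) - t (i + k) < (t (i + m) - t i) / m" if "k < m" for k
        using that m by (simp add: not_le less_divide_eq mult.commute)
      then have "(\<Sum>k<m. t (i + Suc k) - t (i + k)) < (\<Sum>k<m. (t (i + m) - t i) / m)"
        using m by (intro sum_strict_mono) (auto simp: lessThan_empty_iff)
      then show False using m sum_lessThan_telescope[of "\<lambda>k. t (i + k)" m] by simp
    qed
    then obtain gap where gap: "\<And>i. i + m < n \<Longrightarrow> i \<le> gap i \<and> gap i < i + m \<and> t (i + m) - t i \<le> m * (t (Suc (gap i)) - t (gap i))"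
      by metis
    interpret knots t n m \<sigma> B gap
      by unfold_locales (use t m \<sigma> gap in auto)
    have "extends_well m C A ext"
      unfolding extends_well_def
    proof (intro conjI allI impI ballI; (elim conjE)?)
      show "deriv_chain m (ext f)" for f by (rule deriv_chain_ext)
      show "ext f 0 x = f x" if "x \<in> A" for f x using that ext_interpolates unfolding tA by auto
      show "ext h k x = ext f k x + ext g k x" if "\<forall>x\<in>A. h x = f x + g x" for f g h k x
        by (rule ext_add) (use that tA in auto)
      show "ext h k x = c * ext f k x" if "\<forall>x\<in>A. h x = c * f x" for c f h k x
        by (rule ext_cmult) (use that tA in auto)
      show "riesz_bounded p (C powr p * (LINT x|lebesgue. h x powr p)) (ext f (m - 1))"
        if "trace_rep m A f p D h" for f p D h
        unfolding C_def using that tA by (intro ext_riesz_bounded) (auto simp: trace_rep_def)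
    qed
    then show ?thesis by blast
  qed
  moreover have "C > 0"
  proof -
    have "0 < real (m choose 0) * (fact 0 * 2 ^ m * B * real m ^ m)" using \<sigma>(2) m by simp
    also have "\<dots> \<le> jump_const m B" unfolding jump_const_def using \<sigma>(2) by (intro member_le_sum) auto
    finally show ?thesis by (simp add: C_def)
  qed
  ultimately show thesis using that by blast
qed

section \<open>Passage to the limit\<close>

text \<open>Zorn's lemma for the reversed order. What holds eventually for the infimum of a chain of
  filters already holds eventually for one of them; applied to the impossible event, this shows that
  the infimum of proper filters in a chain is proper.\<close>

lemma minimal_filter_exists:
  assumes "F \<noteq> (bot :: 'a filter)"
  obtains U where "U \<le> F" "U \<noteq> bot" "\<And>G. G \<noteq> bot \<Longrightarrow> G \<le> U \<Longrightarrow> G = U"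
proof -
  let ?A = "{G. G \<noteq> bot \<and> G \<le> F}" and ?P = "\<lambda>x y :: 'a filter. y \<le> x"
  have "\<exists>m\<in>?A. \<forall>a\<in>?A. ?P m a \<longrightarrow> a = m"
  proof (rule predicate_Zorn)
    show "partial_order_on ?A (relation_of ?P ?A)"
      by (rule partial_order_on_relation_ofI) auto
    fix C assume C: "C \<in> Chains (relation_of ?P ?A)"
    then have CA: "\<And>c. c \<in> C \<Longrightarrow> c \<in> ?A" and chain: "\<And>c d. c \<in> C \<Longrightarrow> d \<in> C \<Longrightarrow> c \<le> d \<or> d \<le> c"
      unfolding Chains_def relation_of_def by fast+
    show "\<exists>u\<in>?A. \<forall>a\<in>C. u \<le> a"
    proof (cases "C = {}")
      case True
      then show ?thesis using assms by auto
    next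
      case False
      have "Inf C \<noteq> bot"
      proof
        assume "Inf C = bot"
        then have "eventually (\<lambda>_. False) (Inf C)" by simp
        then have "\<exists>b\<in>C. eventually (\<lambda>_. False) b"
        proof (subst (asm) eventually_Inf_base)
          show "\<exists>x\<in>C. x \<le> inf a b" if "a \<in> C" "b \<in> C" for a b
            using chain[OF that] that by (auto simp: inf.absorb1 inf.absorb2)
        qed (use False in auto)
        then show False using CA by (auto simp: trivial_limit_def)
      qed
      moreover have "Inf C \<le> F"
        using False CA by (metis (mono_tags, lifting) Inf_lower2 all_not_in_conv mem_Collect_eq)
      ultimately show ?thesis by (intro bexI[of _ "Inf C"]) (auto intro: Inf_lower)
    qed
  qed
  then show thesis using that by auto
qed

text \<open>A minimal proper filter is an ultrafilter, so bounded functions converge along it.\<close>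
lemma ultralimit_exists:
  fixes \<phi> :: "'a \<Rightarrow> real"
  assumes "U \<noteq> bot" and min: "\<And>G. G \<noteq> bot \<Longrightarrow> G \<le> U \<Longrightarrow> G = U"
    and bd: "\<forall>\<^sub>F x in U. \<bar>\<phi> x\<bar> \<le> B"
  shows "\<exists>l. (\<phi> \<longlongrightarrow> l) U"
proof -
  have "filtermap \<phi> U \<noteq> bot" using assms(1) by (simp add: filtermap_bot_iff)
  moreover have "\<forall>\<^sub>F x in filtermap \<phi> U. x \<in> {- B..B}"
    using bd by (auto simp: eventually_filtermap abs_le_iff elim!: eventually_mono)
  ultimately obtain l where l: "inf (nhds l) (filtermap \<phi> U) \<noteq> bot"
    using compact_Icc[of "- B" B] unfolding compact_filter by blast
  have "(\<phi> \<longlongrightarrow> l) U"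
  proof (rule topological_tendstoI)
    fix S assume S: "open S" "l \<in> S"
    let ?G = "inf U (principal {x. \<phi> x \<in> S})"
    \<comment> \<open>If the restriction of \<open>U\<close> were improper, \<open>\<phi>\<close>
      would eventually avoid the neighbourhood \<open>S\<close> of its cluster point
      \<open>l\<close>. Minimality then identifies the restriction with \<open>U\<close>.\<close>
    have "?G \<noteq> bot"
    proof
      assume "?G = bot"
      then have "\<forall>\<^sub>F x in U. \<phi> x \<notin> S" by (simp add: trivial_limit_def eventually_inf_principal)
      then have "\<forall>\<^sub>F x in filtermap \<phi> U. x \<notin> S" by (simp add: eventually_filtermap)
      moreover have "\<forall>\<^sub>F x in nhds l. x \<in> S" using S by (auto simp: eventually_nhds)
      ultimately have "\<forall>\<^sub>F x in inf (nhds l) (filtermap \<phi> U). False"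
        unfolding eventually_inf by blast
      then show False using l by (simp add: trivial_limit_def)
    qed
    then have "?G = U" by (rule min) simp
    then have "U \<le> principal {x. \<phi> x \<in> S}" by (metis inf.cobounded2)
    then show "\<forall>\<^sub>F x in U. \<phi> x \<in> S" by (simp add: le_principal)
  qed
  then show ?thesis by blast
qed

section \<open>Bounds and differentiability that survive pointwise limits\<close>

text \<open>By Rolle's theorem every \<open>H k\<close> has a zero in the interval. For
  \<open>k = n\<close> the oscillation \<open>Q\<close> therefore bounds the values, and each step
  down in the order integrates from such a zero and costs a factor \<open>b - a\<close>.\<close>

lemma deriv_chain_zeros_bound:
  assumes H: "deriv_chain n H" and S: "finite S" "card S > n" "S \<subseteq> {a..b}" "\<And>x. x \<in> S \<Longrightarrow> H 0 x = 0"
    and Q: "\<And>x y. x \<in> {a..b} \<Longrightarrow> y \<in> {a..b} \<Longrightarrow> \<bar>H n x - H n y\<bar> \<le> Q"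
    and "k \<le> n" "x \<in> {a..b}"
  shows "\<bar>H k x\<bar> \<le> Q * (b - a) ^ (n - k)"
  using assms(7,8)
proof (induction "n - k" arbitrary: k x)
  case 0
  then have "k = n" by simp
  obtain \<xi> where "\<xi> \<in> {a..b}" "H n \<xi> = 0" using generalized_Rolle[OF H order_refl S(1,2) S(4,3)] by blast
  then show ?case using Q[OF 0(3), of \<xi>] \<open>k = n\<close> by simp
next
  case (Suc j)
  have kn: "k < n" using Suc by simp
  obtain \<xi> where \<xi>: "\<xi> \<in> {a..b}" "H k \<xi> = 0"
    using generalized_Rolle[OF H Suc.prems(1) S(1) _ S(4,3)] S(2) Suc.prems(1) by force
  have der: "\<And>z. (H k has_real_derivative H (Suc k) z) (at z)" using H kn by (simp add: deriv_chain_def)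
  have IH: "\<bar>H (Suc k) z\<bar> \<le> Q * (b - a) ^ j" if "z \<in> {a..b}" for z
  proof -
    have j: "j = n - Suc k" using Suc(2) kn by linarith
    show ?thesis using Suc(1)[OF j _ that] j kn by simp
  qed
  have Q0: "Q * (b - a) ^ j \<ge> 0" using IH[OF \<xi>(1)] by linarith
  have "\<bar>H k x\<bar> \<le> Q * (b - a) ^ j * \<bar>x - \<xi>\<bar>"
  proof -
    have "norm (H k x - H k \<xi>) \<le> Q * (b - a) ^ j * norm (x - \<xi>)"
    proof (rule field_differentiable_bound[of "{a..b}"])
      show "(H k has_field_derivative H (Suc k) z) (at z within {a..b})" if "z \<in> {a..b}" for z
        using der has_field_derivative_at_within by blast
    qed (use IH \<xi> Suc.prems in auto)
    then show ?thesis using \<xi>(2) by simp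
  qed
  also have "\<dots> \<le> Q * (b - a) ^ j * (b - a)"
    using Q0 \<xi>(1) Suc.prems(2) by (intro mult_left_mono) auto
  also have "\<dots> = Q * (b - a) ^ (n - k)" using Suc(2) by (metis mult.assoc power_Suc2)
  finally show ?case .
qed

text \<open>The Riesz bound for a division with a single interval. It provides equicontinuity,
  uniform in the finite set, for the derivative of order \<open>m - 1\<close>.\<close>

lemma riesz_bounded_Hoelder:
  assumes "riesz_bounded p M G" "p > 1"
  shows "\<bar>G y - G x\<bar> \<le> M powr (1 / p) * \<bar>y - x\<bar> powr (1 - 1 / p)"
proof -
  have *: "\<bar>G y - G x\<bar> \<le> M powr (1 / p) * (y - x) powr (1 - 1 / p)" if "x < y" for x y
  proof -
    have "{{x..y}} division_of \<Union>{{x..y}}" using that division_of_self[of x y] by (simp add: cbox_interval)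
    then have "(\<Sum>K\<in>{{x..y}}. \<bar>G (Sup K) - G (Inf K)\<bar> powr p / (Sup K - Inf K) powr (p - 1)) \<le> M"
      using assms(1) unfolding riesz_bounded_def by blast
    then have "\<bar>G y - G x\<bar> powr p / (y - x) powr (p - 1) \<le> M" using that by simp
    then have le: "\<bar>G y - G x\<bar> powr p \<le> M * (y - x) powr (p - 1)" using that by (simp add: divide_le_eq)
    have M: "M \<ge> 0" using assms(1)[unfolded riesz_bounded_def, rule_format, of "{}"] by simp
    have "\<bar>G y - G x\<bar> = (\<bar>G y - G x\<bar> powr p) powr (1 / p)" using assms(2) by (simp add: powr_powr)
    also have "\<dots> \<le> (M * (y - x) powr (p - 1)) powr (1 / p)" using le assms(2) by (intro powr_mono2) auto
    also have "\<dots> = M powr (1 / p) * (y - x) powr (1 - 1 / p)"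
      using M assms(2) that by (simp add: powr_mult powr_powr diff_divide_distrib)
    finally show ?thesis .
  qed
  show ?thesis
    using *[of x y] *[of y x] by (cases x y rule: linorder_cases) (auto simp: abs_minus_commute)
qed

text \<open>Differentiability with a quantitative remainder is a family of closed conditions on
  finitely many values, so it can be verified for a pointwise limit.\<close>

lemma DERIV_power_remainder:
  fixes f :: "real \<Rightarrow> real"
  assumes "\<theta> > 0" and le: "\<And>y. \<bar>y - x\<bar> \<le> 1 \<Longrightarrow> \<bar>f y - f x - (y - x) * L\<bar> \<le> \<bar>y - x\<bar> * (c * \<bar>y - x\<bar> powr \<theta>)"
  shows "(f has_real_derivative L) (at x)"
proof -
  have "((\<lambda>y. c * \<bar>y - x\<bar> powr \<theta>) \<longlongrightarrow> c * \<bar>x - x\<bar> powr \<theta>) (at x)"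
    using assms(1) by (intro tendsto_intros tendsto_powr') auto
  then have lim: "((\<lambda>y. c * \<bar>y - x\<bar> powr \<theta>) \<longlongrightarrow> 0) (at x)" using assms(1) by simp
  have "((\<lambda>y. (f y - f x) / (y - x) - L) \<longlongrightarrow> 0) (at x)"
  proof (rule Lim_null_comparison[OF _ lim])
    have "\<forall>\<^sub>F y in at x. y \<noteq> x \<and> \<bar>y - x\<bar> < 1"
      unfolding eventually_at by (intro exI[of _ 1]) (auto simp: dist_real_def)
    then show "\<forall>\<^sub>F y in at x. norm ((f y - f x) / (y - x) - L) \<le> c * \<bar>y - x\<bar> powr \<theta>"
    proof eventually_elim
      case (elim y)
      have "norm ((f y - f x) / (y - x) - L) = \<bar>f y - f x - (y - x) * L\<bar> / \<bar>y - x\<bar>"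
        using elim by (simp add: abs_divide[symmetric] diff_divide_distrib)
      also have "\<dots> \<le> c * \<bar>y - x\<bar> powr \<theta>"
        using le[of y] elim by (simp add: divide_le_eq mult.commute)
      finally show ?case .
    qed
  qed
  then show ?thesis unfolding has_field_derivative_iff by (simp add: LIM_zero_iff)
qed

section \<open>The limit of the finite operators\<close>

text \<open>Compared with \<open>extends_well\<close>, the chain ends at order \<open>m - 1\<close>:
  derivatives of order \<open>m\<close> have no pointwise limit and are represented by the Riesz
  bound. Additivity admits different exponents for \<open>f\<close> and \<open>g\<close> because the
  operator does not involve \<open>p\<close>.\<close>

definition hom_extends :: "nat \<Rightarrow> real \<Rightarrow> real set \<Rightarrow> ((real \<Rightarrow> real) \<Rightarrow> nat \<Rightarrow> real \<Rightarrow> real) \<Rightarrow> bool" where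
  "hom_extends m C E T \<longleftrightarrow>
     (\<forall>f p D h. trace_rep m E f p D h \<longrightarrow> deriv_chain (m - 1) (T f) \<and> (\<forall>x\<in>E. T f 0 x = f x) \<and>
        riesz_bounded p (C powr p * (LINT x|lebesgue. h x powr p)) (T f (m - 1))) \<and>
     (\<forall>f g h. (\<exists>p D u. trace_rep m E f p D u) \<longrightarrow> (\<exists>p D u. trace_rep m E g p D u) \<longrightarrow> (\<forall>x\<in>E. h x = f x + g x) \<longrightarrow>
        T h 0 = (\<lambda>x. T f 0 x + T g 0 x)) \<and>
     (\<forall>c f h. (\<exists>p D u. trace_rep m E f p D u) \<longrightarrow> (\<forall>x\<in>E. h x = c * f x) \<longrightarrow> T h 0 = (\<lambda>x. c * T f 0 x))"

text \<open>\<open>T f\<close> and \<open>D\<close> agree at the \<open>m\<close> points of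
  \<open>X\<close>, and the Hoelder bounds control the oscillation of their difference at order
  \<open>m - 1\<close>. The resulting bound does not involve \<open>A\<close>, which is what
  convergence along the filter requires.\<close>

lemma bounded_ext:
  assumes m: "m \<ge> 1" and T: "extends_well m C A T" and r: "trace_rep m E f p D h" and A: "A \<subseteq> E" "X \<subseteq> A"
    and X: "finite X" "card X = m" "X \<subseteq> {-R..R}" and k: "k \<le> m - 1" and x: "\<bar>x\<bar> \<le> R"
    and Dk: "\<And>k x. k \<le> m - 1 \<Longrightarrow> \<bar>x\<bar> \<le> R \<Longrightarrow> \<bar>D k x\<bar> \<le> B" and I: "I = (LINT x|lebesgue. h x powr p)" and R: "R \<ge> 1"
  shows "\<bar>T f k x\<bar> \<le> B + ((C powr p * I) powr (1 / p) + I powr (1 / p)) * (2 * R) powr (1 - 1 / p) * (2 * R) ^ m"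
proof -
  have p: "p > 1" using r by (simp add: trace_rep_def)
  have D: "deriv_chain (m - 1) D" using r by (simp add: trace_rep_def)
  have rT: "riesz_bounded p (C powr p * I) (T f (m - 1))"
    unfolding I by (rule extends_wellD(5)[OF T trace_rep_subset[OF r A(1)]])
  have rD: "riesz_bounded p I (D (m - 1))" unfolding I using r by (intro incr_bounded_riesz_bounded) (auto simp: trace_rep_def)
  define H where "H k x = T f k x - D k x" for k x
  let ?Q = "((C powr p * I) powr (1 / p) + I powr (1 / p)) * (2 * R) powr (1 - 1 / p)"
  have H: "deriv_chain (m - 1) H" unfolding H_def[abs_def]
    by (intro deriv_chain_diff D deriv_chain_mono[OF extends_wellD(1)[OF T]]) simp
  have Q: "\<bar>H (m - 1) u - H (m - 1) v\<bar> \<le> ?Q" if "u \<in> {-R..R}" "v \<in> {-R..R}" for u v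
  proof -
    have uv: "\<bar>u - v\<bar> powr (1 - 1 / p) \<le> (2 * R) powr (1 - 1 / p)"
      using that p by (intro powr_mono2) auto
    have "\<bar>H (m - 1) u - H (m - 1) v\<bar> \<le> \<bar>T f (m - 1) u - T f (m - 1) v\<bar> + \<bar>D (m - 1) u - D (m - 1) v\<bar>"
      unfolding H_def by linarith
    also have "\<dots> \<le> (C powr p * I) powr (1 / p) * \<bar>u - v\<bar> powr (1 - 1 / p) + I powr (1 / p) * \<bar>u - v\<bar> powr (1 - 1 / p)"
      by (intro add_mono riesz_bounded_Hoelder rT rD p)
    also have "\<dots> = ((C powr p * I) powr (1 / p) + I powr (1 / p)) * \<bar>u - v\<bar> powr (1 - 1 / p)" by (simp add: algebra_simps)
    also have "\<dots> \<le> ?Q" using uv by (intro mult_left_mono) auto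
    finally show ?thesis .
  qed
  have "\<bar>H k x\<bar> \<le> ?Q * (R - (- R)) ^ (m - 1 - k)"
  proof (rule deriv_chain_zeros_bound[OF H X(1) _ X(3) _ Q k])
    show "m - 1 < card X" using X m by simp
    show "H 0 x = 0" if "x \<in> X" for x
      using that A r extends_wellD(2)[OF T, of x f] unfolding H_def trace_rep_def by (metis diff_self subsetD)
  qed (use x in auto)
  also have "\<dots> \<le> ?Q * (2 * R) ^ m"
  proof (rule mult_left_mono)
    have "(2 * R) ^ (m - 1 - k) \<le> (2 * R) ^ m" by (rule power_increasing) (use R in auto)
    then show "(R - (- R)) ^ (m - 1 - k) \<le> (2 * R) ^ m" by simp
  qed (use R in auto)
  finally show ?thesis using Dk[OF k x] unfolding H_def by linarith
qed

lemma trace_rep_bounded: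
  assumes "trace_rep m E f p D h"
  obtains B where "B \<ge> 0" "\<And>k x. k \<le> m - 1 \<Longrightarrow> \<bar>x\<bar> \<le> R \<Longrightarrow> \<bar>D k x\<bar> \<le> B"
proof -
  have "\<exists>B. \<forall>x. \<bar>x\<bar> \<le> R \<longrightarrow> \<bar>D k x\<bar> \<le> B" if k: "k \<le> m - 1" for k
  proof -
    have "isCont (D k) x" for x
    proof (cases "k < m - 1")
      case True
      then show ?thesis using assms by (auto simp: trace_rep_def deriv_chain_def intro: DERIV_isCont)
    next
      case False
      then have "k = m - 1" using k by simp
      then show ?thesis using assms unfolding trace_rep_def
        by (auto intro: AC_isCont riesz_bounded_AC[where p = p] incr_bounded_riesz_bounded)
    qed
    then have "continuous_on {-R..R} (D k)" by (simp add: continuous_at_imp_continuous_on)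
    then have "bounded (D k ` {-R..R})" by (intro compact_imp_bounded compact_continuous_image) auto
    then obtain B where "\<forall>y\<in>D k ` {-R..R}. norm y \<le> B" unfolding bounded_iff by blast
    then show ?thesis by (intro exI[of _ B]) (auto simp: abs_le_iff)
  qed
  then obtain b where b: "\<And>k x. k \<le> m - 1 \<Longrightarrow> \<bar>x\<bar> \<le> R \<Longrightarrow> \<bar>D k x\<bar> \<le> b k" by metis
  have "\<bar>D k x\<bar> \<le> (\<Sum>k\<le>m - 1. \<bar>b k\<bar>)" if "k \<le> m - 1" "\<bar>x\<bar> \<le> R" for k x
  proof -
    have "\<bar>D k x\<bar> \<le> \<bar>b k\<bar>" using b[OF that] by linarith
    also have "\<dots> \<le> (\<Sum>k\<le>m - 1. \<bar>b k\<bar>)" using that by (intro member_le_sum) auto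
    finally show ?thesis .
  qed
  then show thesis by (intro that[of "\<Sum>k\<le>m - 1. \<bar>b k\<bar>"]) (auto intro: sum_nonneg)
qed

text \<open>An infinite \<open>E\<close> has \<open>m\<close> points \<open>X\<close> that
  eventually belong to all finite sets along the filter and pin the interpolants down. Each order of
  differentiation gets its own limit; that these limits are derivatives of each other follows from
  remainder estimates uniform in \<open>A\<close>.\<close>

lemma hom_extension_infinite:
  assumes m: "m \<ge> 1" and C: "\<And>A. finite A \<Longrightarrow> \<exists>T. extends_well m C A T" and E: "infinite E"
  shows "\<exists>T. hom_extends m C E T"
proof -
  obtain TT where TT: "\<And>A. finite A \<Longrightarrow> extends_well m C A (TT A)" using C by metis
  obtain U where U: "U \<le> finite_subsets_at_top E" "U \<noteq> bot" "\<And>G. G \<noteq> bot \<Longrightarrow> G \<le> U \<Longrightarrow> G = U"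
    using minimal_filter_exists[OF finite_subsets_at_top_neq_bot] by blast
  have ev: "\<forall>\<^sub>F A in U. finite A \<and> X \<subseteq> A \<and> A \<subseteq> E" if "finite X" "X \<subseteq> E" for X
  proof (rule filter_leD[OF U(1)])
    show "\<forall>\<^sub>F A in finite_subsets_at_top E. finite A \<and> X \<subseteq> A \<and> A \<subseteq> E"
      unfolding eventually_finite_subsets_at_top using that by blast
  qed
  obtain X where X: "finite X" "card X = m" "X \<subseteq> E" using infinite_arbitrarily_large[OF E] by blast
  obtain R0 where R0: "X \<subseteq> {-R0..R0}" "R0 \<ge> 0"
  proof -
    have "bounded X" using X(1) by (rule finite_imp_bounded)
    then obtain a where "a > 0" "\<forall>x\<in>X. norm x \<le> a" unfolding bounded_pos by blast
    then show thesis using that[of a] by (force simp: abs_le_iff)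
  qed
  have bd: "\<exists>B\<ge>0. \<forall>A k x. finite A \<and> X \<subseteq> A \<and> A \<subseteq> E \<and> k \<le> m - 1 \<and> \<bar>x\<bar> \<le> R \<longrightarrow> \<bar>TT A f k x\<bar> \<le> B"
    if r: "trace_rep m E f p D h" for f p D h R
  proof -
    \<comment> \<open>The interval has to contain \<open>X\<close> as well as the points of
      interest, and its radius must be at least 1 for powers to be monotone in the exponent.\<close>
    define R1 where "R1 = max R (R0 + 1)"
    define I where "I = (LINT x|lebesgue. h x powr p)"
    obtain B where B: "B \<ge> 0" "\<And>k x. k \<le> m - 1 \<Longrightarrow> \<bar>x\<bar> \<le> R1 \<Longrightarrow> \<bar>D k x\<bar> \<le> B"
      using trace_rep_bounded[OF r] by blast
    let ?B = "B + ((C powr p * I) powr (1 / p) + I powr (1 / p)) * (2 * R1) powr (1 - 1 / p) * (2 * R1) ^ m"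
    have "\<bar>TT A f k x\<bar> \<le> ?B" if "finite A" "X \<subseteq> A" "A \<subseteq> E" "k \<le> m - 1" "\<bar>x\<bar> \<le> R" for A k x
    proof (rule bounded_ext[OF m TT[OF that(1)] r that(3,2) X(1,2) _ that(4) _ B(2) I_def])
      show "X \<subseteq> {- R1..R1}" using R0 unfolding R1_def by (auto simp: subset_iff le_max_iff_disj)
    qed (use that R0 in \<open>auto simp: R1_def\<close>)
    moreover have "?B \<ge> 0" using B(1) R0 by (auto intro!: add_nonneg_nonneg mult_nonneg_nonneg simp: R1_def)
    ultimately show ?thesis by blast
  qed
  define T where "T f k x = Lim U (\<lambda>A. TT A f k x)" for f k x
  have lim: "((\<lambda>A. TT A f k x) \<longlongrightarrow> T f k x) U" if r: "trace_rep m E f p D h" and k: "k \<le> m - 1" for f p D h k x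
  proof -
    obtain B where B: "\<forall>A k y. finite A \<and> X \<subseteq> A \<and> A \<subseteq> E \<and> k \<le> m - 1 \<and> \<bar>y\<bar> \<le> \<bar>x\<bar> \<longrightarrow> \<bar>TT A f k y\<bar> \<le> B"
      using bd[OF r, of "\<bar>x\<bar>"] by blast
    have evB: "\<forall>\<^sub>F A in U. \<bar>TT A f k x\<bar> \<le> B"
      using ev[OF X(1,3)] by (rule eventually_mono) (use B k in blast)
    have "\<exists>l. ((\<lambda>A. TT A f k x) \<longlongrightarrow> l) U"
    proof (rule ultralimit_exists[OF U(2) _ evB])
      show "G = U" if "G \<noteq> bot" "G \<le> U" for G using that by (rule U(3))
    qed
    then obtain l where l: "((\<lambda>A. TT A f k x) \<longlongrightarrow> l) U" by blast
    then show ?thesis unfolding T_def tendsto_Lim[OF U(2) l] .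
  qed
  have rz: "\<forall>\<^sub>F A in U. riesz_bounded p (C powr p * (LINT x|lebesgue. h x powr p)) (TT A f (m - 1))"
    if r: "trace_rep m E f p D h" for f p D h
    using ev[OF X(1,3)]
  proof (rule eventually_mono)
    fix A assume A: "finite A \<and> X \<subseteq> A \<and> A \<subseteq> E"
    then show "riesz_bounded p (C powr p * (LINT x|lebesgue. h x powr p)) (TT A f (m - 1))"
      using extends_wellD(5)[OF TT[of A] trace_rep_subset[OF r]] by blast
  qed
  have chain: "deriv_chain (m - 1) (T f)" if r: "trace_rep m E f p D h" for f p D h
    unfolding deriv_chain_def
  proof (intro allI impI)
    fix k x assume k: "k < m - 1"
    have p: "p > 1" using r by (simp add: trace_rep_def)
    let ?I = "C powr p * (LINT x|lebesgue. h x powr p)"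
    obtain B where B: "B \<ge> 0" "\<forall>A k y. finite A \<and> X \<subseteq> A \<and> A \<subseteq> E \<and> k \<le> m - 1 \<and> \<bar>y\<bar> \<le> \<bar>x\<bar> + 1 \<longrightarrow> \<bar>TT A f k y\<bar> \<le> B"
      using bd[OF r, of "\<bar>x\<bar> + 1"] by blast
    \<comment> \<open>One constant serves all orders: order \<open>m - 1\<close> has the Hoelder
      bound, a lower order the Lipschitz bound \<open>B\<close> from the next derivative, and a
      distance of at most 1 is bounded by its own power with exponent
      \<open>1 - 1 / p\<close>.\<close>
    define c where "c = max B (?I powr (1 / p))"
    show "(T f k has_real_derivative T f (Suc k) x) (at x)"
    proof (rule DERIV_power_remainder[where \<theta> = "1 - 1 / p" and c = c])
      show "1 - 1 / p > 0" using p by simp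
      fix y assume y: "\<bar>y - x\<bar> \<le> 1"
      have "((\<lambda>A. \<bar>TT A f k y - TT A f k x - (y - x) * TT A f (Suc k) x\<bar>) \<longlongrightarrow>
          \<bar>T f k y - T f k x - (y - x) * T f (Suc k) x\<bar>) U"
        using k by (intro tendsto_intros lim[OF r]) auto
      moreover have "\<forall>\<^sub>F A in U. \<bar>TT A f k y - TT A f k x - (y - x) * TT A f (Suc k) x\<bar> \<le> \<bar>y - x\<bar> * (c * \<bar>y - x\<bar> powr (1 - 1 / p))"
        using ev[OF X(1,3)] rz[OF r]
      proof eventually_elim
        case (elim A)
        let ?g = "TT A f"
        have ch: "deriv_chain m ?g" using TT[of A] elim by (simp add: extends_well_def)
        then have der: "\<And>j z. j < m \<Longrightarrow> (?g j has_real_derivative ?g (Suc j) z) (at z)" by (simp add: deriv_chain_def)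
        have mod: "\<bar>?g (Suc k) z - ?g (Suc k) x\<bar> \<le> c * \<bar>y - x\<bar> powr (1 - 1 / p)" if z: "\<bar>z - x\<bar> \<le> \<bar>y - x\<bar>" for z
        proof -
          have mono: "\<bar>z - x\<bar> powr (1 - 1 / p) \<le> \<bar>y - x\<bar> powr (1 - 1 / p)" using z p by (intro powr_mono2) auto
          have "\<bar>?g (Suc k) z - ?g (Suc k) x\<bar> \<le> c * \<bar>z - x\<bar> powr (1 - 1 / p)"
          proof (cases "Suc k = m - 1")
            case True
            have "\<bar>?g (Suc k) z - ?g (Suc k) x\<bar> \<le> ?I powr (1 / p) * \<bar>z - x\<bar> powr (1 - 1 / p)"
              using riesz_bounded_Hoelder[OF elim(2) p] True by simp
            also have "\<dots> \<le> c * \<bar>z - x\<bar> powr (1 - 1 / p)" unfolding c_def by (intro mult_right_mono) auto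
            finally show ?thesis .
          next
            case False
            have "norm (?g (Suc k) z - ?g (Suc k) x) \<le> B * norm (z - x)"
            proof (rule field_differentiable_bound[of "{x - 1..x + 1}"])
              show "(?g (Suc k) has_field_derivative ?g (Suc (Suc k)) w) (at w within {x - 1..x + 1})" for w
                by (rule has_field_derivative_at_within, rule der) (use k in simp)
              show "norm (?g (Suc (Suc k)) w) \<le> B" if "w \<in> {x - 1..x + 1}" for w
              proof -
                have "\<bar>w\<bar> \<le> \<bar>x\<bar> + 1" using that by auto
                then show ?thesis using B(2) elim k False by simp
              qed
            qed (use z y in \<open>auto simp: abs_le_iff\<close>)
            also have "\<dots> \<le> c * \<bar>z - x\<bar> powr (1 - 1 / p)"
            proof (intro mult_mono)
              have z1: "\<bar>z - x\<bar> \<le> 1" using z y by simp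
              have "\<bar>z - x\<bar> powr 1 \<le> \<bar>z - x\<bar> powr (1 - 1 / p)"
                by (rule powr_mono') (use z1 p in auto)
              then show "norm (z - x) \<le> \<bar>z - x\<bar> powr (1 - 1 / p)" by simp
            qed (use B in \<open>auto simp: c_def\<close>)
            finally show ?thesis by simp
          qed
          also have "\<dots> \<le> c * \<bar>y - x\<bar> powr (1 - 1 / p)" using mono B(1) by (intro mult_left_mono) (auto simp: c_def)
          finally show ?thesis .
        qed
        have "norm ((?g k y - y * ?g (Suc k) x) - (?g k x - x * ?g (Suc k) x)) \<le> c * \<bar>y - x\<bar> powr (1 - 1 / p) * norm (y - x)"
        proof (rule field_differentiable_bound[of "{x - \<bar>y - x\<bar>..x + \<bar>y - x\<bar>}" "\<lambda>z. ?g k z - z * ?g (Suc k) x" "\<lambda>z. ?g (Suc k) z - ?g (Suc k) x"])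
          show "((\<lambda>z. ?g k z - z * ?g (Suc k) x) has_field_derivative ?g (Suc k) w - ?g (Suc k) x) (at w within {x - \<bar>y - x\<bar>..x + \<bar>y - x\<bar>})" for w
          proof (rule has_field_derivative_at_within)
            show "((\<lambda>z. ?g k z - z * ?g (Suc k) x) has_field_derivative ?g (Suc k) w - ?g (Suc k) x) (at w)"
              using der[of k w] k by (auto intro!: derivative_eq_intros)
          qed
          show "norm (?g (Suc k) w - ?g (Suc k) x) \<le> c * \<bar>y - x\<bar> powr (1 - 1 / p)" if "w \<in> {x - \<bar>y - x\<bar>..x + \<bar>y - x\<bar>}" for w
            using mod[of w] that by (auto simp: abs_le_iff)
        qed auto
        then show ?case by (simp add: algebra_simps)
      qed
      ultimately show "\<bar>T f k y - T f k x - (y - x) * T f (Suc k) x\<bar> \<le> \<bar>y - x\<bar> * (c * \<bar>y - x\<bar> powr (1 - 1 / p))"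
        using tendsto_upperbound U(2) by blast
    qed
  qed
  have interp: "T f 0 x = f x" if r: "trace_rep m E f p D h" and x: "x \<in> E" for f p D h x
  proof -
    have "\<forall>\<^sub>F A in U. f x = TT A f 0 x"
      using ev[of "{x}"] x TT by (auto simp: extends_well_def elim!: eventually_mono)
    then have "((\<lambda>A. TT A f 0 x) \<longlongrightarrow> f x) U" by (rule Lim_transform_eventually[OF tendsto_const])
    then show ?thesis using lim[OF r, of 0 x] tendsto_unique[OF U(2)] by blast
  qed
  have riesz_bounded_lim: "riesz_bounded p (C powr p * (LINT x|lebesgue. h x powr p)) (T f (m - 1))" if r: "trace_rep m E f p D h" for f p D h
    unfolding riesz_bounded_def
  proof (intro allI impI)
    fix \<D> :: "real set set" assume \<D>: "\<D> division_of \<Union>\<D>"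
    have p: "p > 1" using r by (simp add: trace_rep_def)
    \<comment> \<open>For a fixed division only finitely many values enter, so pointwise convergence
      suffices.\<close>
    have "((\<lambda>A. \<Sum>K\<in>\<D>. \<bar>TT A f (m - 1) (Sup K) - TT A f (m - 1) (Inf K)\<bar> powr p / (Sup K - Inf K) powr (p - 1)) \<longlongrightarrow>
      (\<Sum>K\<in>\<D>. \<bar>T f (m - 1) (Sup K) - T f (m - 1) (Inf K)\<bar> powr p * inverse ((Sup K - Inf K) powr (p - 1)))) U"
      unfolding divide_inverse
      using p by (intro tendsto_sum tendsto_mult_right tendsto_powr' tendsto_rabs tendsto_diff lim[OF r] tendsto_const) auto
    moreover have "\<forall>\<^sub>F A in U. (\<Sum>K\<in>\<D>. \<bar>TT A f (m - 1) (Sup K) - TT A f (m - 1) (Inf K)\<bar> powr p / (Sup K - Inf K) powr (p - 1))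
        \<le> C powr p * (LINT x|lebesgue. h x powr p)"
      using rz[OF r] by (rule eventually_mono) (use \<D> in \<open>auto simp: riesz_bounded_def\<close>)
    ultimately have "(\<Sum>K\<in>\<D>. \<bar>T f (m - 1) (Sup K) - T f (m - 1) (Inf K)\<bar> powr p * inverse ((Sup K - Inf K) powr (p - 1)))
       \<le> C powr p * (LINT x|lebesgue. h x powr p)"
      using tendsto_upperbound U(2) by blast
    then show "(\<Sum>K\<in>\<D>. \<bar>T f (m - 1) (Sup K) - T f (m - 1) (Inf K)\<bar> powr p / (Sup K - Inf K) powr (p - 1))
       \<le> C powr p * (LINT x|lebesgue. h x powr p)" by (simp add: divide_inverse)
  qed
  have add: "T h 0 = (\<lambda>x. T f 0 x + T g 0 x)"
    if f: "trace_rep m E f p D u" and g: "trace_rep m E g p' D' u'" and h: "\<forall>x\<in>E. h x = f x + g x" for f g h p D u p' D' u'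
  proof
    fix x
    have "((\<lambda>A. TT A f 0 x + TT A g 0 x) \<longlongrightarrow> T f 0 x + T g 0 x) U"
      by (intro tendsto_add lim[OF f] lim[OF g]) auto
    moreover have "\<forall>\<^sub>F A in U. TT A f 0 x + TT A g 0 x = TT A h 0 x"
      using ev[of "{}"]
    proof (rule eventually_mono)
      fix A assume "finite A \<and> {} \<subseteq> A \<and> A \<subseteq> E"
      then show "TT A f 0 x + TT A g 0 x = TT A h 0 x" using TT[of A] h unfolding extends_well_def by (metis subsetD)
    qed auto
    ultimately have "((\<lambda>A. TT A h 0 x) \<longlongrightarrow> T f 0 x + T g 0 x) U" by (rule Lim_transform_eventually)
    then show "T h 0 x = T f 0 x + T g 0 x" unfolding T_def[of h] by (rule tendsto_Lim[OF U(2)])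
  qed
  have cm: "T h 0 = (\<lambda>x. c * T f 0 x)" if f: "trace_rep m E f p D u" and h: "\<forall>x\<in>E. h x = c * f x" for c f h p D u
  proof
    fix x
    have "((\<lambda>A. c * TT A f 0 x) \<longlongrightarrow> c * T f 0 x) U"
      by (intro tendsto_mult_left lim[OF f]) auto
    moreover have "\<forall>\<^sub>F A in U. c * TT A f 0 x = TT A h 0 x"
      using ev[of "{}"]
    proof (rule eventually_mono)
      fix A assume "finite A \<and> {} \<subseteq> A \<and> A \<subseteq> E"
      then show "c * TT A f 0 x = TT A h 0 x" using TT[of A] h unfolding extends_well_def by (metis subsetD)
    qed auto
    ultimately have "((\<lambda>A. TT A h 0 x) \<longlongrightarrow> c * T f 0 x) U" by (rule Lim_transform_eventually)
    then show "T h 0 x = c * T f 0 x" unfolding T_def[of h] by (rule tendsto_Lim[OF U(2)])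
  qed
  have "hom_extends m C E T"
    unfolding hom_extends_def
    by (intro conjI allI impI ballI; (elim exE)?) (erule chain interp riesz_bounded_lim add cm; assumption)+
  then show ?thesis by blast
qed

theorem hom_extension:
  assumes m: "m \<ge> 1"
  obtains C where "C > 0" "\<And>E. \<exists>T. hom_extends m C E T"
proof -
  obtain C where C: "C > 0" "\<And>A. finite A \<Longrightarrow> \<exists>T. extends_well m C A T"
    using finite_extension[OF m] by blast
  have "\<exists>T. hom_extends m C E T" for E
  proof (cases "finite E")
    case True
    then obtain T where T: "extends_well m C E T" using C by blast
    have "hom_extends m C E T"
      unfolding hom_extends_def
    proof (intro conjI allI impI ballI ext; (elim exE)?)
      show "deriv_chain (m - 1) (T f)" for f by (rule deriv_chain_mono[OF extends_wellD(1)[OF T]]) simp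
    qed (use extends_wellD[OF T] in blast)+
    then show ?thesis by blast
  qed (use hom_extension_infinite[OF m C(2)] in blast)
  then show thesis using that C(1) by blast
qed

section \<open>The homogeneous space and norm estimates\<close>

lemma hom_Sobolev_trace_rep:
  assumes "F \<in> hom_Sobolev m p" "m \<ge> 1" "p > 1" "\<And>x. x \<in> E \<Longrightarrow> f x = F x"
  shows "trace_rep m E f p (\<lambda>k. (deriv ^^ k) F) (\<lambda>x. \<bar>(deriv ^^ m) F x\<bar>)"
  unfolding trace_rep_def
  using assms hom_Sobolev_deriv_chain[OF assms(1)] hom_Sobolev_incr_bounded[OF assms(1-3)]
  by (auto simp: hom_Sobolev_def Lp_space_abs)

text \<open>\<open>g\<close> is compared with every extension \<open>F\<close> separately, and the
  infimum is taken last; division by \<open>C\<close> turns the claim into a lower bound for the set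
  of norms.\<close>

lemma trace_norm_bound:
  assumes "C > 0" "f \<in> trace_space X E"
    and le: "\<And>F. F \<in> X \<Longrightarrow> (\<And>x. x \<in> E \<Longrightarrow> F x = f x) \<Longrightarrow> N g \<le> C * N F"
  shows "N g \<le> C * trace_norm X N E f"
proof -
  have "N g / C \<le> trace_norm X N E f"
    unfolding trace_norm_def
  proof (rule cInf_greatest)
    show "{N F |F. F \<in> X \<and> (\<forall>x\<in>E. F x = f x)} \<noteq> {}" using assms(2) by (auto simp: trace_space_def)
  qed (use assms(1) le in \<open>auto simp: divide_le_eq mult.commute\<close>)
  then show ?thesis using assms(1) by (simp add: divide_le_eq mult.commute)
qed

lemma powr_scale_root:
  "C \<ge> 0 \<Longrightarrow> I \<ge> 0 \<Longrightarrow> p > 1 \<Longrightarrow> (C powr p * I) powr (1 / p) = C * I powr (1 / p)" for C I p :: real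
  by (simp add: powr_mult powr_powr)

lemma Lp_norm_nonneg: "Lp_norm p g \<ge> 0"
  by (simp add: Lp_norm_def)

lemma Lp_norm_powr: "p > 1 \<Longrightarrow> Lp_norm p g powr p = (LINT x|lebesgue. \<bar>g x\<bar> powr p)"
  by (simp add: Lp_norm_def powr_powr)

theorem hom_Sobolev_extension:
  assumes m: "m \<ge> 1" and C: "C > 0" and T: "hom_extends m C E T" and p: "p > 1"
  shows "linear_extension_operator (hom_Sobolev m p) E (\<lambda>f. T f 0)"
    "f \<in> trace_space (hom_Sobolev m p) E \<Longrightarrow> hom_Sobolev_seminorm m p (T f 0)
       \<le> C * trace_norm (hom_Sobolev m p) (hom_Sobolev_seminorm m p) E f"
proof -
  have trace_rep: "\<exists>q D h. trace_rep m E f q D h" if "f \<in> trace_space (hom_Sobolev m p) E" for f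
  proof -
    obtain F where "F \<in> hom_Sobolev m p" "\<forall>x\<in>E. F x = f x" using \<open>f \<in> _\<close> by (auto simp: trace_space_def)
    then show ?thesis using hom_Sobolev_trace_rep[of F m p E f] m p by (metis (no_types))
  qed
  have main: "T f 0 \<in> hom_Sobolev m p \<and> (\<forall>x\<in>E. T f 0 x = f x) \<and>
      hom_Sobolev_seminorm m p (T f 0) \<le> C * hom_Sobolev_seminorm m p F"
    if F: "F \<in> hom_Sobolev m p" "\<And>x. x \<in> E \<Longrightarrow> F x = f x" for f F
  proof -
    have "trace_rep m E f p (\<lambda>k. (deriv ^^ k) F) (\<lambda>x. \<bar>(deriv ^^ m) F x\<bar>)"
      by (rule hom_Sobolev_trace_rep) (use F m p in auto)
    then have *: "deriv_chain (m - 1) (T f)" "\<forall>x\<in>E. T f 0 x = f x"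
      "riesz_bounded p (C powr p * (LINT x|lebesgue. \<bar>(deriv ^^ m) F x\<bar> powr p)) (T f (m - 1))"
      using T unfolding hom_extends_def by blast+
    have "hom_Sobolev_seminorm m p (T f 0) \<le> (C powr p * (LINT x|lebesgue. \<bar>(deriv ^^ m) F x\<bar> powr p)) powr (1 / p)"
      by (rule riesz_bounded_hom_Sobolev(2)[OF *(1) m *(3) p])
    also have "\<dots> = C * hom_Sobolev_seminorm m p F"
      using C p by (simp add: powr_scale_root hom_Sobolev_seminorm_def Lp_norm_def)
    finally show ?thesis using riesz_bounded_hom_Sobolev(1)[OF *(1) m *(3) p] *(2) by blast
  qed
  show "linear_extension_operator (hom_Sobolev m p) E (\<lambda>f. T f 0)"
    unfolding linear_extension_operator_def
  proof (intro conjI ballI allI)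
    fix f assume f: "f \<in> trace_space (hom_Sobolev m p) E"
    then obtain F where F: "F \<in> hom_Sobolev m p" "\<And>x. x \<in> E \<Longrightarrow> F x = f x" by (auto simp: trace_space_def)
    show "T f 0 \<in> hom_Sobolev m p" using main[OF F] by blast
    show "T f 0 x = f x" if "x \<in> E" for x using main[OF F] that by blast
    show "T (\<lambda>x\<in>E. c * f x) 0 = (\<lambda>x. c * T f 0 x)" for c
      using T trace_rep[OF f] unfolding hom_extends_def by simp
    show "T (\<lambda>x\<in>E. f x + g x) 0 = (\<lambda>x. T f 0 x + T g 0 x)" if "g \<in> trace_space (hom_Sobolev m p) E" for g
      using T trace_rep[OF f] trace_rep[OF that] unfolding hom_extends_def by simp
  qed
  show "hom_Sobolev_seminorm m p (T f 0) \<le> C * trace_norm (hom_Sobolev m p) (hom_Sobolev_seminorm m p) E f"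
    if "f \<in> trace_space (hom_Sobolev m p) E"
    by (rule trace_norm_bound[OF C that]) (use main in blast)
qed

section \<open>L_p estimates with constants independent of the exponent\<close>

text \<open>In each summand all but one factor is replaced by the whole sum, raised to
  \<open>p - 1\<close>: the comparison of the norms of finite sequences for the exponents
  \<open>p\<close> and 1.\<close>

lemma sum_powr_le:
  fixes a :: "'a \<Rightarrow> real"
  assumes "finite J" "\<And>i. i \<in> J \<Longrightarrow> a i \<ge> 0" "p > 1"
  shows "(\<Sum>i\<in>J. a i powr p) \<le> (\<Sum>i\<in>J. a i) powr p"
proof -
  let ?s = "\<Sum>i\<in>J. a i"
  have s0: "?s \<ge> 0" using assms by (intro sum_nonneg) auto
  have pw: "t powr p = t * t powr (p - 1)" if "t \<ge> 0" for t :: real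
    using that by (cases "t = 0") (auto simp: powr_diff)
  have "(\<Sum>i\<in>J. a i powr p) \<le> (\<Sum>i\<in>J. a i * ?s powr (p - 1))"
  proof (rule sum_mono)
    fix i assume i: "i \<in> J"
    have "a i \<le> ?s" using assms i by (intro member_le_sum) auto
    then show "a i powr p \<le> a i * ?s powr (p - 1)"
      using assms i by (subst pw) (auto intro!: mult_left_mono powr_mono2)
  qed
  also have "\<dots> = ?s powr p" by (simp add: sum_distrib_right[symmetric] pw[OF s0])
  finally show ?thesis .
qed

text \<open>A crude form of Minkowski's inequality, whose additional factor \<open>card J\<close> is
  independent of \<open>p\<close>.\<close>

lemma Lp_space_sum:
  assumes J: "finite J" and u: "\<And>i. i \<in> J \<Longrightarrow> u i \<in> Lp_space p" and p: "p > 1"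
  shows "(\<lambda>x. \<Sum>i\<in>J. \<bar>u i x\<bar>) \<in> Lp_space p"
    "Lp_norm p (\<lambda>x. \<Sum>i\<in>J. \<bar>u i x\<bar>) \<le> card J * (\<Sum>i\<in>J. Lp_norm p (u i))"
proof -
  let ?S = "\<lambda>x. \<Sum>i\<in>J. \<bar>u i x\<bar>" and ?U = "\<lambda>x. card J powr p * (\<Sum>i\<in>J. \<bar>u i x\<bar> powr p)"
  have le: "\<bar>?S x\<bar> powr p \<le> ?U x" for x
    using powr_sum_le[OF J order_refl, of "\<lambda>i. \<bar>u i x\<bar>" p] p by (simp add: sum_nonneg)
  have Ui: "integrable lebesgue ?U"
    using u by (intro Bochner_Integration.integrable_mult_right Bochner_Integration.integrable_sum) (auto simp: Lp_space_def)
  have Sm: "?S \<in> borel_measurable lebesgue"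
    using u by (intro borel_measurable_sum borel_measurable_abs) (auto simp: Lp_space_def)
  have Si: "integrable lebesgue (\<lambda>x. \<bar>?S x\<bar> powr p)"
  proof (rule Bochner_Integration.integrable_bound[OF Ui])
    show "(\<lambda>x. \<bar>?S x\<bar> powr p) \<in> borel_measurable lebesgue" using Sm by measurable
    show "AE x in lebesgue. norm (\<bar>?S x\<bar> powr p) \<le> norm (?U x)"
      by (rule AE_I2) (use le in \<open>simp add: order_trans[OF _ abs_ge_self]\<close>)
  qed
  show "?S \<in> Lp_space p" using Sm Si by (simp add: Lp_space_def)
  have "(LINT x|lebesgue. \<bar>?S x\<bar> powr p) \<le> (LINT x|lebesgue. ?U x)"
    by (rule integral_mono[OF Si Ui le])
  also have "\<dots> = card J powr p * (\<Sum>i\<in>J. LINT x|lebesgue. \<bar>u i x\<bar> powr p)"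
    using u by (subst Bochner_Integration.integral_mult_right, intro Bochner_Integration.integrable_sum)
      (auto simp: Lp_space_def intro!: Bochner_Integration.integral_sum)
  also have "\<dots> = card J powr p * (\<Sum>i\<in>J. Lp_norm p (u i) powr p)" using p by (simp add: Lp_norm_powr)
  also have "\<dots> \<le> card J powr p * (\<Sum>i\<in>J. Lp_norm p (u i)) powr p"
    by (intro mult_left_mono sum_powr_le J p Lp_norm_nonneg) auto
  finally have "Lp_norm p ?S \<le> (card J powr p * (\<Sum>i\<in>J. Lp_norm p (u i)) powr p) powr (1 / p)"
    unfolding Lp_norm_def[of p ?S] using p by (intro powr_mono2) auto
  also have "\<dots> = card J * (\<Sum>i\<in>J. Lp_norm p (u i))"
    using p by (subst powr_scale_root) (auto simp: powr_powr sum_nonneg Lp_norm_nonneg)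
  finally show "Lp_norm p ?S \<le> card J * (\<Sum>i\<in>J. Lp_norm p (u i))" .
qed

lemma Lp_space_mono:
  assumes v: "v \<in> Lp_space p" and u: "u \<in> borel_measurable lebesgue" and le: "\<And>x. \<bar>u x\<bar> \<le> \<bar>v x\<bar>" and p: "p > 1"
  shows "u \<in> Lp_space p" "Lp_norm p u \<le> Lp_norm p v"
proof -
  have vi: "integrable lebesgue (\<lambda>x. \<bar>v x\<bar> powr p)" using v by (simp add: Lp_space_def)
  have pw: "\<bar>u x\<bar> powr p \<le> \<bar>v x\<bar> powr p" for x using le p by (intro powr_mono2) auto
  have ui: "integrable lebesgue (\<lambda>x. \<bar>u x\<bar> powr p)"
  proof (rule Bochner_Integration.integrable_bound[OF vi])
    show "(\<lambda>x. \<bar>u x\<bar> powr p) \<in> borel_measurable lebesgue" using u by measurable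
  qed (use pw in auto)
  show "u \<in> Lp_space p" using u ui by (simp add: Lp_space_def)
  show "Lp_norm p u \<le> Lp_norm p v"
    unfolding Lp_norm_def using p by (intro powr_mono2 integral_mono ui vi pw) auto
qed

lemma Lp_space_cmult:
  assumes "u \<in> Lp_space p" "p > 1"
  shows "(\<lambda>x. c * u x) \<in> Lp_space p" "Lp_norm p (\<lambda>x. c * u x) = \<bar>c\<bar> * Lp_norm p u"
proof -
  have eq: "\<bar>c * y\<bar> powr p = \<bar>c\<bar> powr p * \<bar>y\<bar> powr p" for y by (simp add: abs_mult powr_mult)
  show "(\<lambda>x. c * u x) \<in> Lp_space p" using assms(1) by (auto simp: Lp_space_def eq)
  show "Lp_norm p (\<lambda>x. c * u x) = \<bar>c\<bar> * Lp_norm p u"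
    unfolding Lp_norm_def eq using assms(2) by (simp add: powr_scale_root)
qed

lemma Lp_space_add:
  assumes u: "u \<in> Lp_space p" and v: "v \<in> Lp_space p" and p: "p > 1"
    and w: "w \<in> borel_measurable lebesgue" "\<And>x. \<bar>w x\<bar> \<le> \<bar>u x\<bar> + \<bar>v x\<bar>"
  shows "w \<in> Lp_space p" "Lp_norm p w \<le> 2 * (Lp_norm p u + Lp_norm p v)"
proof -
  let ?u = "\<lambda>b. if b then u else v"
  have *: "(\<lambda>x. \<Sum>i\<in>UNIV. \<bar>?u i x\<bar>) = (\<lambda>x. \<bar>u x\<bar> + \<bar>v x\<bar>)" by (simp add: UNIV_bool add.commute)
  have S: "(\<lambda>x. \<bar>u x\<bar> + \<bar>v x\<bar>) \<in> Lp_space p" "Lp_norm p (\<lambda>x. \<bar>u x\<bar> + \<bar>v x\<bar>) \<le> 2 * (Lp_norm p u + Lp_norm p v)"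
    using Lp_space_sum[of UNIV ?u p] u v p unfolding * by (auto simp: UNIV_bool add.commute)
  note M = Lp_space_mono[OF S(1) w(1) _ p]
  show "w \<in> Lp_space p" by (rule M(1)) (use w(2) in auto)
  have "Lp_norm p w \<le> Lp_norm p (\<lambda>x. \<bar>u x\<bar> + \<bar>v x\<bar>)" by (rule M(2)) (use w(2) in auto)
  then show "Lp_norm p w \<le> 2 * (Lp_norm p u + Lp_norm p v)" using S(2) by linarith
qed

text \<open>Cells of length 1 make a pointwise bound on a cell also a bound for the integral over
  it. Fatou's lemma along growing windows yields integrability over the line from finite sums
  alone.\<close>

lemma integrable_unit_cells:
  fixes g :: "real \<Rightarrow> real"
  assumes g: "g \<in> borel_measurable lebesgue" "\<And>x. g x \<ge> 0"
    and c: "\<And>j x. x \<in> {of_int j..<of_int j + 1} \<Longrightarrow> g x \<le> c j"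
    and M: "\<And>J. finite J \<Longrightarrow> (\<Sum>j\<in>J. c j) \<le> M"
  shows "integrable lebesgue g" "(LINT x|lebesgue. g x) \<le> M"
proof -
  have M0: "M \<ge> 0" using M[of "{}"] by simp
  have c0: "c j \<ge> 0" for j using c[of "of_int j" j] g(2)[of "of_int j"] by simp
  let ?I = "\<lambda>j. {of_int j..<of_int j + 1 :: real}"
  have [measurable]: "{- real N..<real N} \<in> sets lebesgue" for N by simp
  note g(1) [measurable]
  have "(\<integral>\<^sup>+x. ennreal (g x) \<partial>lebesgue) = (\<integral>\<^sup>+x. liminf (\<lambda>N. ennreal (g x) * indicator {- real N..<real N} x) \<partial>lebesgue)"
  proof (rule nn_integral_cong)
    fix x :: real
    obtain k :: nat where k: "\<bar>x\<bar> < real k" using reals_Archimedean2 by blast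
    then have "\<forall>\<^sub>F N in sequentially. ennreal (g x) * indicator {- real N..<real N} x = ennreal (g x)"
      unfolding eventually_sequentially by (intro exI[of _ k]) (auto simp: abs_if split: if_splits)
    then have "(\<lambda>N. ennreal (g x) * indicator {- real N..<real N} x) \<longlonglongrightarrow> ennreal (g x)"
      by (rule tendsto_eventually)
    then show "ennreal (g x) = liminf (\<lambda>N. ennreal (g x) * indicator {- real N..<real N} x)"
      by (simp add: lim_imp_Liminf)
  qed
  also have "\<dots> \<le> liminf (\<lambda>N. \<integral>\<^sup>+x. ennreal (g x) * indicator {- real N..<real N} x \<partial>lebesgue)"
    by (rule nn_integral_liminf) measurable
  also have "\<dots> \<le> ennreal M"
  proof (rule Liminf_le)
    have "(\<integral>\<^sup>+x. ennreal (g x) * indicator {- real N..<real N} x \<partial>lebesgue) \<le> ennreal M" for N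
    proof -
    let ?J = "{- int N..<int N}"
    have "(\<integral>\<^sup>+x. ennreal (g x) * indicator {- real N..<real N} x \<partial>lebesgue)
      \<le> (\<integral>\<^sup>+x. (\<Sum>j\<in>?J. ennreal (c j) * indicator (?I j) x) \<partial>lebesgue)"
    proof (rule nn_integral_mono)
      fix x :: real
      show "ennreal (g x) * indicator {- real N..<real N} x \<le> (\<Sum>j\<in>?J. ennreal (c j) * indicator (?I j) x)"
      proof (cases "x \<in> {- real N..<real N}")
        case True
        have x: "x \<in> ?I \<lfloor>x\<rfloor>" by (simp add: floor_correct)
        have J: "\<lfloor>x\<rfloor> \<in> ?J" using True by (auto simp: le_floor_iff floor_less_iff)
        have "ennreal (g x) \<le> ennreal (c \<lfloor>x\<rfloor>) * indicator (?I \<lfloor>x\<rfloor>) x"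
          using c[OF x] x by (simp add: ennreal_leI)
        also have "\<dots> \<le> (\<Sum>j\<in>?J. ennreal (c j) * indicator (?I j) x)"
          by (rule member_le_sum[OF J]) auto
        finally show ?thesis using True by simp
      qed simp
    qed
    also have "\<dots> = (\<Sum>j\<in>?J. ennreal (c j) * emeasure lebesgue (?I j))"
    proof -
      have mI [measurable]: "?I j \<in> sets lebesgue" for j by simp
      have "(\<lambda>x. ennreal (c j) * indicator (?I j) x) \<in> borel_measurable lebesgue" for j by measurable
      then show ?thesis by (simp only: nn_integral_sum nn_integral_cmult_indicator[OF mI])
    qed
    also have "\<dots> = ennreal (\<Sum>j\<in>?J. c j)" using c0 by (simp add: sum_ennreal)
    also have "\<dots> \<le> ennreal M" using M by (intro ennreal_leI) auto
    finally show ?thesis .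
    qed
    then show "\<forall>\<^sub>F N in sequentially. (\<integral>\<^sup>+x. ennreal (g x) * indicator {- real N..<real N} x \<partial>lebesgue) \<le> ennreal M"
      by simp
  qed simp
  finally have le: "(\<integral>\<^sup>+x. ennreal (g x) \<partial>lebesgue) \<le> ennreal M" .
  show "integrable lebesgue g"
    by (rule integrableI_bounded[OF g(1)]) (use le order_le_less_trans[OF le] g(2) in simp)
  show "(LINT x|lebesgue. g x) \<le> M"
    using le M0 g by (subst integral_eq_nn_integral) (auto intro!: enn2real_leI)
qed

section \<open>The inhomogeneous space\<close>

text \<open>On each unit cell the cutoff runs from \<open>v j\<close> to \<open>v (j + 1)\<close>
  along the step. Since the derivatives of the step vanish at both ends the pieces fit
  together.\<close>

lemma cutoff_chain:
  fixes v :: "int \<Rightarrow> real"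
  assumes v: "\<And>j. v j \<in> {0, 1}"
    and \<sigma>: "deriv_chain n \<sigma>" "\<And>x. x \<le> 0 \<Longrightarrow> \<sigma> 0 x = (0 :: real)" "\<And>x. x \<ge> 1 \<Longrightarrow> \<sigma> 0 x = 1"
    "\<And>k x. 1 \<le> k \<Longrightarrow> k \<le> n \<Longrightarrow> x \<le> 0 \<or> x \<ge> 1 \<Longrightarrow> \<sigma> k x = 0"
    "\<And>k x. k \<le> n \<Longrightarrow> \<bar>\<sigma> k x\<bar> \<le> B"
  shows "\<exists>\<theta>. deriv_chain n \<theta> \<and> (\<forall>k\<le>n. \<forall>x. \<bar>\<theta> k x\<bar> \<le> 1 + B) \<and> (\<forall>j. \<theta> 0 (of_int j) = v j) \<and>
    (\<forall>j x. x \<in> {of_int j..<of_int j + 1} \<longrightarrow> v j = v (j + 1) \<longrightarrow> \<theta> 0 x = v j)"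
proof -
  define \<theta> where "\<theta> k x = (if k = 0 then v \<lfloor>x\<rfloor> else 0) + (v (\<lfloor>x\<rfloor> + 1) - v \<lfloor>x\<rfloor>) * \<sigma> k (x - of_int \<lfloor>x\<rfloor>)" for k x
  \<comment> \<open>A formula without the floor function of \<open>x\<close> that agrees with
    \<open>\<theta>\<close> on both sides of the integer \<open>j\<close>; differentiability across
    \<open>j\<close> is read off from it.\<close>
  define \<Theta> where "\<Theta> j k x = (if k = 0 then v (j - 1) else 0) + (v j - v (j - 1)) * \<sigma> k (x - of_int (j - 1))
     + (v (j + 1) - v j) * \<sigma> k (x - of_int j)" for j k x
  have local_eq: "\<theta> k x = \<Theta> j k x" if "k \<le> n" "x \<in> {of_int j - 1<..<of_int j + 1}" for j k x
  proof (cases "x < of_int j")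
    case True
    then have "\<lfloor>x\<rfloor> = j - 1" using that by (intro floor_unique) auto
    moreover have "\<sigma> k (x - of_int j) = 0" using True \<sigma>(2,4) that(1) by (cases "k = 0") auto
    ultimately show ?thesis by (simp add: \<theta>_def \<Theta>_def)
  next
    case False
    then have "\<lfloor>x\<rfloor> = j" using that by (intro floor_unique) auto
    moreover have "\<sigma> k (x - of_int (j - 1)) = (if k = 0 then 1 else 0)"
      using False \<sigma>(3)[of "x - of_int (j - 1)"] \<sigma>(4)[of k "x - of_int (j - 1)"] that(1) by auto
    ultimately show ?thesis by (simp add: \<theta>_def \<Theta>_def)
  qed
  have "deriv_chain n \<theta>"
    unfolding deriv_chain_def
  proof (intro allI impI)
    fix k :: nat and x :: real assume k: "k < n"
    define j where "j = \<lfloor>x\<rfloor>"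
    have xj: "x \<in> {of_int j - 1<..<of_int j + 1}" unfolding j_def by (simp, linarith)
    have sh: "((\<lambda>x. \<sigma> k (x - a)) has_real_derivative \<sigma> (Suc k) (x - a)) (at x)" for a
    proof -
      have "(\<sigma> k has_real_derivative \<sigma> (Suc k) (x - a)) (at (x - a))" using \<sigma>(1) k by (simp add: deriv_chain_def)
      then have "((\<lambda>x. \<sigma> k (x - a)) has_real_derivative \<sigma> (Suc k) (x - a) * 1) (at x)"
        by (rule DERIV_chain2) (auto intro!: derivative_eq_intros)
      then show ?thesis by simp
    qed
    have "(\<Theta> j k has_real_derivative \<Theta> j (Suc k) x) (at x)"
      unfolding \<Theta>_def[abs_def]
      by (rule DERIV_cong[OF DERIV_add[OF DERIV_add[OF DERIV_const DERIV_cmult[OF sh]] DERIV_cmult[OF sh]]]) simp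
    then have "(\<theta> k has_real_derivative \<Theta> j (Suc k) x) (at x)"
      by (rule has_field_derivative_transform_within_open[OF _ open_greaterThanLessThan xj]) (use local_eq k in auto)
    then show "(\<theta> k has_real_derivative \<theta> (Suc k) x) (at x)" using local_eq[of "Suc k" x j] k xj by simp
  qed
  moreover have "\<bar>\<theta> k x\<bar> \<le> 1 + B" if "k \<le> n" for k x
  proof -
    have "\<bar>v (\<lfloor>x\<rfloor> + 1) - v \<lfloor>x\<rfloor>\<bar> \<le> 1" "\<bar>v \<lfloor>x\<rfloor>\<bar> \<le> 1" using v[of "\<lfloor>x\<rfloor> + 1"] v[of "\<lfloor>x\<rfloor>"] by auto
    then have "\<bar>(v (\<lfloor>x\<rfloor> + 1) - v \<lfloor>x\<rfloor>) * \<sigma> k (x - of_int \<lfloor>x\<rfloor>)\<bar> \<le> 1 * B"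
      unfolding abs_mult using \<sigma>(5)[OF that] by (intro mult_mono) auto
    moreover have "\<bar>if k = 0 then v \<lfloor>x\<rfloor> else 0\<bar> \<le> 1" using \<open>\<bar>v \<lfloor>x\<rfloor>\<bar> \<le> 1\<close> by auto
    ultimately show ?thesis unfolding \<theta>_def by linarith
  qed
  moreover have "\<theta> 0 (of_int j) = v j" for j using \<sigma>(2) by (simp add: \<theta>_def)
  moreover have "\<theta> 0 x = v j" if "x \<in> {of_int j..<of_int j + 1}" "v j = v (j + 1)" for j x
  proof -
    have "\<lfloor>x\<rfloor> = j" using that by (intro floor_unique) auto
    then show ?thesis using that by (simp add: \<theta>_def)
  qed
  ultimately show ?thesis by blast
qed

section \<open>Products with a cutoff\<close>

lemma incr_bounded_of_local:
  assumes h: "\<And>a b. h integrable_on {a..b}"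
    and le: "\<And>x y. x \<le> y \<Longrightarrow> y \<le> x + 1 \<Longrightarrow> \<bar>G y - G x\<bar> \<le> integral {x..y} h"
  shows "incr_bounded G h"
proof -
  have "\<bar>G y - G x\<bar> \<le> integral {x..y} h" if "x \<le> y" "y \<le> x + real (Suc n)" for n x y
    using that
  proof (induction n arbitrary: y)
    case (Suc n)
    show ?case
    proof (cases "y \<le> x + real (Suc n)")
      case False
      let ?z = "x + real (Suc n)"
      have "\<bar>G ?z - G x\<bar> \<le> integral {x..?z} h" by (rule Suc.IH) auto
      moreover have "\<bar>G y - G ?z\<bar> \<le> integral {?z..y} h" using False Suc.prems by (intro le) auto
      moreover have "integral {x..?z} h + integral {?z..y} h = integral {x..y} h"
        using False by (intro Henstock_Kurzweil_Integration.integral_combine h) auto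
      ultimately show ?thesis by linarith
    qed (use Suc in blast)
  qed (use le in auto)
  moreover have "\<exists>n. y \<le> x + real (Suc n)" for x y
  proof -
    obtain n :: nat where "y - x \<le> real n" using real_arch_simple by blast
    then show ?thesis by (intro exI[of _ n]) simp
  qed
  ultimately show ?thesis unfolding incr_bounded_def by blast
qed

text \<open>The product rule for increments produces the value \<open>\<bar>u x\<bar>\<close> times
  \<open>y - x\<close>, which has to become an integral. For every \<open>s\<close> in the interval
  \<open>\<bar>u x\<bar>\<close> exceeds \<open>\<bar>u s\<bar>\<close> by at most the integral of
  \<open>a\<close>; averaging over \<open>s\<close> settles this, and \<open>y - x \<le> 1\<close>
  absorbs the remaining length.\<close>

lemma incr_bounded_mult_local:
  assumes u: "incr_bounded u a" "\<And>s t. a integrable_on {s..t}" "\<And>x. a x \<ge> 0" "\<And>s t. (\<lambda>x. \<bar>u x\<bar>) integrable_on {s..t}"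
    and v: "\<And>x. \<bar>v x\<bar> \<le> b" "\<And>x y. \<bar>v y - v x\<bar> \<le> b * \<bar>y - x\<bar>" and xy: "x \<le> y" "y \<le> x + 1"
  shows "\<bar>u y * v y - u x * v x\<bar> \<le> 2 * b * integral {x..y} (\<lambda>s. \<bar>u s\<bar> + a s)"
proof -
  let ?A = "integral {x..y} a" and ?U = "integral {x..y} (\<lambda>s. \<bar>u s\<bar>)"
  have b: "b \<ge> 0" using v(1)[of 0] by linarith
  have A: "?A \<ge> 0" using u by (intro integral_nonneg) auto
  have U: "?U \<ge> 0" using u by (intro integral_nonneg) auto
  have "\<bar>u x\<bar> * (y - x) = integral {x..y} (\<lambda>s. \<bar>u x\<bar>)" using xy by simp
  also have "\<dots> \<le> integral {x..y} (\<lambda>s. \<bar>u s\<bar> + ?A)"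
  proof (rule integral_le)
    show "\<bar>u x\<bar> \<le> \<bar>u s\<bar> + ?A" if "s \<in> {x..y}" for s
      using incr_bounded_within[OF u(1,2,3), of x x y s] that xy by auto
  qed (use u in \<open>auto intro!: integrable_add\<close>)
  also have "\<dots> = ?U + (y - x) * ?A" using u xy by (subst integral_add) auto
  also have "\<dots> \<le> ?U + ?A" using xy A by (simp add: mult_left_le_one_le)
  finally have ux: "\<bar>u x\<bar> * (y - x) \<le> ?U + ?A" .
  have "\<bar>u y - u x\<bar> \<le> ?A" using u(1) xy by (simp add: incr_bounded_def)
  then have 1: "\<bar>(u y - u x) * v y\<bar> \<le> ?A * b" unfolding abs_mult using v(1) A by (intro mult_mono) auto
  have "\<bar>u x * (v y - v x)\<bar> \<le> \<bar>u x\<bar> * (b * (y - x))" unfolding abs_mult using v(2)[of y x] xy by (intro mult_left_mono) auto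
  also have "\<dots> = b * (\<bar>u x\<bar> * (y - x))" by simp
  also have "\<dots> \<le> b * (?U + ?A)" using ux b by (rule mult_left_mono)
  finally have 2: "\<bar>u x * (v y - v x)\<bar> \<le> b * (?U + ?A)" .
  have "u y * v y - u x * v x = (u y - u x) * v y + u x * (v y - v x)" by (simp add: algebra_simps)
  then have "\<bar>u y * v y - u x * v x\<bar> \<le> ?A * b + b * (?U + ?A)" using 1 2 by linarith
  also have "\<dots> \<le> 2 * b * (?U + ?A)" using b U by (simp add: algebra_simps)
  also have "?U + ?A = integral {x..y} (\<lambda>s. \<bar>u s\<bar> + a s)" using u by (subst integral_add) auto
  finally show ?thesis .
qed

lemma Sobolev_Lp: "F \<in> Sobolev m p \<Longrightarrow> k \<le> m \<Longrightarrow> (deriv ^^ k) F \<in> Lp_space p"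
  by (simp add: Sobolev_def)

lemma Sobolev_incr_bounded:
  assumes F: "F \<in> Sobolev m p" and p: "p > 1" and r: "r < m"
  shows "incr_bounded ((deriv ^^ r) F) (\<lambda>x. \<bar>(deriv ^^ Suc r) F x\<bar>)"
proof (cases "Suc r = m")
  case True
  have "F \<in> hom_Sobolev (Suc r) p" using F True by (simp add: Sobolev_def)
  from hom_Sobolev_incr_bounded[OF this _ p] show ?thesis by simp
next
  case False
  then have r': "Suc r < m" using r by simp
  have Lp: "(deriv ^^ Suc r) F \<in> Lp_space p" by (rule Sobolev_Lp[OF F]) (use r' in simp)
  have dch: "deriv_chain (m - 1) (\<lambda>k. (deriv ^^ k) F)" using F hom_Sobolev_deriv_chain by (auto simp: Sobolev_def)
  show ?thesis
    unfolding incr_bounded_def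
  proof (intro allI impI)
    fix x y :: real assume xy: "x \<le> y"
    have "((deriv ^^ r) F has_real_derivative (deriv ^^ Suc r) F z) (at z)" for z
    proof -
      have "r < m - 1" using r' by linarith
      then show ?thesis using dch unfolding deriv_chain_def by blast
    qed
    then have "((deriv ^^ r) F has_vector_derivative (deriv ^^ Suc r) F z) (at z within {x..y})" for z
      using has_field_derivative_at_within has_real_derivative_iff_has_vector_derivative by blast
    then have "((deriv ^^ Suc r) F has_integral (deriv ^^ r) F y - (deriv ^^ r) F x) {x..y}"
      by (intro fundamental_theorem_of_calculus xy)
    then have "integral {x..y} ((deriv ^^ Suc r) F) = (deriv ^^ r) F y - (deriv ^^ r) F x" by (rule integral_unique)
    moreover have "norm (integral {x..y} ((deriv ^^ Suc r) F)) \<le> integral {x..y} (\<lambda>x. \<bar>(deriv ^^ Suc r) F x\<bar>)"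
      by (rule integral_norm_bound_integral) (use Lp_integrable_on(1)[OF Lp p] Lp_integrable_on(1)[OF Lp_space_abs[OF Lp] p] in auto)
    ultimately show "\<bar>(deriv ^^ r) F y - (deriv ^^ r) F x\<bar> \<le> integral {x..y} (\<lambda>x. \<bar>(deriv ^^ Suc r) F x\<bar>)" by simp
  qed
qed

section \<open>Functions with zeros in every window\<close>

lemma int_window_card: "card {j \<in> J. x \<in> {of_int j - real R..of_int j + real R}} \<le> 2 * R + 1" for J :: "int set"
proof -
  have "{j \<in> J. x \<in> {of_int j - real R..of_int j + real R}} \<subseteq> {\<lceil>x\<rceil> - int R..\<lfloor>x\<rfloor> + int R}"
  proof safe
    fix j assume "x \<in> {of_int j - real R..of_int j + real R}"
    then have "of_int (j - int R) \<le> x" "x \<le> of_int (j + int R)" by auto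
    then have "j - int R \<le> \<lfloor>x\<rfloor>" "\<lceil>x\<rceil> \<le> j + int R" by (simp_all only: le_floor_iff ceiling_le_iff)
    then show "j \<in> {\<lceil>x\<rceil> - int R..\<lfloor>x\<rfloor> + int R}" by simp
  qed
  then have "card {j \<in> J. x \<in> {of_int j - real R..of_int j + real R}} \<le> card {\<lceil>x\<rceil> - int R..\<lfloor>x\<rfloor> + int R}"
    by (intro card_mono) auto
  also have "\<dots> \<le> 2 * R + 1"
  proof -
    have "\<lfloor>x\<rfloor> \<le> \<lceil>x\<rceil>" by (rule floor_le_ceiling)
    then show ?thesis unfolding card_atLeastAtMost_int nat_le_iff by simp
  qed
  finally show ?thesis .
qed

text \<open>Zeros in every window of length 2 give, by Rolle's theorem, zeros of the lower order
  derivatives in every window of length comparable to m; these are then dominated by the top one.\<close>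
lemma dense_zeros_Lp:
  assumes H: "deriv_chain n H" and z: "\<And>j :: int. \<exists>x\<in>{of_int j - 1..of_int j + 1}. H 0 x = 0"
    and q: "incr_bounded (H n) q" "q \<in> Lp_space p" "\<And>x. q x \<ge> 0" and p: "p > 1" and k: "k \<le> n"
  defines "R \<equiv> 3 * n + 5"
  shows "H k \<in> Lp_space p" "Lp_norm p (H k) \<le> (2 * real R) ^ (n + 1) * (2 * real R + 1) * Lp_norm p q"
proof -
  have qi: "q integrable_on {a..b}" for a b using Lp_integrable_on[OF q(2) p] by blast
  have qp: "integrable lebesgue (\<lambda>x. q x powr p)" using q by (simp add: Lp_space_def)
  let ?W = "\<lambda>j :: int. {of_int j - real R..of_int j + real R}"
  define I where "I j = integral (?W j) q" for j
  \<comment> \<open>The first factor comes from descending through the derivatives on a window of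
    length \<open>2 * R\<close>. Jensen's inequality gives the second with exponent
    \<open>p - 1\<close>; it is enlarged to \<open>p\<close> so that the root removes the dependence
    on \<open>p\<close>.\<close>
  define c where "c j = ((2 * real R) ^ n) powr p * ((2 * real R) powr p * integral (?W j) (\<lambda>x. q x powr p))" for j
  have R1: "2 * real R \<ge> 1" by (simp add: R_def)
  have I0: "I j \<ge> 0" for j unfolding I_def using q qi by (intro integral_nonneg) auto
  have bound: "\<bar>H k x\<bar> powr p \<le> c j" if x: "x \<in> {of_int j..<of_int j + 1}" for j x
  proof -
    \<comment> \<open>Windows of length 2 with centres 3 apart are disjoint, so the zeros chosen in
      them are distinct. The \<open>n + 1\<close> zeros lie below \<open>j + 3 * n + 1\<close>,
      within the radius \<open>R\<close>.\<close>
    have "\<forall>i. \<exists>e. e \<in> {of_int (j + 3 * int i) - 1..of_int (j + 3 * int i) + 1} \<and> H 0 e = 0"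
      using z by blast
    then obtain e where "\<forall>i. e i \<in> {of_int (j + 3 * int i) - 1..of_int (j + 3 * int i) + 1} \<and> H 0 (e i) = 0"
      unfolding choice_iff by blast
    then have e: "\<And>i. e i \<in> {of_int (j + 3 * int i) - 1..of_int (j + 3 * int i) + 1}" "\<And>i. H 0 (e i) = 0"
      by blast+
    have e_less: "e i < e i'" if "i < i'" for i i'
    proof -
      have "real i + 1 \<le> real i'" using that by linarith
      then show ?thesis using e(1)[of i] e(1)[of i'] by simp
    qed
    let ?S = "e ` {..n}"
    have inj: "inj_on e {..n}"
    proof (rule inj_onI)
      fix i i' assume "e i = e i'"
      then show "i = i'" using e_less[of i i'] e_less[of i' i] by (cases i i' rule: linorder_cases) auto
    qed
    have S: "?S \<subseteq> ?W j"
    proof safe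
      fix i assume "i \<le> n"
      then have "real i \<le> real n" by simp
      then show "e i \<in> ?W j" using e(1)[of i] by (simp add: R_def)
    qed
    have "\<bar>H k x\<bar> \<le> I j * (of_int j + real R - (of_int j - real R)) ^ (n - k)"
    proof (rule deriv_chain_zeros_bound[OF H _ _ S _ _ k])
      show "n < card ?S" using inj by (simp add: card_image)
      show "\<bar>H n s - H n t\<bar> \<le> I j" if "s \<in> ?W j" "t \<in> ?W j" for s t
        unfolding I_def by (rule incr_bounded_within[OF q(1) qi q(3) that])
      show "x \<in> ?W j" using x by (auto simp: R_def)
    qed (use e in auto)
    also have "\<dots> \<le> I j * (2 * real R) ^ n"
    proof (rule mult_left_mono[OF _ I0])
      have "(2 * real R) ^ (n - k) \<le> (2 * real R) ^ n" using R1 by (intro power_increasing) auto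
      then show "(of_int j + real R - (of_int j - real R)) ^ (n - k) \<le> (2 * real R) ^ n" by simp
    qed
    finally have "\<bar>H k x\<bar> powr p \<le> (I j * (2 * real R) ^ n) powr p" using p by (intro powr_mono2) auto
    also have "\<dots> = ((2 * real R) ^ n) powr p * (I j) powr p" using I0 by (simp add: powr_mult mult.commute)
    also have "\<dots> \<le> c j"
      unfolding c_def
    proof (rule mult_left_mono)
      have "(I j) powr p \<le> (of_int j + real R - (of_int j - real R)) powr (p - 1) * integral (?W j) (\<lambda>x. q x powr p)"
        unfolding I_def by (rule Jensen_powr[OF q(2,3) p]) simp
      also have "\<dots> \<le> (2 * real R) powr p * integral (?W j) (\<lambda>x. q x powr p)"
      proof (rule mult_right_mono)
        show "(of_int j + real R - (of_int j - real R)) powr (p - 1) \<le> (2 * real R) powr p"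
          using R1 by (simp add: powr_mono)
        show "0 \<le> integral (?W j) (\<lambda>x. q x powr p)"
          using Lp_integrable_on(2)[OF q(2) p] q(3) by (intro integral_nonneg) auto
      qed
      finally show "(I j) powr p \<le> (2 * real R) powr p * integral (?W j) (\<lambda>x. q x powr p)" .
    qed simp
    finally show ?thesis .
  qed
  have sum_c: "(\<Sum>j\<in>J. c j) \<le> ((2 * real R) ^ (n + 1) * (2 * real R + 1)) powr p * (LINT x|lebesgue. q x powr p)"
    if "finite J" for J
  proof -
    have "(\<Sum>j\<in>J. c j) = ((2 * real R) ^ n) powr p * ((2 * real R) powr p * (\<Sum>j\<in>J. integral (?W j) (\<lambda>x. q x powr p)))"
      by (simp add: c_def sum_distrib_left)
    also have "\<dots> \<le> ((2 * real R) ^ n) powr p * ((2 * real R) powr p * (real (2 * R + 1) * (LINT x|lebesgue. q x powr p)))"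
      by (intro mult_left_mono sum_integral_overlap that qp int_window_card) auto
    also have "\<dots> \<le> ((2 * real R) ^ n) powr p * ((2 * real R) powr p * ((2 * real R + 1) powr p * (LINT x|lebesgue. q x powr p)))"
    proof (intro mult_left_mono mult_right_mono)
      have "(2 * real R + 1) powr 1 \<le> (2 * real R + 1) powr p" using p by (intro powr_mono) auto
      then show "real (2 * R + 1) \<le> (2 * real R + 1) powr p" by (simp add: add.commute)
    qed auto
    also have "\<dots> = ((2 * real R) ^ (n + 1) * (2 * real R + 1)) powr p * (LINT x|lebesgue. q x powr p)"
    proof -
      have "(2 * real R) ^ (n + 1) = (2 * real R) ^ n * (2 * real R)" by simp
      then show ?thesis by (simp only:) (simp add: powr_mult)
    qed
    finally show ?thesis .
  qed
  have Hm: "H k \<in> borel_measurable lebesgue"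
  proof -
    have "isCont (H k) x" for x
    proof (cases "k < n")
      case True
      then show ?thesis using H by (auto simp: deriv_chain_def intro: DERIV_isCont)
    next
      case False
      then have "k = n" using k by simp
      then show ?thesis using AC_isCont[OF riesz_bounded_AC[OF incr_bounded_riesz_bounded[OF q p] p]] by simp
    qed
    then have "H k \<in> borel_measurable borel"
      by (intro borel_measurable_continuous_onI) (simp add: continuous_at_imp_continuous_on)
    then show ?thesis by (simp add: measurable_completion)
  qed
  have pm: "(\<lambda>x. \<bar>H k x\<bar> powr p) \<in> borel_measurable lebesgue" using Hm by measurable
  note cells = integrable_unit_cells[OF pm _ bound sum_c]
  show "H k \<in> Lp_space p" using Hm cells(1) by (simp add: Lp_space_def)
  have "Lp_norm p (H k) \<le> (((2 * real R) ^ (n + 1) * (2 * real R + 1)) powr p * (LINT x|lebesgue. q x powr p)) powr (1 / p)"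
    unfolding Lp_norm_def[of p "H k"] using p cells(2) by (intro powr_mono2) auto
  also have "\<dots> = (2 * real R) ^ (n + 1) * (2 * real R + 1) * (LINT x|lebesgue. q x powr p) powr (1 / p)"
    using p by (intro powr_scale_root) auto
  also have "(LINT x|lebesgue. q x powr p) powr (1 / p) = Lp_norm p q" using q(3) by (simp add: Lp_norm_def)
  finally show "Lp_norm p (H k) \<le> (2 * real R) ^ (n + 1) * (2 * real R + 1) * Lp_norm p q" .
qed

lemma incr_bounded_diff:
  assumes "incr_bounded G a" "incr_bounded H b" "\<And>s t. a integrable_on {s..t}" "\<And>s t. b integrable_on {s..t}"
  shows "incr_bounded (\<lambda>x. G x - H x) (\<lambda>x. b x + a x)"
  unfolding incr_bounded_def
proof (intro allI impI)
  fix x y :: real assume "x \<le> y"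
  then have "\<bar>G y - G x\<bar> \<le> integral {x..y} a" "\<bar>H y - H x\<bar> \<le> integral {x..y} b"
    using assms(1,2) by (auto simp: incr_bounded_def)
  moreover have "integral {x..y} (\<lambda>x. b x + a x) = integral {x..y} b + integral {x..y} a"
    by (intro integral_add assms)
  ultimately show "\<bar>(G y - H y) - (G x - H x)\<bar> \<le> integral {x..y} (\<lambda>x. b x + a x)" by linarith
qed

lemma sum_binomial_real: "(\<Sum>r\<le>k. real (k choose r)) = 2 ^ k"
  using choose_row_sum[of k] by (metis of_nat_numeral of_nat_power of_nat_sum)

text \<open>\<open>2 ^ m\<close> bounds the sum of the binomial coefficients; \<open>4 * b\<close>
  is the \<open>2 * b\<close> of the local product rule times 2, as \<open>S\<close> dominates a
  derivative and the next one. The derivative of \<open>F\<close> of order \<open>m - 1\<close> is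
  merely absolutely continuous, so the top bound concerns increments.\<close>

lemma cutoff_product:
  fixes \<theta> :: "nat \<Rightarrow> real \<Rightarrow> real"
  assumes F: "F \<in> Sobolev m p" and m: "m \<ge> 1" and p: "p > 1"
    and \<theta>: "deriv_chain m \<theta>" "\<forall>k\<le>m. \<forall>x. \<bar>\<theta> k x\<bar> \<le> b"
  defines "W \<equiv> \<lambda>k x. \<Sum>r\<le>k. real (k choose r) * ((deriv ^^ r) F x * \<theta> (k - r) x)"
    and "S \<equiv> \<lambda>x. \<Sum>r\<le>m. \<bar>(deriv ^^ r) F x\<bar>"
  shows "deriv_chain (m - 1) W" "incr_bounded (W (m - 1)) (\<lambda>x. 2 ^ m * (4 * b) * S x)"
    "\<And>k x. k \<le> m - 1 \<Longrightarrow> \<bar>W k x\<bar> \<le> 2 ^ m * (4 * b) * S x"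
    "\<And>k. k \<le> m - 1 \<Longrightarrow> W k \<in> borel_measurable lebesgue"
proof -
  have Lp: "(deriv ^^ r) F \<in> Lp_space p" if "r \<le> m" for r using Sobolev_Lp[OF F that] .
  have b: "b \<ge> 0" using \<theta>(2)[rule_format, of 0 0] by simp
  have SLp: "S \<in> Lp_space p" unfolding S_def by (rule Lp_space_sum(1)) (use Lp p in auto)
  have Si: "S integrable_on {s..t}" for s t using Lp_integrable_on(1)[OF SLp p] .
  have le_S: "\<bar>(deriv ^^ r) F x\<bar> \<le> S x" if "r \<le> m" for r x
    unfolding S_def using that by (intro member_le_sum) auto
  have S0: "S x \<ge> 0" for x unfolding S_def by (simp add: sum_nonneg)
  have pow: "(2::real) ^ k \<le> 2 ^ m" if "k \<le> m - 1" for k using that by (intro power_increasing) auto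
  have Fch: "deriv_chain (m - 1) (\<lambda>k. (deriv ^^ k) F)" using F hom_Sobolev_deriv_chain by (auto simp: Sobolev_def)
  show "deriv_chain (m - 1) W"
    unfolding W_def by (rule deriv_chain_mult[OF Fch deriv_chain_mono[OF \<theta>(1)]]) simp
  show "\<bar>W k x\<bar> \<le> 2 ^ m * (4 * b) * S x" if k: "k \<le> m - 1" for k x
  proof -
    have "\<bar>W k x\<bar> \<le> (\<Sum>r\<le>k. real (k choose r) * (S x * b))"
      unfolding W_def
    proof (rule order_trans[OF sum_abs sum_mono])
      fix r assume "r \<in> {..k}"
      then have "\<bar>(deriv ^^ r) F x\<bar> * \<bar>\<theta> (k - r) x\<bar> \<le> S x * b"
        using k \<theta>(2) by (intro mult_mono le_S S0) auto
      then show "\<bar>real (k choose r) * ((deriv ^^ r) F x * \<theta> (k - r) x)\<bar> \<le> real (k choose r) * (S x * b)"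
        by (simp add: abs_mult mult_left_mono)
    qed
    also have "\<dots> = 2 ^ k * (S x * b)" by (simp only: sum_distrib_right[symmetric] sum_binomial_real)
    also have "\<dots> \<le> 2 ^ m * (4 * (S x * b))"
      by (rule mult_mono[OF pow[OF k]]) (use S0[of x] b in auto)
    finally show ?thesis by (simp add: mult_ac)
  qed
  show "W k \<in> borel_measurable lebesgue" if k: "k \<le> m - 1" for k
  proof -
    have "\<theta> j \<in> borel_measurable lebesgue" if "j \<le> m - 1" for j
    proof -
      have jm: "j < m" using that m by linarith
      have "isCont (\<theta> j) x" for x using \<theta>(1) jm by (auto simp: deriv_chain_def intro: DERIV_isCont)
      then have "\<theta> j \<in> borel_measurable borel"
        by (intro borel_measurable_continuous_onI) (simp add: continuous_at_imp_continuous_on)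
      then show ?thesis by (simp add: measurable_completion)
    qed
    moreover have "(deriv ^^ r) F \<in> borel_measurable lebesgue" if "r \<le> m" for r using Lp[OF that] by (simp add: Lp_space_def)
    ultimately show ?thesis
      unfolding W_def using k by (intro borel_measurable_sum borel_measurable_times borel_measurable_const) auto
  qed
  show "incr_bounded (W (m - 1)) (\<lambda>x. 2 ^ m * (4 * b) * S x)"
  proof (rule incr_bounded_of_local)
    show "(\<lambda>x. 2 ^ m * (4 * b) * S x) integrable_on {s..t}" for s t by (intro integrable_on_mult_right Si)
    fix x y :: real assume xy: "x \<le> y" "y \<le> x + 1"
    let ?n = "m - 1" and ?I = "integral {x..y} S"
    have I0: "?I \<ge> 0" using Si S0 by (intro integral_nonneg) auto
    have one: "\<bar>(deriv ^^ r) F y * \<theta> (?n - r) y - (deriv ^^ r) F x * \<theta> (?n - r) x\<bar> \<le> 4 * b * ?I" if r: "r \<le> ?n" for r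
    proof -
      have rm: "r < m" using r m by linarith
      have int: "(\<lambda>x. \<bar>(deriv ^^ j) F x\<bar>) integrable_on {s..t}" if "j \<le> m" for j s t
        using Lp_integrable_on(1)[OF Lp_space_abs[OF Lp[OF that]] p] .
      have lip: "\<bar>\<theta> (?n - r) t - \<theta> (?n - r) s\<bar> \<le> b * \<bar>t - s\<bar>" for s t
      proof -
        have "norm (\<theta> (?n - r) t - \<theta> (?n - r) s) \<le> b * norm (t - s)"
        proof (rule field_differentiable_bound[of UNIV])
          show "(\<theta> (?n - r) has_field_derivative \<theta> (Suc (?n - r)) z) (at z within UNIV)" for z
            using \<theta>(1) rm unfolding deriv_chain_def by auto
          show "norm (\<theta> (Suc (?n - r)) z) \<le> b" for z using \<theta>(2)[rule_format, of "Suc (?n - r)" z] rm by auto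
        qed auto
        then show ?thesis by simp
      qed
      have "\<bar>(deriv ^^ r) F y * \<theta> (?n - r) y - (deriv ^^ r) F x * \<theta> (?n - r) x\<bar>
        \<le> 2 * b * integral {x..y} (\<lambda>s. \<bar>(deriv ^^ r) F s\<bar> + \<bar>(deriv ^^ Suc r) F s\<bar>)"
        by (rule incr_bounded_mult_local[OF Sobolev_incr_bounded[OF F p rm] int _ int _ lip xy]) (use rm \<theta>(2) in auto)
      also have "\<dots> \<le> 2 * b * integral {x..y} (\<lambda>s. 2 * S s)"
      proof (intro mult_left_mono integral_le)
        show "(\<lambda>s. \<bar>(deriv ^^ r) F s\<bar> + \<bar>(deriv ^^ Suc r) F s\<bar>) integrable_on {x..y}"
          by (rule integrable_add[OF int int]) (use rm in auto)
        show "(\<lambda>s. 2 * S s) integrable_on {x..y}" by (intro integrable_on_mult_right Si)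
        show "\<bar>(deriv ^^ r) F s\<bar> + \<bar>(deriv ^^ Suc r) F s\<bar> \<le> 2 * S s" for s
          using le_S[of r s] le_S[of "Suc r" s] rm by linarith
      qed (use b in auto)
      finally show ?thesis by simp
    qed
    have "\<bar>W ?n y - W ?n x\<bar> \<le> (\<Sum>r\<le>?n. real (?n choose r) * (4 * b * ?I))"
      unfolding W_def sum_subtractf[symmetric] right_diff_distrib[symmetric]
    proof (rule order_trans[OF sum_abs sum_mono])
      fix r assume "r \<in> {..?n}"
      then show "\<bar>real (?n choose r) * ((deriv ^^ r) F y * \<theta> (?n - r) y - (deriv ^^ r) F x * \<theta> (?n - r) x)\<bar>
        \<le> real (?n choose r) * (4 * b * ?I)"
        unfolding abs_mult[of "real (?n choose r)"] abs_of_nat by (intro mult_left_mono one) auto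
    qed
    also have "\<dots> = 2 ^ ?n * (4 * b * ?I)" by (simp only: sum_distrib_right[symmetric] sum_binomial_real)
    also have "\<dots> \<le> 2 ^ m * (4 * b * ?I)" using pow[OF order_refl] b I0 by (intro mult_right_mono) auto
    also have "\<dots> = integral {x..y} (\<lambda>x. 2 ^ m * (4 * b) * S x)" by simp
    finally show "\<bar>W ?n y - W ?n x\<bar> \<le> integral {x..y} (\<lambda>x. 2 ^ m * (4 * b) * S x)" .
  qed
qed

section \<open>The operator on the inhomogeneous space\<close>

text \<open>\<open>P\<close> is the constant of \<open>dense_zeros_Lp\<close> for
  \<open>n = m - 1\<close>, factors 2 come from \<open>Lp_space_add\<close>, and the summand
  \<open>C\<close> takes care of order \<open>m\<close>. One factor \<open>real m + 1\<close> counts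
  the orders in the norm, the other stems from \<open>Lp_space_sum\<close> applied to
  \<open>S\<close>.\<close>

lemma Sobolev_extension_bound:
  fixes \<theta> :: "nat \<Rightarrow> real \<Rightarrow> real"
  assumes m: "m \<ge> 1" and p: "p > 1" and C: "C > 0" and F: "F \<in> Sobolev m p"
    and \<theta>: "deriv_chain m \<theta>" "\<forall>k\<le>m. \<forall>x. \<bar>\<theta> k x\<bar> \<le> b"
    and T: "hom_extends m C E T" and E: "\<forall>j :: int. \<exists>x\<in>{of_int j - 1..of_int j + 1}. x \<in> E"
    and f: "\<forall>x\<in>E. f x = F x * \<theta> 0 x"
  defines "P \<equiv> (2 * real (3 * (m - 1) + 5)) ^ m * (2 * real (3 * (m - 1) + 5) + 1)"
  shows "T f 0 \<in> Sobolev m p" "\<And>x. x \<in> E \<Longrightarrow> T f 0 x = f x"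
    "Sobolev_norm m p (T f 0)
       \<le> (real m + 1) * (2 * (2 * P * (1 + C) + 1) + C) * (2 ^ m * (4 * b)) * (real m + 1) * Sobolev_norm m p F"
proof -
  let ?G = "T f"
  define W where "W = (\<lambda>k x. \<Sum>r\<le>k. real (k choose r) * ((deriv ^^ r) F x * \<theta> (k - r) x))"
  define S where "S = (\<lambda>x. \<Sum>r\<le>m. \<bar>(deriv ^^ r) F x\<bar>)"
  define h where "h = (\<lambda>x. 2 ^ m * (4 * b) * S x)"
  define g where "g = (deriv ^^ m) (?G 0)"
  define Nh where "Nh = Lp_norm p h"
  have W: "deriv_chain (m - 1) W" "incr_bounded (W (m - 1)) h"
    "\<And>k x. k \<le> m - 1 \<Longrightarrow> \<bar>W k x\<bar> \<le> h x" "\<And>k. k \<le> m - 1 \<Longrightarrow> W k \<in> borel_measurable lebesgue"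
    unfolding W_def h_def S_def
    by (rule cutoff_product(1)[OF F m p \<theta>], rule cutoff_product(2)[OF F m p \<theta>],
        erule cutoff_product(3)[OF F m p \<theta>], erule cutoff_product(4)[OF F m p \<theta>])
  have b: "b \<ge> 0" using \<theta>(2)[rule_format, of 0 0] by simp
  have S0: "S x \<ge> 0" for x unfolding S_def by (simp add: sum_nonneg)
  have h0: "h x \<ge> 0" for x using S0 b by (simp add: h_def)
  have FLp: "(deriv ^^ r) F \<in> Lp_space p" if "r \<in> {..m}" for r using Sobolev_Lp[OF F] that by simp
  have SLp: "S \<in> Lp_space p" "Lp_norm p S \<le> real (card {..m}) * Sobolev_norm m p F"
  proof -
    show "S \<in> Lp_space p" unfolding S_def by (rule Lp_space_sum(1)) (use FLp p in auto)
    show "Lp_norm p S \<le> real (card {..m}) * Sobolev_norm m p F"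
      unfolding S_def Sobolev_norm_def by (rule Lp_space_sum(2)) (use FLp p in auto)
  qed
  have hLp: "h \<in> Lp_space p" unfolding h_def by (rule Lp_space_cmult[OF SLp(1) p])
  have Nh: "Nh \<le> 2 ^ m * (4 * b) * ((real m + 1) * Sobolev_norm m p F)"
    unfolding Nh_def h_def Lp_space_cmult(2)[OF SLp(1) p] using SLp(2) b
    by (simp add: abs_mult mult_left_mono add.commute)
  have Nh0: "Nh \<ge> 0" by (simp add: Nh_def Lp_norm_nonneg)
  have trace_rep: "trace_rep m E f p W h"
  proof -
    have "W 0 x = F x * \<theta> 0 x" for x by (simp add: W_def)
    then show ?thesis unfolding trace_rep_def using p W(1,2) hLp h0 f by auto
  qed
  have G: "deriv_chain (m - 1) ?G" "\<And>x. x \<in> E \<Longrightarrow> ?G 0 x = f x"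
    "riesz_bounded p (C powr p * (LINT x|lebesgue. h x powr p)) (?G (m - 1))"
    using T trace_rep unfolding hom_extends_def by blast+
  note hom = riesz_bounded_hom_Sobolev[OF G(1) m G(3) p]
  show "\<And>x. x \<in> E \<Longrightarrow> T f 0 x = f x" by (rule G(2))
  have Gk: "(deriv ^^ k) (?G 0) = ?G k" if "k \<le> m - 1" for k by (rule deriv_chain_deriv[OF G(1) that])
  have gLp: "g \<in> Lp_space p" using hom(1) by (simp add: hom_Sobolev_def g_def)
  have Ng: "Lp_norm p g \<le> C * Nh"
  proof -
    have "Lp_norm p g \<le> (C powr p * (LINT x|lebesgue. h x powr p)) powr (1 / p)"
      using hom(2) by (simp add: hom_Sobolev_seminorm_def g_def)
    also have "\<dots> = C * (LINT x|lebesgue. h x powr p) powr (1 / p)" using C p by (intro powr_scale_root) auto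
    also have "\<dots> = C * Nh" using h0 by (simp add: Nh_def Lp_norm_def)
    finally show ?thesis .
  qed
  define q where "q x = h x + \<bar>g x\<bar>" for x
  have qLp: "q \<in> Lp_space p" "Lp_norm p q \<le> 2 * (Nh + Lp_norm p g)"
  proof -
    have qm: "q \<in> borel_measurable lebesgue"
      unfolding q_def[abs_def] using hLp gLp by (intro borel_measurable_add borel_measurable_abs) (auto simp: Lp_space_def)
    have "\<bar>q x\<bar> \<le> \<bar>h x\<bar> + \<bar>g x\<bar>" for x by (simp add: q_def)
    from Lp_space_add[OF hLp gLp p qm this]
    show "q \<in> Lp_space p" "Lp_norm p q \<le> 2 * (Nh + Lp_norm p g)" by (auto simp: Nh_def)
  qed
  define H where "H k x = ?G k x - W k x" for k x
  have H: "deriv_chain (m - 1) H" unfolding H_def[abs_def] by (intro deriv_chain_diff G W)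
  have ibdH: "incr_bounded (H (m - 1)) q"
    unfolding H_def[abs_def] q_def[abs_def]
  proof (rule incr_bounded_diff)
    show "incr_bounded (?G (m - 1)) (\<lambda>x. \<bar>g x\<bar>)"
      using hom_Sobolev_incr_bounded[OF hom(1) m p] Gk[of "m - 1"] unfolding g_def by simp
  qed (use W(2) Lp_integrable_on(1)[OF hLp p] Lp_integrable_on(1)[OF Lp_space_abs[OF gLp] p] in auto)
  have zeros: "\<exists>x\<in>{of_int j - 1..of_int j + 1}. H 0 x = 0" for j :: int
  proof -
    obtain x where x: "x \<in> {of_int j - 1..of_int j + 1}" "x \<in> E" using E by blast
    have "H 0 x = 0" using G(2)[OF x(2)] f x(2) by (simp add: H_def W_def)
    then show ?thesis using x(1) by blast
  qed
  have q0: "q x \<ge> 0" for x using h0 by (simp add: q_def)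
  have P: "P \<ge> 0" by (simp add: P_def)
  have HLp: "H k \<in> Lp_space p" "Lp_norm p (H k) \<le> P * Lp_norm p q" if "k \<le> m - 1" for k
    using dense_zeros_Lp[OF H zeros ibdH qLp(1) q0 p that] m by (simp_all add: P_def)
  have GLp: "?G k \<in> Lp_space p" "Lp_norm p (?G k) \<le> 2 * (2 * P * (1 + C) + 1) * Nh" if k: "k \<le> m - 1" for k
  proof -
    have WLp: "W k \<in> Lp_space p" "Lp_norm p (W k) \<le> Nh"
    proof -
      have le: "\<bar>W k x\<bar> \<le> \<bar>h x\<bar>" for x using W(3)[OF k, of x] h0[of x] by simp
      show "W k \<in> Lp_space p" "Lp_norm p (W k) \<le> Nh"
        unfolding Nh_def by (rule Lp_space_mono[OF hLp W(4)[OF k] le p])+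
    qed
    have "?G k = (\<lambda>x. H k x + W k x)" by (simp add: H_def)
    then have Gm: "?G k \<in> borel_measurable lebesgue"
      using HLp(1)[OF k] WLp(1) by (auto simp: Lp_space_def intro: borel_measurable_add)
    have "\<bar>?G k x\<bar> \<le> \<bar>H k x\<bar> + \<bar>W k x\<bar>" for x by (simp add: H_def)
    note A = Lp_space_add[OF HLp(1)[OF k] WLp(1) p Gm this]
    show "?G k \<in> Lp_space p" by (rule A(1))
    have "Lp_norm p (?G k) \<le> 2 * (Lp_norm p (H k) + Lp_norm p (W k))" by (rule A(2))
    also have "\<dots> \<le> 2 * (P * (2 * (Nh + C * Nh)) + Nh)"
    proof -
      have "P * Lp_norm p q \<le> P * (2 * (Nh + C * Nh))" using qLp(2) Ng P by (intro mult_left_mono) auto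
      then show ?thesis using HLp(2)[OF k] WLp(2) by simp
    qed
    also have "\<dots> = 2 * (2 * P * (1 + C) + 1) * Nh" by (simp add: algebra_simps)
    finally show "Lp_norm p (?G k) \<le> 2 * (2 * P * (1 + C) + 1) * Nh" .
  qed
  let ?c = "2 * (2 * P * (1 + C) + 1) + C"
  have all: "(deriv ^^ k) (?G 0) \<in> Lp_space p \<and> Lp_norm p ((deriv ^^ k) (?G 0)) \<le> ?c * Nh" if "k \<le> m" for k
  proof (cases "k = m")
    case True
    have "C * Nh \<le> ?c * Nh" using P C Nh0 by (intro mult_right_mono) auto
    then show ?thesis using True gLp Ng by (simp add: g_def)
  next
    case False
    then have k: "k \<le> m - 1" using that by linarith
    have "2 * (2 * P * (1 + C) + 1) * Nh \<le> ?c * Nh" using C Nh0 by (intro mult_right_mono) auto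
    then show ?thesis using GLp[OF k] Gk[OF k] by simp
  qed
  show "?G 0 \<in> Sobolev m p" using hom(1) all by (simp add: Sobolev_def)
  have "Sobolev_norm m p (?G 0) \<le> (\<Sum>k\<le>m. ?c * Nh)"
    unfolding Sobolev_norm_def by (rule sum_mono) (use all in auto)
  also have "\<dots> = (real m + 1) * ?c * Nh" by (simp add: algebra_simps)
  also have "\<dots> \<le> (real m + 1) * ?c * (2 ^ m * (4 * b) * ((real m + 1) * Sobolev_norm m p F))"
    using P C by (intro mult_left_mono Nh) auto
  finally show "Sobolev_norm m p (?G 0)
     \<le> (real m + 1) * ?c * (2 ^ m * (4 * b)) * (real m + 1) * Sobolev_norm m p F" by (simp only: mult.assoc)
qed

theorem Sobolev_extension:
  assumes m: "m \<ge> 1"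
  obtains C where "C > 0" "\<And>E p. p > 1 \<Longrightarrow> \<exists>T. linear_extension_operator (Sobolev m p) E T \<and>
     (\<forall>f\<in>trace_space (Sobolev m p) E. Sobolev_norm m p (T f) \<le> C * trace_norm (Sobolev m p) (Sobolev_norm m p) E f)"
proof -
  obtain C where C: "C > 0" "\<And>E. \<exists>T. hom_extends m C E T" using hom_extension[OF m] by blast
  obtain \<sigma> B where \<sigma>: "deriv_chain m \<sigma>" "B \<ge> (1 :: real)"
    "\<And>x. x \<le> 0 \<Longrightarrow> \<sigma> 0 x = 0" "\<And>x. x \<ge> 1 \<Longrightarrow> \<sigma> 0 x = 1"
    "\<And>k x. 1 \<le> k \<Longrightarrow> k \<le> m \<Longrightarrow> x \<le> 0 \<or> x \<ge> 1 \<Longrightarrow> \<sigma> k x = 0"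
    "\<And>k x. k \<le> m \<Longrightarrow> \<bar>\<sigma> k x\<bar> \<le> B"
    using smoothstep_exists[of m] by blast
  define P where "P = (2 * real (3 * (m - 1) + 5)) ^ m * (2 * real (3 * (m - 1) + 5) + 1)"
  define K where "K = (real m + 1) * (2 * (2 * P * (1 + C) + 1) + C) * (2 ^ m * (4 * (1 + B))) * (real m + 1)"
  have K: "K > 0"
  proof -
    have "P \<ge> 0" by (simp add: P_def)
    then have "2 * (2 * P * (1 + C) + 1) + C > 0"
      using C(1) by (intro add_pos_pos mult_pos_pos add_nonneg_pos) auto
    then show ?thesis unfolding K_def using \<sigma>(2) by (intro mult_pos_pos) auto
  qed
  show thesis
  proof (rule that[OF K])
    fix E :: "real set" and p :: real assume p: "p > 1"
    \<comment> \<open>The cutoff, the enlarged set \<open>E'\<close> and the extension by 0 are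
      determined by \<open>E\<close> alone, which keeps the final operator linear. Every window of
      radius 1 around an integer meets \<open>E\<close> or has its centre added to
      \<open>E'\<close>.\<close>
    define v where "v j = (if E \<inter> {of_int j - 1..of_int j + 1} = {} then 0 else 1 :: real)" for j :: int
    have v01: "v j \<in> {0, 1}" for j by (simp add: v_def)
    obtain \<theta> where \<theta>: "deriv_chain m \<theta>" "\<forall>k\<le>m. \<forall>x. \<bar>\<theta> k x\<bar> \<le> 1 + B"
      "\<forall>j. \<theta> 0 (of_int j) = v j"
      "\<forall>j x. x \<in> {of_int j..<of_int j + 1} \<longrightarrow> v j = v (j + 1) \<longrightarrow> \<theta> 0 x = v j"
    proof -
      have "\<exists>\<theta>. deriv_chain m \<theta> \<and> (\<forall>k\<le>m. \<forall>x. \<bar>\<theta> k x\<bar> \<le> 1 + B) \<and> (\<forall>j. \<theta> 0 (of_int j) = v j) \<and>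
        (\<forall>j x. x \<in> {of_int j..<of_int j + 1} \<longrightarrow> v j = v (j + 1) \<longrightarrow> \<theta> 0 x = v j)"
        by (rule cutoff_chain) (fact v01 \<sigma>)+
      then show thesis using that by blast
    qed
    define E' where "E' = E \<union> {of_int j | j. v j = 0}"
    obtain T where T: "hom_extends m C E' T" using C(2) by blast
    define z where "z f x = (if x \<in> E then f x else 0)" for f :: "real \<Rightarrow> real" and x :: real
    \<comment> \<open>Both integers next to a point of \<open>E\<close> are within distance 1 of it
      and carry the value 1, so the cutoff is constant on that cell.\<close>
    have \<theta>E: "\<theta> 0 x = 1" if "x \<in> E" for x
    proof -
      have "x \<in> {of_int \<lfloor>x\<rfloor>..<of_int \<lfloor>x\<rfloor> + 1}" by (simp add: floor_correct)
      moreover from this have "v \<lfloor>x\<rfloor> = 1" "v (\<lfloor>x\<rfloor> + 1) = 1"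
      proof -
        have "x \<in> E \<inter> {of_int \<lfloor>x\<rfloor> - 1..of_int \<lfloor>x\<rfloor> + 1}" "x \<in> E \<inter> {of_int (\<lfloor>x\<rfloor> + 1) - 1..of_int (\<lfloor>x\<rfloor> + 1) + 1}"
          by (intro IntI that; simp; linarith)+
        then show "v \<lfloor>x\<rfloor> = 1" "v (\<lfloor>x\<rfloor> + 1) = 1" unfolding v_def by (metis empty_iff)+
      qed
      ultimately show ?thesis using \<theta>(4) by metis
    qed
    have E'_dense: "\<forall>j :: int. \<exists>x\<in>{of_int j - 1..of_int j + 1}. x \<in> E'"
    proof
      fix j :: int
      show "\<exists>x\<in>{of_int j - 1..of_int j + 1}. x \<in> E'"
      proof (cases "v j = 0")
        case True
        then show ?thesis by (intro bexI[of _ "of_int j"]) (auto simp: E'_def)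
      next
        case False
        then show ?thesis by (auto simp: v_def E'_def split: if_splits)
      qed
    qed
    have zF: "\<forall>x\<in>E'. z f x = F x * \<theta> 0 x" if "\<And>x. x \<in> E \<Longrightarrow> F x = f x" for f F
      using that \<theta>E \<theta>(3) by (auto simp: z_def E'_def)
    have main: "T (z f) 0 \<in> Sobolev m p \<and> (\<forall>x\<in>E. T (z f) 0 x = f x) \<and> Sobolev_norm m p (T (z f) 0) \<le> K * Sobolev_norm m p F"
      if F: "F \<in> Sobolev m p" "\<And>x. x \<in> E \<Longrightarrow> F x = f x" for f F
    proof -
      note B = Sobolev_extension_bound[OF m p C(1) F(1) \<theta>(1,2) T E'_dense zF[OF F(2)], folded P_def, folded K_def]
      have "T (z f) 0 x = f x" if "x \<in> E" for x
      proof -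
        have "x \<in> E'" "z f x = f x" using that by (simp_all add: E'_def z_def)
        then show ?thesis using B(2)[of x] by simp
      qed
      then show ?thesis using B(1,3) by blast
    qed
    have trace_rep: "\<exists>q D h. trace_rep m E' (z f) q D h" if tr: "f \<in> trace_space (Sobolev m p) E" for f
    proof -
      obtain F where F: "F \<in> Sobolev m p" "\<And>x. x \<in> E \<Longrightarrow> F x = f x" using tr by (auto simp: trace_space_def)
      have S: "T (z f) 0 \<in> hom_Sobolev m p" using main[OF F] by (simp add: Sobolev_def)
      note B = Sobolev_extension_bound(2)[OF m p C(1) F(1) \<theta>(1,2) T E'_dense zF[OF F(2)]]
      \<comment> \<open>Linearity of \<open>T\<close> requires some representation of
        \<open>z f\<close>; the extension just constructed is one itself.\<close>
      have "trace_rep m E' (z f) p (\<lambda>k. (deriv ^^ k) (T (z f) 0)) (\<lambda>x. \<bar>(deriv ^^ m) (T (z f) 0) x\<bar>)"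
        by (rule hom_Sobolev_trace_rep[OF S m p]) (use B in auto)
      then show ?thesis by blast
    qed
    have "linear_extension_operator (Sobolev m p) E (\<lambda>f. T (z f) 0)"
      unfolding linear_extension_operator_def
    proof (intro conjI ballI allI)
      fix f assume f: "f \<in> trace_space (Sobolev m p) E"
      then obtain F where F: "F \<in> Sobolev m p" "\<And>x. x \<in> E \<Longrightarrow> F x = f x" by (auto simp: trace_space_def)
      show "T (z f) 0 \<in> Sobolev m p" using main[OF F] by blast
      show "T (z f) 0 x = f x" if "x \<in> E" for x using main[OF F] that by blast
      show "T (z (\<lambda>x\<in>E. c * f x)) 0 = (\<lambda>x. c * T (z f) 0 x)" for c
      proof -
        have "\<forall>x\<in>E'. z (\<lambda>x\<in>E. c * f x) x = c * z f x" by (simp add: z_def)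
        then show ?thesis using T trace_rep[OF f] unfolding hom_extends_def by blast
      qed
      show "T (z (\<lambda>x\<in>E. f x + g x)) 0 = (\<lambda>x. T (z f) 0 x + T (z g) 0 x)" if g: "g \<in> trace_space (Sobolev m p) E" for g
      proof -
        have "\<forall>x\<in>E'. z (\<lambda>x\<in>E. f x + g x) x = z f x + z g x" by (simp add: z_def)
        then show ?thesis using T trace_rep[OF f] trace_rep[OF g] unfolding hom_extends_def by blast
      qed
    qed
    moreover have "Sobolev_norm m p (T (z f) 0) \<le> K * trace_norm (Sobolev m p) (Sobolev_norm m p) E f"
      if "f \<in> trace_space (Sobolev m p) E" for f
      by (rule trace_norm_bound[OF K that]) (use main in blast)
    ultimately show "\<exists>T. linear_extension_operator (Sobolev m p) E T \<and>
     (\<forall>f\<in>trace_space (Sobolev m p) E. Sobolev_norm m p (T f) \<le> K * trace_norm (Sobolev m p) (Sobolev_norm m p) E f)"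
      by blast
  qed
qed

theorem theorem1p10:
  fixes m :: nat
  assumes "m \<ge> 1"
  shows
    "(\<exists>C::real. \<forall>(E::real set) (p::real). closed E \<and> E \<noteq> {} \<and> 1 < p \<longrightarrow>
        (\<exists>T. linear_extension_operator (hom_Sobolev m p) E T \<and>
             (\<forall>f\<in>trace_space (hom_Sobolev m p) E.
                hom_Sobolev_seminorm m p (T f)
                  \<le> C * trace_norm (hom_Sobolev m p) (hom_Sobolev_seminorm m p) E f))) \<and>
     (\<exists>C::real. \<forall>(E::real set) (p::real). closed E \<and> E \<noteq> {} \<and> 1 < p \<longrightarrow>
        (\<exists>T. linear_extension_operator (Sobolev m p) E T \<and>
             (\<forall>f\<in>trace_space (Sobolev m p) E.
                Sobolev_norm m p (T f)
                  \<le> C * trace_norm (Sobolev m p) (Sobolev_norm m p) E f)))"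
proof (intro conjI)
  obtain C where C: "C > 0" "\<And>E. \<exists>T. hom_extends m C E T" using hom_extension[OF assms] by blast
  show "\<exists>C::real. \<forall>(E::real set) (p::real). closed E \<and> E \<noteq> {} \<and> 1 < p \<longrightarrow>
        (\<exists>T. linear_extension_operator (hom_Sobolev m p) E T \<and>
             (\<forall>f\<in>trace_space (hom_Sobolev m p) E.
                hom_Sobolev_seminorm m p (T f)
                  \<le> C * trace_norm (hom_Sobolev m p) (hom_Sobolev_seminorm m p) E f))"
  proof (intro exI[of _ C] allI impI)
    fix E :: "real set" and p :: real assume "closed E \<and> E \<noteq> {} \<and> 1 < p"
    then have p: "p > 1" by simp
    obtain T where T: "hom_extends m C E T" using C(2) by blast
    show "\<exists>T. linear_extension_operator (hom_Sobolev m p) E T \<and>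
             (\<forall>f\<in>trace_space (hom_Sobolev m p) E.
                hom_Sobolev_seminorm m p (T f)
                  \<le> C * trace_norm (hom_Sobolev m p) (hom_Sobolev_seminorm m p) E f)"
      using hom_Sobolev_extension[OF assms C(1) T p] by blast
  qed
  obtain K where "K > 0" "\<And>E p. p > 1 \<Longrightarrow> \<exists>T. linear_extension_operator (Sobolev m p) E T \<and>
     (\<forall>f\<in>trace_space (Sobolev m p) E. Sobolev_norm m p (T f) \<le> K * trace_norm (Sobolev m p) (Sobolev_norm m p) E f)"
    using Sobolev_extension[OF assms] by blast
  then show "\<exists>C::real. \<forall>(E::real set) (p::real). closed E \<and> E \<noteq> {} \<and> 1 < p \<longrightarrow>
        (\<exists>T. linear_extension_operator (Sobolev m p) E T \<and>
             (\<forall>f\<in>trace_space (Sobolev m p) E.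
                Sobolev_norm m p (T f)
                  \<le> C * trace_norm (Sobolev m p) (Sobolev_norm m p) E f))"
    by (intro exI[of _ K]) blast
qed

end
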